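(* Let $k\ge 2$ and $\Delta\ge 2$ be integers and let $\mathbf{z}=(\zeta_1,\ldots,\zeta_\Delta)\in\mathbb{R}_{\ge 0}^{\Delta}$ be a fixed vector with $\zeta_\Delta>0$ and $\sum_{i=1}^{\Delta}\zeta_i=1$. Define \[P(x):=\sum_{i=1}^{\Delta}\zeta_i x^i,\qquad Q(x):=\int_x^1\frac{(k-1)\,w\,P''(w)}{P'(w)^{k}}\,dw,\] and let $0<\alpha_{end}<1$ be the unique root in $(0,1)$ of the equation $\alpha=Q(\alpha)P'(\alpha)^{k-1}$. Then, for $H\sim\mathcal{H}(n,k,\mathbf{z})$, the algorithm RANDOM GREEDY run on $H$ produces a matching which, with high probability, covers all but $\bigl[P(\alpha_{end})+o(1)\bigr]n$ vertices of $H$ (as $n\to\infty$).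
   Context: A $k$-uniform hypergraph is a hypergraph all of whose edges have exactly $k$ vertices; a matching is a set of pairwise vertex-disjoint edges, and a vertex is covered by a matching if it lies in one of its edges. $\mathcal{H}(n,k,\mathbf{z})$ denotes the uniform probability distribution over all $k$-uniform hypergraphs on $n$ vertices having exactly $\zeta_i n$ vertices of degree $i$ for each $i=1,\ldots,\Delta$ (it is assumed that these quantities are integers and that the degree sum $n\sum_i i\zeta_i$ is divisible by $k$; floors and ceilings are ignored). Algorithm RANDOM GREEDY: given a hypergraph $H=(V,E)$, start with $M=\emptyset$; while $E\neq\emptyset$, select an edge $e\in E$ uniformly at random, add $e$ to $M$, and remove from $E$ every edge $e'$ with $e'\cap e\neq\emptyset$; output $M$. A sequence of events $A_n$ holds with high probability if $\Pr[A_n]\to 1$ as $n\to\infty$. *)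

theory Defs
  imports "HOL-Probability.Probability"
begin

type_synonym hypergraph = "nat set set"

definition uniform_hypergraph :: "nat \<Rightarrow> nat \<Rightarrow> hypergraph \<Rightarrow> bool" where
  "uniform_hypergraph n k E \<longleftrightarrow> (\<forall>e\<in>E. e \<subseteq> {..<n} \<and> card e = k)"

definition vertex_degree :: "hypergraph \<Rightarrow> nat \<Rightarrow> nat" where
  "vertex_degree E v = card {e\<in>E. v \<in> e}"

definition is_matching :: "hypergraph \<Rightarrow> hypergraph \<Rightarrow> bool" where
  "is_matching E M \<longleftrightarrow> M \<subseteq> E \<and> disjoint M"

definition uncovered :: "nat \<Rightarrow> hypergraph \<Rightarrow> nat set" where
  "uncovered n M = {..<n} - \<Union>M"

text \<open>
  \<open>d i\<close> is the number of vertices of degree \<open>i\<close>.  Each \<open>d i\<close> is the floor or the ceiling of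
  \<open>\<zeta> i * n\<close>; in particular \<open>d i = \<zeta> i * n\<close> whenever the latter is an integer.  The rounding
  keeps the notion non-vacuous for irrational \<open>\<zeta>\<close>.
\<close>

definition degree_profile ::
  "nat \<Rightarrow> nat \<Rightarrow> (nat \<Rightarrow> real) \<Rightarrow> nat \<Rightarrow> (nat \<Rightarrow> nat) \<Rightarrow> bool" where
  "degree_profile k \<Delta> \<zeta> n d \<longleftrightarrow>
     (\<forall>i\<in>{1..\<Delta>}. \<bar>real (d i) - \<zeta> i * real n\<bar> < 1) \<and>
     (\<Sum>i=1..\<Delta>. d i) = n \<and>
     k dvd (\<Sum>i=1..\<Delta>. i * d i)"

definition hypergraphs :: "nat \<Rightarrow> nat \<Rightarrow> nat \<Rightarrow> (nat \<Rightarrow> nat) \<Rightarrow> hypergraph set" where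
  "hypergraphs n k \<Delta> d =
     {E. uniform_hypergraph n k E \<and> (\<forall>i\<in>{1..\<Delta>}. card {v\<in>{..<n}. vertex_degree E v = i} = d i)}"

text \<open>
  \<open>pmf_of_set\<close> is unspecified on the empty set; for degree profiles as above \<open>hypergraphs n k \<Delta> d\<close>
  is non-empty once \<open>n\<close> is large.
\<close>

definition random_hypergraph ::
  "nat \<Rightarrow> nat \<Rightarrow> nat \<Rightarrow> (nat \<Rightarrow> nat) \<Rightarrow> hypergraph pmf" where
  "random_hypergraph n k \<Delta> d = pmf_of_set (hypergraphs n k \<Delta> d)"

text \<open>
  The tests for an infinite edge set and for an empty edge only serve to make the loop total:
  for finite sets of non-empty edges the chosen edge meets itself and is therefore removed.
\<close>

function greedy_loop :: "hypergraph \<Rightarrow> hypergraph \<Rightarrow> hypergraph pmf" where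
  "greedy_loop E M =
     (if E = {} \<or> infinite E \<or> {} \<in> E then return_pmf M
      else bind_pmf (pmf_of_set E) (\<lambda>e. greedy_loop {e'\<in>E. e' \<inter> e = {}} (insert e M)))"
  by pat_completeness auto
termination
proof (relation "Wellfounded.measure (\<lambda>(E, M). card E)")
  fix E M :: hypergraph and e
  assume *: "\<not> (E = {} \<or> infinite E \<or> {} \<in> E)" and "e \<in> set_pmf (pmf_of_set E)"
  then have "e \<in> E" and "e \<noteq> {}" by auto
  then have "{e'\<in>E. e' \<inter> e = {}} \<subset> E" by auto
  then show "(({e'\<in>E. e' \<inter> e = {}}, insert e M), (E, M)) \<in> Wellfounded.measure (\<lambda>(E, M). card E)"
    using * by (simp add: psubset_card_mono)
qed simp

declare greedy_loop.simps [simp del]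

definition random_greedy :: "hypergraph \<Rightarrow> hypergraph pmf" where
  "random_greedy E = greedy_loop E {}"

definition P_fun :: "nat \<Rightarrow> (nat \<Rightarrow> real) \<Rightarrow> real \<Rightarrow> real" where
  "P_fun \<Delta> \<zeta> x = (\<Sum>i=1..\<Delta>. \<zeta> i * x ^ i)"

definition Q_fun :: "nat \<Rightarrow> nat \<Rightarrow> (nat \<Rightarrow> real) \<Rightarrow> real \<Rightarrow> real" where
  "Q_fun k \<Delta> \<zeta> x =
     integral {x..1}
       (\<lambda>w. (real k - 1) * w * deriv (deriv (P_fun \<Delta> \<zeta>)) w / deriv (P_fun \<Delta> \<zeta>) w ^ k)"

definition is_end_root :: "nat \<Rightarrow> nat \<Rightarrow> (nat \<Rightarrow> real) \<Rightarrow> real \<Rightarrow> bool" where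
  "is_end_root k \<Delta> \<zeta> \<alpha> \<longleftrightarrow>
     0 < \<alpha> \<and> \<alpha> < 1 \<and> \<alpha> = Q_fun k \<Delta> \<zeta> \<alpha> * deriv (P_fun \<Delta> \<zeta>) \<alpha> ^ (k - 1)"

definition alpha_end :: "nat \<Rightarrow> nat \<Rightarrow> (nat \<Rightarrow> real) \<Rightarrow> real" where
  "alpha_end k \<Delta> \<zeta> = (THE \<alpha>. is_end_root k \<Delta> \<zeta> \<alpha>)"

end

theory Submission
  imports Defs
begin

text \<open>
  Split a vertex of degree \<open>i\<close> into \<open>i\<close> points and let the edges appear as consecutive \<open>k\<close>-tuples of
  a random permutation of the points; random greedy then accepts a tuple iff all its vertices are
  distinct and uncovered.  When \<open>T = s N\<close> of the \<open>N\<close> points are still unrevealed, let \<open>B\<^sub>i\<close> be the sum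
  of \<open>r choose i\<close> over the uncovered vertices, \<open>r\<close> being the number of unrevealed points of the
  vertex.  A tuple changes \<open>B\<^sub>i\<close> by \<open>- (k / T) (i B\<^sub>i + (i + 1) (B\<^sub>1 / T) ^ (k - 1) B\<^sub>i\<^sub>+\<^sub>1)\<close> in the mean,
  up to \<open>O(1 / T)\<close>.  This system is solved by \<open>n s ^ i P\<^sup>(\<^sup>i\<^sup>)(\<alpha> s) / i!\<close>, where \<open>\<alpha> 1 = 1\<close> and
  \<open>\<alpha>' = (P' \<alpha> / P' 1) ^ (k - 1)\<close>, and integration by parts in \<open>Q\<close> shows that \<open>\<alpha> 0\<close> is the end root.

  The squared distance \<open>\<Phi>\<close> between the \<open>B\<^sub>i\<close> and this solution satisfies
  \<open>E exp (\<theta> \<Phi>' / n) \<le> exp (\<theta> (1 + c / n) \<Phi> / n + c / n)\<close>, so deviations of order \<open>n\<close> have exponentially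
  small probability as long as \<open>T \<ge> \<sigma> N\<close>; the last \<open>\<sigma> N\<close> points cover at most \<open>\<sigma> N\<close> further vertices.
  A greedy construction with switchings shows that the permutations yielding a simple hypergraph
  are at least a polynomially small fraction of all, so the exponential bound survives conditioning
  on simplicity.
\<close>

section \<open>Random greedy as a scan of a random edge order\<close>

text \<open>The conditioning on simplicity dictates the shape of the proof. A uniform simple
  hypergraph is reached by conditioning the permutation model, and the elementary bound for the
  probability of that condition is about \<open>N ^ (- 2 * C0)\<close>, polynomially small. A
  variance estimate of the failure would be lost in this factor, an exponentially small bound is
  not. Hence an exponential moment, which has to survive of the order of n steps; it does because
  the mean increment of \<Phi> is O(\<Phi> / n + 1) and its squared increments are O(\<Phi> + 1), so
  that a step costs only a factor \<open>1 + c / n\<close> in the exponent. Conditioning gives the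
  right law since every ordered simple hypergraph with a given degree sequence is spelled by the
  same number of permutations; averaging over degree sequences is harmless because the bounds depend
  on the profile alone. Binomial moments instead of counts by residual degree make each limit a
  single Taylor coefficient of P at \<alpha>, times a power of s. The scan is stopped early because
  the error terms carry a factor \<open>1 / T\<close>.\<close>

definition greedy_step :: "nat set \<Rightarrow> hypergraph \<Rightarrow> hypergraph" where
  "greedy_step e M = (if e \<inter> \<Union>M = {} then insert e M else M)"

text \<open>Lets one random order serve all rounds of the loop: the survivors of a choice inherit a
  uniform order from it.\<close>

lemma filter_random_permutation:
  assumes "finite A"
  shows "map_pmf (filter P) (pmf_of_set (permutations_of_set A)) =
    pmf_of_set (permutations_of_set {x\<in>A. P x})"
proof -
  have "filter P = fst \<circ> partition P"
    by (auto simp: fun_eq_iff)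
  then have "map_pmf (filter P) (pmf_of_set (permutations_of_set A)) =
      map_pmf fst (map_pmf (partition P) (pmf_of_set (permutations_of_set A)))"
    by (simp add: pmf.map_comp)
  then show ?thesis
    using assms by (simp add: partition_random_permutations map_fst_pair_pmf)
qed

text \<open>Edges meeting \<open>e\<close> would be rejected anyway, since \<open>e\<close> stays in
  the matching from here on.\<close>

lemma fold_greedy_step_filter:
  assumes "e \<in> M"
  shows "fold greedy_step (filter (\<lambda>e'. e' \<inter> e = {}) es) M = fold greedy_step es M"
  using assms
proof (induction es arbitrary: M)
  case (Cons a es)
  have "e \<in> greedy_step a M"
    using Cons.prems by (auto simp: greedy_step_def)
  moreover have "greedy_step a M = M" if "a \<inter> e \<noteq> {}"
    using that Cons.prems by (auto simp: greedy_step_def)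
  ultimately show ?case
    using Cons by auto
qed simp

text \<open>Drawing a uniform edge reveals the head of a uniform order. By the third hypothesis
  \<open>E\<close> holds only live edges, so this head is always accepted.\<close>

lemma greedy_loop_eq_fold:
  assumes "finite E" "{} \<notin> E" "\<forall>e\<in>E. e \<inter> \<Union>M = {}"
  shows "greedy_loop E M =
    map_pmf (\<lambda>es. fold greedy_step es M) (pmf_of_set (permutations_of_set E))"
  using assms
proof (induction E M rule: greedy_loop.induct)
  case (1 E M)
  show ?case
  proof (cases "E = {}")
    case True
    then show ?thesis
      by (simp add: greedy_loop.simps pmf_of_set_singleton)
  next
    case False
    have *: "greedy_loop {e'\<in>E. e' \<inter> e = {}} (insert e M) =
        map_pmf (\<lambda>xs. fold greedy_step (e # xs) M) (pmf_of_set (permutations_of_set (E - {e})))"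
      if "e \<in> E" for e
    proof -
      have ne: "e \<noteq> {}" and M: "greedy_step e M = insert e M"
        using that 1 by (auto simp: greedy_step_def)
      \<comment> \<open>A nonempty \<open>e\<close> meets itself, so it is not among the survivors
        and these can be taken from \<open>E - {e}\<close>.\<close>
      have "{e'\<in>E. e' \<inter> e = {}} = {e'\<in>E - {e}. e' \<inter> e = {}}"
        using ne by auto
      then have "pmf_of_set (permutations_of_set {e'\<in>E. e' \<inter> e = {}}) =
          map_pmf (filter (\<lambda>e'. e' \<inter> e = {})) (pmf_of_set (permutations_of_set (E - {e})))"
        using 1 by (simp add: filter_random_permutation)
      moreover have "greedy_loop {e'\<in>E. e' \<inter> e = {}} (insert e M) =
          map_pmf (\<lambda>es. fold greedy_step es (insert e M))
            (pmf_of_set (permutations_of_set {e'\<in>E. e' \<inter> e = {}}))"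
        using 1 False that by (intro 1(1)) auto
      ultimately show ?thesis
        using M by (simp add: pmf.map_comp o_def fold_greedy_step_filter)
    qed
    have "greedy_loop E M = pmf_of_set E \<bind> (\<lambda>e. greedy_loop {e'\<in>E. e' \<inter> e = {}} (insert e M))"
      using False 1 by (subst greedy_loop.simps) auto
    also have "\<dots> = pmf_of_set E \<bind> (\<lambda>e.
        map_pmf (\<lambda>xs. fold greedy_step (e # xs) M) (pmf_of_set (permutations_of_set (E - {e}))))"
      using 1 False by (intro bind_pmf_cong * refl) auto
    also have "\<dots> = map_pmf (\<lambda>es. fold greedy_step es M) (pmf_of_set (permutations_of_set E))"
      using 1 False by (simp add: random_permutation_of_set map_bind_pmf map_pmf_def bind_assoc_pmf bind_return_pmf)
    finally show ?thesis .
  qed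
qed

lemma random_greedy_eq_fold:
  assumes "finite E" "{} \<notin> E"
  shows "random_greedy E =
    map_pmf (\<lambda>es. fold greedy_step es {}) (pmf_of_set (permutations_of_set E))"
  unfolding random_greedy_def using assms by (intro greedy_loop_eq_fold) auto

lemma fold_greedy_step_matching:
  assumes "disjoint M"
  shows "disjoint (fold greedy_step es M) \<and> fold greedy_step es M \<subseteq> M \<union> set es"
  using assms
proof (induction es arbitrary: M)
  case (Cons a es)
  have "disjoint (greedy_step a M)"
  proof (cases "a \<inter> \<Union>M = {}")
    case True
    then have "\<forall>X\<in>M. disjnt X a \<and> disjnt a X"
      by (auto simp: disjnt_def)
    then show ?thesis
      using Cons.prems by (simp add: greedy_step_def pairwise_insert)
  qed (use Cons.prems in \<open>simp add: greedy_step_def\<close>)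
  moreover have "greedy_step a M \<subseteq> M \<union> {a}"
    by (auto simp: greedy_step_def)
  ultimately show ?case
    using Cons.IH[of "greedy_step a M"] by (auto)
qed simp

lemma finite_uniform: "uniform_hypergraph n k E \<Longrightarrow> finite E"
  by (auto simp: uniform_hypergraph_def intro!: finite_subset[of E "Pow {..<n}"])

lemma empty_not_in_hypergraph:
  assumes "E \<in> hypergraphs n k \<Delta> d" "k \<ge> 1"
  shows "{} \<notin> E"
  using assms by (auto simp: hypergraphs_def uniform_hypergraph_def)

lemma random_greedy_is_matching:
  assumes "E \<in> hypergraphs n k \<Delta> d" "k \<ge> 1" "M \<in> set_pmf (random_greedy E)"
  shows "is_matching E M"
proof -
  have E: "finite E" "{} \<notin> E"
    using assms finite_uniform empty_not_in_hypergraph by (auto simp: hypergraphs_def)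
  then obtain es where "es \<in> permutations_of_set E" "M = fold greedy_step es {}"
    using assms(3) by (auto simp: random_greedy_eq_fold)
  then show ?thesis
    using fold_greedy_step_matching[of "{}" es]
    by (auto simp: is_matching_def permutations_of_set_def)
qed

section \<open>Sequences of disjoint tuples of points\<close>

definition tuples :: "nat \<Rightarrow> 'a set \<Rightarrow> 'a list set" where
  "tuples k A = {l. length l = k \<and> distinct l \<and> set l \<subseteq> A}"

text \<open>The first \<open>m\<close> blocks of a permutation of the points \<open>A\<close>, cut into \<open>k\<close>-tuples.\<close>

primrec seqs :: "nat \<Rightarrow> nat \<Rightarrow> 'a set \<Rightarrow> 'a list list set" where
  "seqs k 0 A = {[]}"
| "seqs k (Suc m) A = (\<Union>l\<in>tuples k A. (#) l ` seqs k m (A - set l))"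

lemma finite_tuples: "finite A \<Longrightarrow> finite (tuples k A)"
  by (rule finite_subset[OF _ finite_lists_length_eq[of A k]]) (auto simp: tuples_def)

lemma finite_seqs: "finite A \<Longrightarrow> finite (seqs k m A)"
  by (induction m arbitrary: A) (auto simp: finite_tuples)

lemma card_tuples_pos:
  assumes "finite A" "k \<le> card A"
  shows "card (tuples k A) > 0"
proof -
  obtain B where B: "B \<subseteq> A" "card B = k"
    using assms by (meson obtain_subset_with_card_n)
  then obtain l where "set l = B" "distinct l"
    using finite_distinct_list finite_subset[OF B(1) assms(1)] by blast
  then have "l \<in> tuples k A"
    using B distinct_card[of l] by (auto simp: tuples_def)
  then show ?thesis
    using finite_tuples[OF assms(1)] by (auto simp: card_gt_0_iff)
qed

lemma sum_seqs_Suc: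
  fixes f :: "'a list list \<Rightarrow> 'b::comm_monoid_add"
  assumes "finite A"
  shows "(\<Sum>ls\<in>seqs k (Suc m) A. f ls) =
    (\<Sum>l\<in>tuples k A. \<Sum>ls\<in>seqs k m (A - set l). f (l # ls))"
proof -
  have "(\<Sum>ls\<in>seqs k (Suc m) A. f ls) = (\<Sum>l\<in>tuples k A. \<Sum>ls\<in>(#) l ` seqs k m (A - set l). f ls)"
    unfolding seqs.simps
    using assms by (intro sum.UNION_disjoint) (auto simp: finite_tuples finite_seqs)
  also have "\<dots> = (\<Sum>l\<in>tuples k A. \<Sum>ls\<in>seqs k m (A - set l). f (l # ls))"
    by (rule sum.cong[OF refl]) (simp add: sum.reindex)
  finally show ?thesis .
qed

lemma in_seqs_iff:
  "ls \<in> seqs k m A \<longleftrightarrow>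
    length ls = m \<and> (\<forall>l\<in>set ls. length l = k) \<and> distinct (concat ls) \<and> set (concat ls) \<subseteq> A"
proof (induction m arbitrary: A ls)
  case (Suc m)
  show ?case
  proof (cases ls)
    case (Cons l ls')
    show ?thesis
      unfolding Cons seqs.simps using Suc[of ls' "A - set l"] by (auto simp: tuples_def)
  qed auto
qed auto

section \<open>Residual degrees and the sequences that spell given edges\<close>

definition rem :: "('v \<times> 'b) set \<Rightarrow> 'v \<Rightarrow> nat" where
  "rem A v = card {x\<in>A. fst x = v}"

lemma card_lists_over:
  assumes "finite A" "distinct ws"
  shows "card {l. map fst l = ws \<and> set l \<subseteq> A} = (\<Prod>v\<in>set ws. rem A v)"
  using assms(2)
proof (induction ws)
  case Nil
  have "{l. map fst l = [] \<and> set l \<subseteq> A} = {[]}"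
    by auto
  then show ?case
    by (metis card.empty card.insert empty_iff finite.emptyI list.set(1) prod.empty One_nat_def)
next
  case (Cons w ws)
  have "{l. map fst l = w # ws \<and> set l \<subseteq> A} =
      (\<lambda>(x, l). x # l) ` ({x\<in>A. fst x = w} \<times> {l. map fst l = ws \<and> set l \<subseteq> A})"
    by (auto simp: image_iff map_eq_Cons_conv)
  moreover have "inj_on (\<lambda>(x, l). x # l) ({x\<in>A. fst x = w} \<times> {l. map fst l = ws \<and> set l \<subseteq> A})"
    by (auto simp: inj_on_def)
  ultimately have "card {l. map fst l = w # ws \<and> set l \<subseteq> A} =
      rem A w * card {l. map fst l = ws \<and> set l \<subseteq> A}"
    by (simp add: card_image card_cartesian_product rem_def)
  then show ?case
    using Cons by simp
qed

definition edge_tuples :: "nat \<Rightarrow> 'v set \<Rightarrow> ('v \<times> 'b) set \<Rightarrow> ('v \<times> 'b) list set" where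
  "edge_tuples k e A = {l\<in>tuples k A. distinct (map fst l) \<and> fst ` set l = e}"

text \<open>A tuple over \<open>e\<close> is an order of \<open>e\<close> together with a point for
  each vertex; distinct vertices make the points distinct by themselves.\<close>

lemma card_edge_tuples:
  assumes "finite A" "finite e" "card e = k"
  shows "card (edge_tuples k e A) = fact k * (\<Prod>v\<in>e. rem A v)"
proof -
  have eq: "edge_tuples k e A = (\<Union>ws\<in>permutations_of_set e. {l. map fst l = ws \<and> set l \<subseteq> A})"
    using assms by (force simp: edge_tuples_def tuples_def permutations_of_set_def distinct_map
        dest: distinct_card)
  have "finite {l. map fst l = ws \<and> set l \<subseteq> A}" for ws
    by (rule finite_subset[OF _ finite_lists_length_eq[OF assms(1), of "length ws"]]) auto
  then have "card (edge_tuples k e A) =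
      (\<Sum>ws\<in>permutations_of_set e. card {l. map fst l = ws \<and> set l \<subseteq> A})"
    unfolding eq using assms by (intro card_UN_disjoint) auto
  also have "\<dots> = (\<Sum>ws\<in>permutations_of_set e. \<Prod>v\<in>e. rem A v)"
    using assms by (intro sum.cong refl) (auto simp: card_lists_over permutations_of_set_def)
  finally show ?thesis
    using assms by simp
qed

definition edge_seqs :: "nat \<Rightarrow> 'v set list \<Rightarrow> ('v \<times> 'b) set \<Rightarrow> ('v \<times> 'b) list list set" where
  "edge_seqs k es A = {ls\<in>seqs k (length es) A.
     list_all2 (\<lambda>l e. distinct (map fst l) \<and> fst ` set l = e) ls es}"

lemma card_fst_eq:
  assumes "distinct (map fst l)"
  shows "card {x\<in>set l. fst x = v} = (if v \<in> fst ` set l then 1 else 0)"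
proof (cases "v \<in> fst ` set l")
  case True
  then obtain x where "x \<in> set l" "fst x = v"
    by auto
  then have "{x\<in>set l. fst x = v} = {x}"
    using assms by (auto simp: distinct_map inj_on_def)
  then show ?thesis
    using True by simp
next
  case False
  then have "{x\<in>set l. fst x = v} = {}"
    by force
  then show ?thesis
    using False by (simp only: card.empty if_False)
qed

lemma rem_Diff_tuple:
  assumes "finite A" "l \<in> edge_tuples k e A"
  shows "rem (A - set l) v = rem A v - (if v \<in> e then 1 else 0)"
proof -
  have l: "set l \<subseteq> A" "distinct (map fst l)" "fst ` set l = e"
    using assms by (auto simp: edge_tuples_def tuples_def)
  have "card {x\<in>set l. fst x = v} = (if v \<in> e then 1 else 0)"
    using card_fst_eq[OF l(2)] l(3) by simp
  moreover have "{x\<in>A - set l. fst x = v} = {x\<in>A. fst x = v} - {x\<in>set l. fst x = v}"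
    by auto
  moreover have "{x\<in>set l. fst x = v} \<subseteq> {x\<in>A. fst x = v}"
    using l by auto
  ultimately show ?thesis
    unfolding rem_def by (simp add: card_Diff_subset)
qed

text \<open>The count does not see how the edges are arranged, only their number and the degrees. So
  a uniform sequence, conditioned on being simple, yields a uniform hypergraph with the given
  degrees. The tuple for \<open>e\<close> contributes \<open>rem A v\<close> for each vertex of
  \<open>e\<close>, the top factor of the factorial of the residual degree.\<close>

lemma card_edge_seqs:
  fixes A :: "('v \<times> 'b) set"
  assumes "finite V" "finite A"
    and "\<And>v. v \<in> V \<Longrightarrow> rem A v = length (filter (\<lambda>e. v \<in> e) es)"
    and "\<And>e. e \<in> set es \<Longrightarrow> e \<subseteq> V \<and> card e = k"
  shows "card (edge_seqs k es A) = fact k ^ length es * (\<Prod>v\<in>V. fact (rem A v))"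
  using assms(2-)
proof (induction es arbitrary: A)
  case Nil
  have "edge_seqs k [] A = {[]}"
    by (auto simp: edge_seqs_def)
  then show ?case
    using Nil by simp
next
  case (Cons e es)
  have e: "e \<subseteq> V" "card e = k" "finite e"
    using Cons.prems(3)[of e] finite_subset[OF _ assms(1)] by auto
  define K :: nat where "K = fact k ^ length es * (\<Prod>v\<in>V. fact (rem A v - (if v \<in> e then 1 else 0)))"
  have eq: "edge_seqs k (e # es) A = (\<Union>l\<in>edge_tuples k e A. (#) l ` edge_seqs k es (A - set l))"
    by (auto simp: edge_seqs_def edge_tuples_def list_all2_Cons2)
  have card: "card (edge_seqs k es (A - set l)) = K" if "l \<in> edge_tuples k e A" for l
  proof -
    have "card (edge_seqs k es (A - set l)) = fact k ^ length es * (\<Prod>v\<in>V. fact (rem (A - set l) v))"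
      using Cons.prems that by (intro Cons.IH) (auto simp: rem_Diff_tuple)
    then show ?thesis
      using that Cons.prems by (simp add: K_def rem_Diff_tuple)
  qed
  have fin: "finite (edge_tuples k e A)" "finite (edge_seqs k es (A - set l))" for l
    using Cons.prems by (auto simp: edge_tuples_def edge_seqs_def finite_tuples finite_seqs)
  have "card (edge_seqs k (e # es) A) = (\<Sum>l\<in>edge_tuples k e A. card ((#) l ` edge_seqs k es (A - set l)))"
    unfolding eq using fin by (intro card_UN_disjoint) auto
  also have "\<dots> = card (edge_tuples k e A) * K"
    by (simp add: card_image card)
  also have "\<dots> = fact k ^ length (e # es) * ((\<Prod>v\<in>e. rem A v) *
      (\<Prod>v\<in>V. fact (rem A v - (if v \<in> e then 1 else 0))))"
    using Cons.prems e by (simp add: card_edge_tuples K_def)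
  also have "(\<Prod>v\<in>e. rem A v) = (\<Prod>v\<in>V. if v \<in> e then rem A v else 1)"
    using e assms(1) by (simp add: prod.If_cases Int_absorb1)
  also have "(\<Prod>v\<in>V. if v \<in> e then rem A v else 1) *
      (\<Prod>v\<in>V. fact (rem A v - (if v \<in> e then 1 else 0))) = (\<Prod>v\<in>V. fact (rem A v) :: nat)"
    unfolding prod.distrib[symmetric]
  proof (intro prod.cong refl)
    fix v assume "v \<in> V"
    then have "v \<in> e \<Longrightarrow> rem A v > 0"
      using Cons.prems(2) by auto
    then show "(if v \<in> e then rem A v else 1) * fact (rem A v - (if v \<in> e then 1 else 0)) = (fact (rem A v) :: nat)"
      by (auto simp: fact_reduce)
  qed
  finally show ?case .
qed

section \<open>Counting linear sequences\<close>

text \<open>Positions with the same quotient by \<open>k\<close> form a block, i.e. an edge; the last block may be incomplete.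
  Linearity (two blocks share at most one vertex) is more than simplicity requires, but unlike
  simplicity it survives the switching in \<open>linear_word_swap\<close>.\<close>

definition share_block :: "nat \<Rightarrow> 'v list \<Rightarrow> 'v \<Rightarrow> 'v \<Rightarrow> bool" where
  "share_block k w x y \<longleftrightarrow> (\<exists>p<length w. \<exists>q<length w. p div k = q div k \<and> w ! p = x \<and> w ! q = y)"

definition linear_word :: "nat \<Rightarrow> 'v list \<Rightarrow> bool" where
  "linear_word k w \<longleftrightarrow>
    (\<forall>p<length w. \<forall>q<length w. p \<noteq> q \<and> p div k = q div k \<longrightarrow> w ! p \<noteq> w ! q) \<and>
    (\<forall>p<length w. \<forall>q<length w. \<forall>p'<length w. \<forall>q'<length w.
       p \<noteq> q \<and> p div k = q div k \<and> p' div k = q' div k \<and> w ! p = w ! p' \<and> w ! q = w ! q'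
         \<longrightarrow> p div k = p' div k)"

section \<open>Appending to a linear word and switching inside it\<close>

lemma share_block_sym: "share_block k w x y \<Longrightarrow> share_block k w y x"
  unfolding share_block_def by metis

lemma adjI: "p < length w \<Longrightarrow> q < length w \<Longrightarrow> p div k = q div k \<Longrightarrow> share_block k w (w ! p) (w ! q)"
  unfolding share_block_def by metis

lemma linear_wordD1:
  "linear_word k w \<Longrightarrow> p < length w \<Longrightarrow> q < length w \<Longrightarrow> p \<noteq> q \<Longrightarrow> p div k = q div k \<Longrightarrow> w ! p \<noteq> w ! q"
  unfolding linear_word_def by blast

lemma linear_wordD2:
  "linear_word k w \<Longrightarrow> p < length w \<Longrightarrow> q < length w \<Longrightarrow> p' < length w \<Longrightarrow> q' < length w \<Longrightarrow>
    p \<noteq> q \<Longrightarrow> p div k = q div k \<Longrightarrow> p' div k = q' div k \<Longrightarrow> w ! p = w ! p' \<Longrightarrow> w ! q = w ! q' \<Longrightarrow>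
    p div k = p' div k"
  unfolding linear_word_def by blast

text \<open>A violation has to use the new position; its two vertices, \<open>y\<close> and a vertex
  of the open block, would then share an older block as well.\<close>

lemma linear_word_append:
  assumes lin: "linear_word k w"
    and new: "\<And>q. q < length w \<Longrightarrow> q div k = length w div k \<Longrightarrow> \<not> share_block k w y (w ! q)"
    and new': "\<And>q. q < length w \<Longrightarrow> q div k = length w div k \<Longrightarrow> w ! q \<noteq> y"
  shows "linear_word k (w @ [y])"
proof -
  define m where "m = length w"
  define w' where "w' = w @ [y]"
  have w': "w' ! p = w ! p" if "p < m" for p
    using that by (simp add: w'_def m_def nth_append)
  have w'm: "w' ! m = y"
    by (simp add: w'_def m_def)
  have L1: "w' ! p \<noteq> w' ! q" if "p \<le> m" "q \<le> m" "p \<noteq> q" "p div k = q div k" for p q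
  proof (cases "p = m \<or> q = m")
    case True
    then show ?thesis
      using that new' w' w'm unfolding m_def by (metis le_neq_implies_less)
  next
    case False
    then show ?thesis
      using that linear_wordD1[OF lin, of p q] w' unfolding m_def by simp
  qed
  \<comment> \<open>Violations whose first position is the new one suffice; the other cases follow
    by exchanging the two pairs or the two positions of each pair.\<close>
  have *: "p div k = p' div k"
    if "p = m" "q \<le> m" "p' \<le> m" "q' \<le> m" "p \<noteq> q" "p div k = q div k" "p' div k = q' div k"
      "w' ! p = w' ! p'" "w' ! q = w' ! q'" for p q p' q'
  proof (rule ccontr)
    assume "p div k \<noteq> p' div k"
    then have "p' < m" "q' < m" "q < m"
      using that by (auto simp: order.strict_iff_order)
    then have "share_block k w y (w ! q)"
      using that w' w'm by (metis adjI m_def)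
    then show False
      using new[of q] \<open>q < m\<close> that by (simp add: m_def)
  qed
  have L2: "p div k = p' div k"
    if asm: "p \<le> m" "q \<le> m" "p' \<le> m" "q' \<le> m" "p \<noteq> q" "p div k = q div k" "p' div k = q' div k"
      "w' ! p = w' ! p'" "w' ! q = w' ! q'" for p q p' q'
  proof -
    have "p' \<noteq> q'"
      using asm L1[of p q] by metis
    consider "p = m" | "q = m" | "p' = m" | "q' = m" | "p < m" "q < m" "p' < m" "q' < m"
      using asm by (auto simp: order.strict_iff_order)
    then show ?thesis
    proof cases
      case 5
      then show ?thesis
        using asm linear_wordD2[OF lin, of p q p' q'] w' unfolding m_def by simp
    next
      case 1 then show ?thesis using asm *[of p q p' q'] by metis
    next
      case 2 then show ?thesis using asm *[of q p q' p'] by metis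
    next
      case 3 then show ?thesis using asm \<open>p' \<noteq> q'\<close> *[of p' q' p q] by metis
    next
      case 4 then show ?thesis using asm \<open>p' \<noteq> q'\<close> *[of q' p' q p] by metis
    qed
  qed
  have len: "length w' = Suc m"
    by (simp add: w'_def m_def)
  show ?thesis
    unfolding linear_word_def w'_def[symmetric] len less_Suc_eq_le
    using L1 L2 by blast
qed

text \<open>Only the positions \<open>j\<close> and \<open>length w\<close> are affected, and they
  lie in different blocks. A violation at \<open>j\<close> would make \<open>y\<close> share a block
  with an entry of the block of \<open>j\<close>; one at the end would make the moved vertex share a
  block with an entry of the open block. \<open>far'\<close> and \<open>far\<close> exclude
  this.\<close>

lemma linear_word_swap:
  assumes lin: "linear_word k w" and j: "j < length w"
    and far: "\<And>q. q < length w \<Longrightarrow> q div k = length w div k \<Longrightarrow> \<not> share_block k w (w ! j) (w ! q)"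
    and far': "\<And>q. q < length w \<Longrightarrow> q div k = j div k \<Longrightarrow> \<not> share_block k w y (w ! q) \<and> w ! q \<noteq> y"
  shows "linear_word k (w[j := y] @ [w ! j])"
proof -
  define m where "m = length w"
  define z where "z = w ! j"
  define w' where "w' = w[j := y] @ [z]"
  have w': "w' ! p = w ! p" if "p < m" "p \<noteq> j" for p
    using that by (simp add: w'_def m_def nth_append)
  have w'm: "w' ! m = z" and w'j: "w' ! j = y"
    using j by (auto simp: w'_def m_def nth_append)
  have jm: "j < m"
    using j by (simp add: m_def)
  have zy: "z \<noteq> y"
    using far'[of j] j by (simp add: z_def)
  \<comment> \<open>\<open>share_block\<close> relates every occurring vertex to itself, so
    \<open>far\<close> also keeps \<open>j\<close> out of the open block.\<close>
  have jb: "j div k \<noteq> m div k"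
    using far[of j] adjI[of j w j k] j by (auto simp: m_def)
  have L1: "w' ! p \<noteq> w' ! q" if "p \<le> m" "q \<le> m" "p \<noteq> q" "p div k = q div k" for p q
  proof -
    have A: "w' ! j \<noteq> w' ! q" if "q \<le> m" "q \<noteq> j" "q div k = j div k" for q
    proof -
      have "q < m"
        using that jb by (auto simp: order.strict_iff_order)
      then show ?thesis
        using far'[of q] that w' w'j by (auto simp: m_def)
    qed
    have B: "w' ! m \<noteq> w' ! q" if "q < m" "q div k = m div k" for q
    proof -
      have "w' ! q = w ! q"
        using that jb by (intro w') auto
      then show ?thesis
        using far[of q] that w'm adjI[of q w q k] by (auto simp: m_def z_def)
    qed
    consider "p = j" | "q = j" | "p = m" "q < m" | "q = m" "p < m" | "p < m" "p \<noteq> j" "q < m" "q \<noteq> j"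
      using \<open>p \<le> m\<close> \<open>q \<le> m\<close> \<open>p \<noteq> q\<close> by linarith
    then show ?thesis
    proof cases
      case 1 then show ?thesis using A[of q] that by auto
    next
      case 2 then show ?thesis using A[of p] that by auto
    next
      case 3 then show ?thesis using B[of q] that by auto
    next
      case 4 then show ?thesis using B[of p] that by auto
    next
      case 5
      then show ?thesis
        using that linear_wordD1[OF lin, of p q] w' unfolding m_def by simp
    qed
  qed
  have z_unique: "w ! p \<noteq> z" if "p < m" "p \<noteq> j" "p div k = j div k" for p
    using linear_wordD1[OF lin, of p j] that jm by (simp add: m_def z_def)
  have J: "p div k = p' div k"
    if "p = j" "q \<le> m" "p' \<le> m" "q' \<le> m" "p \<noteq> q" "p div k = q div k" "p' div k = q' div k"
      "w' ! p = w' ! p'" "w' ! q = w' ! q'" for p q p' q'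
  proof (rule ccontr)
    assume neq: "p div k \<noteq> p' div k"
    have "q \<noteq> j" "q \<noteq> m"
      using that jb by auto
    then have q: "q < m" "q \<noteq> j" "w' ! q = w ! q"
      using \<open>q \<le> m\<close> w'[of q] by simp_all
    have "p' \<noteq> m"
      using that w'm w'j zy by auto
    moreover have "p' \<noteq> j"
      using that(1) neq by auto
    ultimately have p': "p' < m" "w ! p' = y"
      using \<open>p' \<le> m\<close> w'[of p'] w'j \<open>w' ! p = w' ! p'\<close> \<open>p = j\<close> by simp_all
    \<comment> \<open>Otherwise \<open>w ! q\<close> would be the moved vertex \<open>z\<close>,
      which by linearity of \<open>w\<close> occurs in the block of \<open>j\<close> only at
      \<open>j\<close>.\<close>
    have "q' \<noteq> m"
      using z_unique[of q] q that w'm by auto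
    moreover have "q' \<noteq> j"
      using that neq by auto
    ultimately have "q' < m" "w ! q' = w ! q"
      using that w'[of q'] q(3) by auto
    then have "share_block k w y (w ! q)"
      using p' q that adjI[of p' w q' k] by (auto simp: m_def)
    then show False
      using far'[of q] q that by (auto simp: m_def)
  qed
  have M: "p div k = p' div k"
    if "p = m" "q \<le> m" "p' \<le> m" "q' \<le> m" "p \<noteq> q" "p div k = q div k" "p' div k = q' div k"
      "w' ! p = w' ! p'" "w' ! q = w' ! q'" for p q p' q'
  proof (rule ccontr)
    assume neq: "p div k \<noteq> p' div k"
    have "q \<noteq> j" "q \<noteq> m"
      using that jb by auto
    then have q: "q < m" "q \<noteq> j" "w' ! q = w ! q"
      using \<open>q \<le> m\<close> w'[of q] by simp_all
    have "p' \<noteq> j"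
      using that w'm w'j zy by auto
    moreover have "p' \<noteq> m"
      using that(1) neq by auto
    ultimately have p': "p' < m" "w ! p' = z" "p' \<noteq> j"
      using \<open>p' \<le> m\<close> w'[of p'] w'm \<open>w' ! p = w' ! p'\<close> \<open>p = m\<close> by simp_all
    have "q' \<noteq> j"
      using z_unique[of p'] p' that by auto
    moreover have "q' \<noteq> m"
      using that neq by auto
    ultimately have "q' < m" "w ! q' = w ! q"
      using that w'[of q'] q(3) by auto
    then have "share_block k w z (w ! q)"
      using p' q that adjI[of p' w q' k] by (auto simp: m_def)
    then show False
      using far[of q] q that by (auto simp: m_def z_def)
  qed
  have L2: "p div k = p' div k"
    if asm: "p \<le> m" "q \<le> m" "p' \<le> m" "q' \<le> m" "p \<noteq> q" "p div k = q div k" "p' div k = q' div k"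
      "w' ! p = w' ! p'" "w' ! q = w' ! q'" for p q p' q'
  proof -
    have "p' \<noteq> q'"
      using asm L1[of p q] by metis
    consider "p = m \<or> p = j" | "q = m \<or> q = j" | "p' = m \<or> p' = j" | "q' = m \<or> q' = j" |
       "p < m" "q < m" "p' < m" "q' < m" "p \<noteq> j" "q \<noteq> j" "p' \<noteq> j" "q' \<noteq> j"
      using asm by (auto simp: order.strict_iff_order)
    then show ?thesis
    proof cases
      case 1 then show ?thesis using asm J[of p q p' q'] M[of p q p' q'] by metis
    next
      case 2 then show ?thesis using asm J[of q p q' p'] M[of q p q' p'] by metis
    next
      case 3 then show ?thesis using asm \<open>p' \<noteq> q'\<close> J[of p' q' p q] M[of p' q' p q] by metis
    next
      case 4 then show ?thesis using asm \<open>p' \<noteq> q'\<close> J[of q' p' q p] M[of q' p' q p] by metis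
    next
      case 5
      then show ?thesis
        using asm linear_wordD2[OF lin, of p q p' q'] w' unfolding m_def by simp
    qed
  qed
  have len: "length w' = Suc m"
    by (simp add: w'_def m_def)
  show ?thesis
    unfolding linear_word_def z_def[symmetric] w'_def[symmetric] len less_Suc_eq_le
    using L1 L2 by blast
qed

section \<open>A lower bound for the number of linear lists of points\<close>

lemma finite_block: "k > 0 \<Longrightarrow> finite {q::nat. q div k = c}"
  and card_block: "k > 0 \<Longrightarrow> card {q::nat. q div k = c} = k"
proof -
  assume "k > 0"
  then have "{q. q div k = c} = {c * k..<c * k + k}"
    using div_times_less_eq_dividend[of _ k] dividend_less_div_times[of k]
    by (auto intro!: div_nat_eqI simp: algebra_simps)
  then show "finite {q::nat. q div k = c}" "card {q::nat. q div k = c} = k"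
    by simp_all
qed

locale point_set =
  fixes k D :: nat and A :: "('v \<times> 'b) set"
  assumes k: "k \<ge> 2" and D: "D \<ge> 1" and finA: "finite A" and rem_le: "\<And>v. rem A v \<le> D"
begin

definition linear_lists :: "nat \<Rightarrow> ('v \<times> 'b) list set" where
  "linear_lists m = {xs. length xs = m \<and> distinct xs \<and> set xs \<subseteq> A \<and> linear_word k (map fst xs)}"

lemma finite_linear_lists: "finite (linear_lists m)"
  by (rule finite_subset[OF _ finite_lists_length_eq[OF finA, of m]]) (auto simp: linear_lists_def)

lemma card_positions:
  assumes "xs \<in> linear_lists m"
  shows "card {p. p < m \<and> fst (xs ! p) = v} \<le> D"
proof -
  have "card {p. p < m \<and> fst (xs ! p) = v} = card ((!) xs ` {p. p < m \<and> fst (xs ! p) = v})"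
    using assms by (intro card_image[symmetric]) (auto simp: linear_lists_def inj_on_def nth_eq_iff_index_eq)
  also have "\<dots> \<le> card {x\<in>A. fst x = v}"
    using assms finA by (intro card_mono) (auto simp: linear_lists_def)
  also have "\<dots> \<le> D"
    using rem_le[of v] by (simp add: rem_def)
  finally show ?thesis .
qed

lemma card_UN_le_mult:
  assumes "finite I" "card I \<le> a" "\<And>i. i \<in> I \<Longrightarrow> card (B i) \<le> b"
  shows "card (\<Union>i\<in>I. B i) \<le> a * b"
proof -
  have "card (\<Union>i\<in>I. B i) \<le> (\<Sum>i\<in>I. card (B i))"
    by (rule card_UN_le[OF assms(1)])
  also have "\<dots> \<le> (\<Sum>i\<in>I. b)"
    by (rule sum_mono) (rule assms(3))
  also have "\<dots> \<le> a * b"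
    using assms by simp
  finally show ?thesis .
qed

lemma card_share_block:
  assumes "xs \<in> linear_lists m"
  shows "finite {u. share_block k (map fst xs) v u}" "card {u. share_block k (map fst xs) v u} \<le> D * k"
proof -
  have len: "length xs = m"
    using assms by (simp add: linear_lists_def)
  let ?U = "\<Union>p\<in>{p. p < m \<and> fst (xs ! p) = v}. (\<lambda>q. fst (xs ! q)) ` {q. q div k = p div k}"
  have sub: "{u. share_block k (map fst xs) v u} \<subseteq> ?U"
    by (force simp: share_block_def len)
  have fin: "finite ?U"
    using k by (auto intro!: finite_imageI finite_block)
  have "card ?U \<le> D * k"
    using card_positions[OF assms, of v] k
    by (intro card_UN_le_mult) (auto intro!: order.trans[OF card_image_le] finite_block simp: card_block)
  then show "finite {u. share_block k (map fst xs) v u}" "card {u. share_block k (map fst xs) v u} \<le> D * k"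
    using finite_subset[OF sub fin] order.trans[OF card_mono[OF fin sub]] by simp_all
qed

text \<open>With \<open>m\<close> the length of \<open>xs\<close>, these are the points, used or
  not, whose vertex violates \<open>new\<close> in \<open>linear_word_append\<close>.\<close>

definition bad_points :: "('v \<times> 'b) list \<Rightarrow> nat \<Rightarrow> ('v \<times> 'b) set" where
  "bad_points xs m = {a\<in>A. \<exists>q<m. q div k = m div k \<and> share_block k (map fst xs) (fst a) (fst (xs ! q))}"

text \<open>Bounds two counts. For \<open>bad_points\<close>: at most \<open>k\<close> entries of
  the open block, \<open>D * k\<close> vertices sharing a block with each, \<open>D\<close> points
  of each of these. For the switching: \<open>D * k\<close> vertices sharing a block with a given
  one, \<open>D\<close> positions of each, \<open>k\<close> positions in the block of each.\<close>

definition C0 :: nat where "C0 = (k * D)\<^sup>2"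

lemma card_bad_points:
  assumes "xs \<in> linear_lists m"
  shows "card (bad_points xs m) \<le> C0"
proof -
  let ?W = "map fst xs"
  let ?F = "\<lambda>u. {a\<in>A. fst a = u}"
  let ?G = "\<lambda>q. \<Union>u\<in>{u. share_block k ?W (fst (xs ! q)) u}. ?F u"
  let ?U = "\<Union>q\<in>{q. q div k = m div k}. ?G q"
  have "bad_points xs m \<subseteq> ?U"
    by (auto simp: bad_points_def dest: share_block_sym)
  moreover have G: "card (?G q) \<le> D * k * D" for q
    using card_share_block[OF assms, of "fst (xs ! q)"] rem_le
    by (intro card_UN_le_mult) (auto simp: rem_def)
  moreover have "card ?U \<le> k * (D * k * D)"
    using k by (intro card_UN_le_mult G) (auto intro!: finite_block simp: card_block)
  moreover have "finite ?U"
    using card_share_block[OF assms] finA k by (auto intro!: finite_block)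
  ultimately have "card (bad_points xs m) \<le> k * (D * k * D)"
    using order.trans[OF card_mono] by blast
  then show ?thesis
    by (simp add: C0_def power2_eq_square algebra_simps)
qed

lemma card_linear_lists_Suc:
  "card (linear_lists (Suc m)) \<ge> card (linear_lists m) * (card A - m - C0)"
proof -
  let ?S = "SIGMA xs:linear_lists m. A - set xs - bad_points xs m"
  have "card A - m - C0 \<le> card (A - set xs - bad_points xs m)" if "xs \<in> linear_lists m" for xs
  proof -
    have "card (A - set xs) = card A - m"
      using that finA by (auto simp: linear_lists_def card_Diff_subset distinct_card)
    then show ?thesis
      using card_bad_points[OF that] diff_card_le_card_Diff[of "bad_points xs m" "A - set xs"] finA
      by (simp add: bad_points_def)
  qed
  then have "card (linear_lists m) * (card A - m - C0) \<le> card ?S"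
    using finA finite_linear_lists sum_mono[of "linear_lists m" "\<lambda>_. card A - m - C0"] by simp
  also have "card ?S = card ((\<lambda>(xs, a). xs @ [a]) ` ?S)"
    by (intro card_image[symmetric]) (auto simp: inj_on_def)
  also have "\<dots> \<le> card (linear_lists (Suc m))"
  proof (rule card_mono[OF finite_linear_lists], safe)
    fix xs a b assume xs: "xs \<in> linear_lists m" and a: "(a, b) \<in> A" "(a, b) \<notin> set xs" "(a, b) \<notin> bad_points xs m"
    have "linear_word k (map fst xs @ [a])"
    proof (rule linear_word_append)
      show "\<not> share_block k (map fst xs) a (map fst xs ! q)"
        if "q < length (map fst xs)" "q div k = length (map fst xs) div k" for q
        using xs a that by (auto simp: linear_lists_def bad_points_def)
      then show "map fst xs ! q \<noteq> a"
        if "q < length (map fst xs)" "q div k = length (map fst xs) div k" for q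
        using that adjI[of q "map fst xs" q k] by metis
    qed (use xs in \<open>simp add: linear_lists_def\<close>)
    then show "xs @ [(a, b)] \<in> linear_lists (Suc m)"
      using xs a by (auto simp: linear_lists_def)
  qed
  finally show ?thesis .
qed

text \<open>Near the end every unused point may be excluded, so an arbitrary one is exchanged with a position
  that is far from it; the position determines the preimage, which costs a factor \<open>m\<close>.\<close>

lemma card_linear_lists_le:
  assumes "2 * C0 < m" "m < card A"
  shows "card (linear_lists m) \<le> m * card (linear_lists (Suc m))"
proof -
  have ex: "\<exists>j a. j < m \<and> a \<in> A \<and> xs[j := a] @ [xs ! j] \<in> linear_lists (Suc m)"
    if xs: "xs \<in> linear_lists m" for xs
  proof -
    have len: "length xs = m" and dist: "distinct xs" and sub: "set xs \<subseteq> A"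
      using xs by (auto simp: linear_lists_def)
    obtain a where a: "a \<in> A" "a \<notin> set xs"
      using assms len card_length[of xs] card_mono[of "set xs" A] by fastforce
    let ?w = "map fst xs"
    \<comment> \<open>\<open>X\<close> collects the positions that violate \<open>far\<close> in
      \<open>linear_word_swap\<close>, \<open>Y\<close> those that violate \<open>far'\<close>. Each
      has at most \<open>C0\<close> elements, whence the hypothesis
      \<open>2 * C0 < m\<close>.\<close>
    define X where "X = {j. j < m \<and> xs ! j \<in> bad_points xs m}"
    define Y where "Y = {j. j < m \<and> (\<exists>q<m. q div k = j div k \<and> (share_block k ?w (fst a) (?w ! q)))}"
    have "card X = card ((!) xs ` X)"
      using dist len by (intro card_image[symmetric]) (auto simp: X_def inj_on_def nth_eq_iff_index_eq)
    also have "\<dots> \<le> card (bad_points xs m)"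
      using finA by (intro card_mono) (auto simp: X_def bad_points_def)
    finally have X: "card X \<le> C0"
      using card_bad_points[OF xs] by simp
    have "Y \<subseteq> (\<Union>u\<in>{u. share_block k ?w (fst a) u}. \<Union>q\<in>{q. q < m \<and> fst (xs ! q) = u}. {j. j div k = q div k})"
      (is "_ \<subseteq> ?U")
      by (force simp: Y_def len)
    moreover have "card (\<Union>q\<in>{q. q < m \<and> fst (xs ! q) = u}. {j. j div k = q div k}) \<le> D * k" for u
      using card_positions[OF xs, of u] k by (intro card_UN_le_mult) (auto simp: card_block)
    note * = this
    have "card ?U \<le> D * k * (D * k)"
      using card_share_block[OF xs] by (rule card_UN_le_mult) (rule *)
    moreover have "finite ?U"
      using card_share_block[OF xs] k by (auto intro!: finite_block)
    ultimately have "card Y \<le> D * k * (D * k)"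
      by (meson card_mono order.trans)
    then have "card Y \<le> C0"
      by (simp add: C0_def power2_eq_square algebra_simps)
    then have "card (X \<union> Y) < card {..<m}"
      using X card_Un_le[of X Y] assms by simp
    moreover have "finite (X \<union> Y)"
      by (auto simp: X_def Y_def)
    ultimately obtain j where j: "j < m" "j \<notin> X" "j \<notin> Y"
      by (metis UnCI card_mono lessThan_iff linorder_not_le subsetI)
    have lin: "linear_word k (?w[j := fst a] @ [?w ! j])"
    proof (rule linear_word_swap)
      show "\<not> share_block k ?w (?w ! j) (?w ! q)" if "q < length ?w" "q div k = length ?w div k" for q
        using j that len nth_mem[of j xs] subsetD[OF sub] by (auto simp: X_def bad_points_def)
      have *: "\<not> share_block k ?w (fst a) (?w ! q)" if "q < length ?w" "q div k = j div k" for q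
        using j that len by (auto simp: Y_def)
      then show "\<not> share_block k ?w (fst a) (?w ! q) \<and> ?w ! q \<noteq> fst a"
        if "q < length ?w" "q div k = j div k" for q
        using that adjI[of q ?w q k] by metis
    qed (use xs j len in \<open>auto simp: linear_lists_def\<close>)
    have "xs[j := a] @ [xs ! j] \<in> linear_lists (Suc m)"
    proof -
      have "set (xs[j := a]) = insert a (set xs - {xs ! j})" "distinct (xs[j := a])"
        using dist j len a by (simp_all add: set_update_distinct distinct_list_update)
      moreover have "xs ! j \<in> set xs" "xs ! j \<noteq> a"
        using j len a nth_mem[of j xs] by auto
      ultimately show ?thesis
        using lin j len a sub by (auto simp: linear_lists_def map_update)
    qed
    then show ?thesis
      using a j by blast
  qed
  then obtain J a where Ja: "\<And>xs. xs \<in> linear_lists m \<Longrightarrow>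
      J xs < m \<and> a xs \<in> A \<and> xs[J xs := a xs] @ [xs ! J xs] \<in> linear_lists (Suc m)"
    by metis
  define \<phi> where "\<phi> xs = (J xs, xs[J xs := a xs] @ [xs ! J xs])" for xs
  define \<psi> where "\<psi> = (\<lambda>(j, ys). (take m ys)[j := ys ! m] :: ('v \<times> 'b) list)"
  have "\<psi> (\<phi> xs) = xs" if "xs \<in> linear_lists m" for xs
    using that Ja[OF that] by (simp add: \<phi>_def \<psi>_def linear_lists_def nth_append)
  then have "inj_on \<phi> (linear_lists m)"
    by (rule inj_on_inverseI)
  moreover have "\<phi> ` linear_lists m \<subseteq> {..<m} \<times> linear_lists (Suc m)"
    using Ja by (auto simp: \<phi>_def)
  ultimately have "card (linear_lists m) \<le> card ({..<m} \<times> linear_lists (Suc m))"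
    by (intro card_inj_on_le) (auto simp: finite_linear_lists)
  then show ?thesis
    by (simp add: card_cartesian_product)
qed

text \<open>With \<open>N = card A\<close>, appending up to length \<open>N - C0\<close> already
  gives \<open>fact (N - C0)\<close> lists. Each of the last \<open>C0\<close> steps loses a factor
  of at most \<open>N\<close>, and passing from \<open>fact (N - C0)\<close> to
  \<open>fact N\<close> costs another \<open>N ^ C0\<close>; hence the exponent
  \<open>2 * C0\<close>. The assumption \<open>N > 3 * C0\<close> ensures \<open>2 * C0 < m\<close>
  in every switching step.\<close>

lemma card_linear_lists:
  assumes "card A > 3 * C0"
  shows "fact (card A) \<le> card (linear_lists (card A)) * card A ^ (2 * C0)"
proof -
  define N where "N = card A"
  have low: "(\<Prod>t<m. N - t - C0) \<le> card (linear_lists m)" for m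
  proof (induction m)
    case 0
    have "linear_lists 0 = {[]}"
      by (auto simp: linear_lists_def linear_word_def)
    then show ?case
      by simp
  next
    case (Suc m)
    then show ?case
      using order.trans[OF mult_le_mono1[OF Suc.IH, of "N - m - C0"]] card_linear_lists_Suc[of m]
      by (simp add: N_def)
  qed
  have high: "card (linear_lists (N - C0)) \<le> N ^ t * card (linear_lists (N - C0 + t))" if "t \<le> C0" for t
    using that
  proof (induction t)
    case (Suc t)
    have "card (linear_lists (N - C0 + t)) \<le> (N - C0 + t) * card (linear_lists (Suc (N - C0 + t)))"
      using assms Suc by (intro card_linear_lists_le) (auto simp: N_def)
    also have "\<dots> \<le> N * card (linear_lists (Suc (N - C0 + t)))"
      using assms Suc by (intro mult_le_mono1) (auto simp: N_def)
    finally have "N ^ t * card (linear_lists (N - C0 + t)) \<le> N ^ t * (N * card (linear_lists (Suc (N - C0 + t))))"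
      by (rule mult_le_mono2)
    then show ?case
      using order.trans[OF Suc.IH] Suc.prems by (simp add: algebra_simps)
  qed simp
  have "(\<Prod>t<N - C0. N - t - C0) = fact (N - C0)"
    unfolding fact_prod_rev atLeast0LessThan by (simp add: add.commute)
  then have "fact (N - C0) \<le> N ^ C0 * card (linear_lists N)"
    using low[of "N - C0"] high[of C0] assms by (simp add: N_def)
  moreover have "fact N \<le> fact (N - C0) * N ^ C0"
  proof -
    have "fact N = fact (N - C0) * (fact N div fact (N - C0) :: nat)"
      by (simp add: fact_dvd)
    also have "\<dots> \<le> fact (N - C0) * N ^ C0"
      using assms by (intro mult_le_mono2 fact_div_fact_le_pow) (simp add: N_def)
    finally show ?thesis .
  qed
  ultimately have "fact N \<le> N ^ C0 * card (linear_lists N) * N ^ C0"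
    by (meson le_trans mult_le_mono1)
  then show ?thesis
    by (simp add: N_def mult_2 power_add algebra_simps)
qed


end

section \<open>From linear lists to simple sequences\<close>

lemma length_concat_blocks:
  "\<forall>l\<in>set ls. length l = m \<Longrightarrow> length (concat ls) = m * length ls"
  by (induction ls) auto

text \<open>The second condition excludes multiple edges, which a set of edges could not
  record.\<close>

definition simple_seq :: "('v \<times> 'b) list list \<Rightarrow> bool" where
  "simple_seq ls \<longleftrightarrow>
    (\<forall>l\<in>set ls. distinct (map fst l)) \<and> distinct (map (\<lambda>l. fst ` set l) ls)"

context point_set
begin

lemma card_seqs_le_fact:
  assumes "card A = k * M"
  shows "card (seqs k M A) \<le> fact (card A)"
proof -
  have "inj_on concat (seqs k M A)"
  proof (rule inj_onI)
    fix xs ys assume "xs \<in> seqs k M A" "ys \<in> seqs k M A" "concat xs = concat ys"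
    then show "xs = ys"
      by (intro concat_injective) (auto simp: in_seqs_iff set_zip)
  qed
  moreover have "concat ` seqs k M A \<subseteq> permutations_of_set A"
  proof safe
    fix ls assume ls: "ls \<in> seqs k M A"
    then have "length (concat ls) = card A"
      using assms length_concat_blocks[of ls k] by (simp add: in_seqs_iff)
    then have "card (set (concat ls)) = card A"
      using ls distinct_card[of "concat ls"] by (simp add: in_seqs_iff del: set_concat)
    then have "set (concat ls) = A"
      using ls finA by (intro card_subset_eq) (simp_all add: in_seqs_iff)
    then show "concat ls \<in> permutations_of_set A"
      using ls by (auto simp: in_seqs_iff permutations_of_set_def)
  qed
  ultimately have "card (seqs k M A) \<le> card (permutations_of_set A)"
    using finA by (intro card_inj_on_le) auto
  then show ?thesis
    using finA by simp
qed

lemma nth_concat_blocks: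
  assumes "\<forall>l\<in>set ls. length l = k" "i < length ls" "r < k"
  shows "concat ls ! (i * k + r) = ls ! i ! r"
  using assms
proof (induction ls arbitrary: i)
  case (Cons l ls)
  show ?case
  proof (cases i)
    case (Suc i')
    then have "concat (l # ls) ! (i * k + r) = concat ls ! (i' * k + r)"
      using Cons.prems by (simp add: nth_append add.assoc)
    then show ?thesis
      using Cons Suc by simp
  qed (use Cons.prems in \<open>auto simp: nth_append\<close>)
qed simp

lemma ex_blocks:
  assumes "length xs = k * M"
  shows "\<exists>ls. length ls = M \<and> (\<forall>l\<in>set ls. length l = k) \<and> concat ls = xs"
  using assms
proof (induction M arbitrary: xs)
  case (Suc M)
  have "length (drop k xs) = k * M"
    using Suc.prems by simp
  from Suc.IH[OF this] obtain ls
    where "length ls = M" "\<forall>l\<in>set ls. length l = k" "concat ls = drop k xs"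
    by blast
  then show ?case
    using Suc.prems by (intro exI[of _ "take k xs # ls"]) auto
qed simp

lemma linear_list_simple:
  assumes "xs \<in> linear_lists (k * M)" "length ls = M" "\<forall>l\<in>set ls. length l = k" "concat ls = xs"
  shows "ls \<in> {ls\<in>seqs k M A. simple_seq ls}"
proof -
  have ls: "ls \<in> seqs k M A"
    using assms by (auto simp: in_seqs_iff linear_lists_def)
  have lin: "linear_word k (map fst xs)" and len: "length xs = k * M"
    using assms by (auto simp: linear_lists_def)
  have pos: "i * k + r < k * M" "(i * k + r) div k = i" if "i < M" "r < k" for i r
  proof -
    have "i * k + r < Suc i * k"
      using that by simp
    also have "\<dots> \<le> M * k"
      using that by (intro mult_le_mono1) simp
    finally show "i * k + r < k * M"
      by (simp add: mult.commute)
    show "(i * k + r) div k = i"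
      using that by simp
  qed
  have nth: "map fst xs ! (i * k + r) = fst (ls ! i ! r)" if "i < M" "r < k" for i r
    using that assms pos[OF that] nth_concat_blocks[of ls i r] len by simp
  have len_i: "length (ls ! i) = k" if "i < M" for i
    using that assms by auto
  have D1: "fst (ls ! i ! r) \<noteq> fst (ls ! i ! r')" if "i < M" "r < k" "r' < k" "r \<noteq> r'" for i r r'
    using linear_wordD1[OF lin, of "i * k + r" "i * k + r'"] that pos nth len by simp
  have "distinct (map fst l)" if "l \<in> set ls" for l
  proof -
    from that obtain i where "i < length ls" "ls ! i = l"
      unfolding in_set_conv_nth by blast
    then have i: "i < M" "l = ls ! i"
      using assms(2) by simp_all
    show ?thesis
      unfolding distinct_conv_nth i(2) length_map len_i[OF i(1)]
      by (intro allI impI) (use D1[OF i(1)] len_i[OF i(1)] in \<open>simp only: nth_map\<close>)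
  qed
  moreover have "fst ` set (ls ! i) \<noteq> fst ` set (ls ! i')" if ii: "i < M" "i' < M" "i \<noteq> i'" for i i'
  proof
    assume eq: "fst ` set (ls ! i) = fst ` set (ls ! i')"
    have match: "\<exists>r'. r' < k \<and> fst (ls ! i ! r) = fst (ls ! i' ! r')" if "r < k" for r
    proof -
      have "fst (ls ! i ! r) \<in> fst ` set (ls ! i')"
        using that ii len_i unfolding eq[symmetric] by simp
      then obtain x where "x \<in> set (ls ! i')" "fst (ls ! i ! r) = fst x"
        by auto
      then show ?thesis
        using len_i[OF ii(2)] by (metis in_set_conv_nth)
    qed
    \<comment> \<open>Since k \<ge> 2, block \<open>i\<close> has two positions; both of their
      vertices recur in block \<open>i'\<close>, which linearity forbids for different
      blocks.\<close>
    have "0 < k" "1 < k"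
      using k by simp_all
    from match[OF this(1)] match[OF this(2)]
    obtain r0 r1 where r0: "r0 < k" "fst (ls ! i ! 0) = fst (ls ! i' ! r0)"
      and r1: "r1 < k" "fst (ls ! i ! 1) = fst (ls ! i' ! r1)"
      by blast
    note r = r0 r1
    have "(i * k + 0) div k = (i' * k + r0) div k"
      by (rule linear_wordD2[OF lin, of "i * k + 0" "i * k + 1" "i' * k + r0" "i' * k + r1"])
        (use r ii k pos[of i 0] pos[of i 1] pos[of i' r0] pos[of i' r1]
          nth[of i 0] nth[of i 1] nth[of i' r0] nth[of i' r1] len in simp_all)
    then show False
      using ii r k pos[of i 0] pos[of i' r0] by simp
  qed
  ultimately show ?thesis
    using ls assms by (auto simp: simple_seq_def distinct_conv_nth)
qed

text \<open>The price of conditioning on simplicity: a factor polynomial in the number of points,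
  with an exponent that depends on \<open>k\<close> and \<open>D\<close> alone.\<close>

lemma card_simple_seqs:
  assumes "card A = k * M" "card A > 3 * C0"
  shows "card (seqs k M A) \<le> card {ls\<in>seqs k M A. simple_seq ls} * card A ^ (2 * C0)"
proof -
  have "linear_lists (k * M) \<subseteq> concat ` {ls\<in>seqs k M A. simple_seq ls}"
  proof
    fix xs assume xs: "xs \<in> linear_lists (k * M)"
    then obtain ls where "length ls = M" "\<forall>l\<in>set ls. length l = k" "concat ls = xs"
      using ex_blocks[of xs M] by (auto simp: linear_lists_def)
    then show "xs \<in> concat ` {ls\<in>seqs k M A. simple_seq ls}"
      using linear_list_simple[OF xs, of ls] by (metis imageI)
  qed
  then have "card (linear_lists (card A)) \<le> card {ls\<in>seqs k M A. simple_seq ls}"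
    using finA assms by (intro surj_card_le) (auto simp: finite_seqs)
  then show ?thesis
    using card_seqs_le_fact[OF assms(1)] card_linear_lists[OF assms(2)]
    by (meson le_trans mult_le_mono1)
qed

end

section \<open>The limiting trajectory\<close>

locale degree_distribution =
  fixes k \<Delta> :: nat and \<zeta> :: "nat \<Rightarrow> real"
  assumes k: "k \<ge> 2" and \<Delta>: "\<Delta> \<ge> 2"
    and \<zeta>_nonneg: "\<And>i. i \<in> {1..\<Delta>} \<Longrightarrow> \<zeta> i \<ge> 0"
    and \<zeta>_\<Delta>: "\<zeta> \<Delta> > 0"
    and \<zeta>_sum: "(\<Sum>i=1..\<Delta>. \<zeta> i) = 1"
begin

text \<open>\<open>P\<^sup>(\<^sup>i\<^sup>)(a) / i!\<close>\<close>

definition P_coeff :: "nat \<Rightarrow> real \<Rightarrow> real" where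
  "P_coeff i a = (\<Sum>j=1..\<Delta>. \<zeta> j * real (j choose i) * a ^ (j - i))"

lemma P_fun_eq_P_coeff: "P_fun \<Delta> \<zeta> = P_coeff 0"
  by (simp add: P_fun_def P_coeff_def fun_eq_iff)

lemma choose_mult_diff: "real (j choose i) * real (j - i) = real (Suc i) * real (j choose Suc i)"
proof -
  have "(j - i) * (j choose i) = Suc i * (j choose Suc i)"
    by (simp only: binomial_absorb_comp binomial_absorption)
  then show ?thesis
    by (metis mult.commute of_nat_mult)
qed

lemma P_coeff_has_derivative: "(P_coeff i has_real_derivative real (Suc i) * P_coeff (Suc i) a) (at a within S)"
proof -
  have "((\<lambda>a. \<zeta> j * real (j choose i) * a ^ (j - i)) has_real_derivative
      real (Suc i) * (\<zeta> j * real (j choose Suc i) * a ^ (j - Suc i))) (at a within S)" for j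
  proof -
    have "((\<lambda>a. \<zeta> j * real (j choose i) * a ^ (j - i)) has_real_derivative
        \<zeta> j * real (j choose i) * (real (j - i) * a ^ (j - Suc i))) (at a within S)"
      by (auto intro!: derivative_eq_intros)
    moreover have "\<zeta> j * real (j choose i) * (real (j - i) * a ^ (j - Suc i)) =
        real (Suc i) * (\<zeta> j * real (j choose Suc i) * a ^ (j - Suc i))"
      using arg_cong[OF choose_mult_diff[of j i], of "\<lambda>x. \<zeta> j * a ^ (j - Suc i) * x"]
      by (simp add: algebra_simps)
    ultimately show ?thesis
      by metis
  qed
  then show ?thesis
    unfolding P_coeff_def[abs_def] sum_distrib_left by (intro DERIV_sum) auto
qed

lemma deriv_P_coeff: "deriv (P_coeff i) = (\<lambda>a. real (Suc i) * P_coeff (Suc i) a)"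
  using P_coeff_has_derivative DERIV_imp_deriv by blast

lemma deriv_P_fun: "deriv (P_fun \<Delta> \<zeta>) = P_coeff 1"
  by (simp add: P_fun_eq_P_coeff deriv_P_coeff)

lemma deriv_deriv_P_fun: "deriv (deriv (P_fun \<Delta> \<zeta>)) = (\<lambda>a. 2 * P_coeff 2 a)"
  using deriv_P_coeff[of 1] by (simp add: deriv_P_fun numeral_2_eq_2)

section \<open>Bounds for the normalised derivatives of P on the unit interval\<close>

lemma P_coeff_nonneg: "0 \<le> a \<Longrightarrow> 0 \<le> P_coeff i a"
  unfolding P_coeff_def by (intro sum_nonneg mult_nonneg_nonneg) (auto simp: \<zeta>_nonneg)

lemma P_coeff_le:
  assumes "0 \<le> a" "a \<le> 1"
  shows "P_coeff i a \<le> 2 ^ \<Delta>"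
proof -
  have "P_coeff i a \<le> (\<Sum>j=1..\<Delta>. \<zeta> j * 2 ^ \<Delta>)"
    unfolding P_coeff_def
  proof (rule sum_mono)
    fix j assume j: "j \<in> {1..\<Delta>}"
    have "(j choose i) \<le> 2 ^ \<Delta>"
      using j order.trans[OF binomial_le_pow2[of j i] power_increasing[of j \<Delta> "2::nat"]] by simp
    then have "real (j choose i) \<le> 2 ^ \<Delta>"
      by (metis of_nat_le_iff of_nat_numeral of_nat_power)
    then have "real (j choose i) * a ^ (j - i) \<le> 2 ^ \<Delta> * 1"
      using assms by (intro mult_mono) (auto simp: power_le_one)
    then show "\<zeta> j * real (j choose i) * a ^ (j - i) \<le> \<zeta> j * 2 ^ \<Delta>"
      using \<zeta>_nonneg[OF j] by (simp add: mult.assoc mult_left_mono)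
  qed
  then show ?thesis
    using \<zeta>_sum by (simp add: sum_distrib_right[symmetric])
qed

text \<open>A common bound on [0, 1] for the derivatives of \<open>P_coeff i\<close> with i \<le>
  \<Delta> + 1. Index \<Delta> + 1 is included because the Taylor remainder at index \<Delta> uses
  the Lipschitz bound at the next one.\<close>

definition Lip :: real where "Lip = (real \<Delta> + 2) * 2 ^ \<Delta>"

lemma Lip_pos: "Lip > 0"
  by (simp add: Lip_def add_nonneg_pos)

lemma Suc_pc_le:
  assumes "i \<le> Suc \<Delta>" "0 \<le> a" "a \<le> 1"
  shows "real (Suc i) * P_coeff (Suc i) a \<le> Lip"
  unfolding Lip_def using P_coeff_le[of a "Suc i"] P_coeff_nonneg[of a "Suc i"] assms by (intro mult_mono) auto

lemma P_coeff_MVT: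
  assumes "a < b"
  shows "\<exists>z. a < z \<and> z < b \<and> P_coeff i b - P_coeff i a = (b - a) * (real (Suc i) * P_coeff (Suc i) z)"
  by (rule MVT2[OF assms P_coeff_has_derivative])

lemma P_coeff_Lipschitz:
  assumes "0 \<le> a" "a \<le> b" "b \<le> 1" "i \<le> Suc \<Delta>"
  shows "\<bar>P_coeff i b - P_coeff i a\<bar> \<le> Lip * (b - a)"
proof (cases "a = b")
  case False
  then obtain z where z: "a < z" "z < b" "P_coeff i b - P_coeff i a = (b - a) * (real (Suc i) * P_coeff (Suc i) z)"
    using P_coeff_MVT[of a b i] assms by auto
  moreover have "(b - a) * (real (Suc i) * P_coeff (Suc i) z) \<le> (b - a) * Lip"
    using z assms Suc_pc_le[of i z] by (intro mult_left_mono) auto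
  moreover have "0 \<le> (b - a) * (real (Suc i) * P_coeff (Suc i) z)"
    using z assms P_coeff_nonneg[of z "Suc i"] by (intro mult_nonneg_nonneg) auto
  ultimately show ?thesis
    by (simp add: mult.commute)
qed simp

text \<open>The mean value theorem turns the remainder into a variation of the derivative, which is
  Lipschitz in its turn.\<close>

lemma P_coeff_Taylor:
  assumes "0 \<le> a" "a \<le> b" "b \<le> 1" "i \<le> \<Delta>"
  shows "\<bar>P_coeff i a - P_coeff i b + (b - a) * (real (Suc i) * P_coeff (Suc i) b)\<bar> \<le> (real \<Delta> + 2) * Lip * (b - a)\<^sup>2"
proof (cases "a = b")
  case False
  then obtain z where z: "a < z" "z < b" "P_coeff i b - P_coeff i a = (b - a) * (real (Suc i) * P_coeff (Suc i) z)"
    using P_coeff_MVT[of a b i] assms by auto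
  have "\<bar>P_coeff (Suc i) b - P_coeff (Suc i) z\<bar> \<le> Lip * (b - z)"
    using assms z by (intro P_coeff_Lipschitz) auto
  also have "\<dots> \<le> Lip * (b - a)"
    using z Lip_pos by (intro mult_left_mono) auto
  finally have "real (Suc i) * \<bar>P_coeff (Suc i) b - P_coeff (Suc i) z\<bar> \<le> (real \<Delta> + 2) * (Lip * (b - a))"
    using assms by (intro mult_mono) auto
  then have "(b - a) * (real (Suc i) * \<bar>P_coeff (Suc i) b - P_coeff (Suc i) z\<bar>) \<le>
      (b - a) * ((real \<Delta> + 2) * (Lip * (b - a)))"
    using assms by (intro mult_left_mono) auto
  moreover have "P_coeff i a - P_coeff i b + (b - a) * (real (Suc i) * P_coeff (Suc i) b) =
      (b - a) * (real (Suc i) * (P_coeff (Suc i) b - P_coeff (Suc i) z))"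
    using z by (simp add: algebra_simps)
  then have "\<bar>P_coeff i a - P_coeff i b + (b - a) * (real (Suc i) * P_coeff (Suc i) b)\<bar> =
      (b - a) * (real (Suc i) * \<bar>P_coeff (Suc i) b - P_coeff (Suc i) z\<bar>)"
    using assms by (simp add: abs_mult)
  moreover have "(b - a) * ((real \<Delta> + 2) * (Lip * (b - a))) = (real \<Delta> + 2) * Lip * (b - a)\<^sup>2"
    by (simp add: power2_eq_square)
  ultimately show ?thesis
    by linarith
qed simp

section \<open>Monotonicity of P' and the time function G\<close>

lemma P1_pos: "0 < a \<Longrightarrow> 0 < P_coeff 1 a"
proof -
  assume a: "0 < a"
  have "0 < \<zeta> \<Delta> * real (\<Delta> choose 1) * a ^ (\<Delta> - 1)"
    using a \<zeta>_\<Delta> \<Delta> by simp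
  also have "\<dots> \<le> P_coeff 1 a"
    unfolding P_coeff_def using a \<Delta> \<zeta>_nonneg
    by (intro member_le_sum[of \<Delta> _ "\<lambda>j. \<zeta> j * real (j choose 1) * a ^ (j - 1)"]) auto
  finally show ?thesis .
qed

lemma P2_pos: "0 < a \<Longrightarrow> 0 < P_coeff 2 a"
proof -
  assume a: "0 < a"
  have "0 < \<zeta> \<Delta> * real (\<Delta> choose 2) * a ^ (\<Delta> - 2)"
    using a \<zeta>_\<Delta> \<Delta> by (simp add: zero_less_binomial)
  also have "\<dots> \<le> P_coeff 2 a"
    unfolding P_coeff_def using a \<Delta> \<zeta>_nonneg
    by (intro member_le_sum[of \<Delta> _ "\<lambda>j. \<zeta> j * real (j choose 2) * a ^ (j - 2)"]) auto
  finally show ?thesis .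
qed

lemma P1_strict_mono: "0 \<le> a \<Longrightarrow> a < b \<Longrightarrow> P_coeff 1 a < P_coeff 1 b"
proof -
  assume ab: "0 \<le> a" "a < b"
  obtain z where z: "a < z" "z < b" "P_coeff 1 b - P_coeff 1 a = (b - a) * (real (Suc 1) * P_coeff (Suc 1) z)"
    using P_coeff_MVT[of a b 1] ab by auto
  moreover have "0 < (b - a) * (real (Suc 1) * P_coeff (Suc 1) z)"
    using P2_pos[of z] ab z by (simp add: numeral_2_eq_2)
  ultimately show ?thesis
    by linarith
qed

lemma P1_mono: "0 \<le> a \<Longrightarrow> a \<le> b \<Longrightarrow> P_coeff 1 a \<le> P_coeff 1 b"
  using P1_strict_mono[of a b] by (cases "a = b") auto

text \<open>The limit probability that the other k - 1 points of a tuple lie at uncovered vertices: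
  for \<open>a = \<alpha> s\<close> these carry about \<open>n * s * P_coeff 1 a\<close> of the
  roughly \<open>n * s * P_coeff 1 1\<close> unrevealed points.\<close>

definition rate :: "real \<Rightarrow> real" where
  "rate a = (P_coeff 1 a / P_coeff 1 1) ^ (k - 1)"

text \<open>The proportion of points revealed while \<alpha> falls from 1 to \<open>a\<close>. At 0
  the rate may vanish and the integral diverge, so all facts about \<open>G\<close> concern positive
  arguments.\<close>

definition G :: "real \<Rightarrow> real" where
  "G a = integral {a..1} (\<lambda>w. 1 / rate w)"

lemma rate_pos: "0 < a \<Longrightarrow> 0 < rate a"
  using P1_pos[of a] P1_pos[of 1] by (simp add: rate_def)

lemma rate_le_1: "0 \<le> a \<Longrightarrow> a \<le> 1 \<Longrightarrow> rate a \<le> 1"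
  using P1_mono[of a 1] P1_pos[of 1] P_coeff_nonneg[of a 1] by (simp add: rate_def power_le_one)

lemma rate_strict_mono: "0 \<le> a \<Longrightarrow> a < b \<Longrightarrow> rate a < rate b"
  unfolding rate_def using P1_strict_mono[of a b] P1_pos[of 1] P_coeff_nonneg[of a 1] k
  by (intro power_strict_mono) (auto simp: divide_strict_right_mono)

lemma rate_Lipschitz:
  assumes "0 \<le> a" "a \<le> b" "b \<le> 1"
  shows "\<bar>rate b - rate a\<bar> \<le> real (k - 1) * (Lip / P_coeff 1 1) * (b - a)"
proof -
  have le: "P_coeff 1 a / P_coeff 1 1 \<le> 1" "P_coeff 1 b / P_coeff 1 1 \<le> 1" "0 \<le> P_coeff 1 a / P_coeff 1 1" "0 \<le> P_coeff 1 b / P_coeff 1 1"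
    using P1_mono[of a 1] P1_mono[of b 1] P1_pos[of 1] P_coeff_nonneg[of a 1] P_coeff_nonneg[of b 1] assms by auto
  have "\<bar>rate b - rate a\<bar> \<le> real (k - 1) * \<bar>P_coeff 1 b / P_coeff 1 1 - P_coeff 1 a / P_coeff 1 1\<bar>"
    using norm_power_diff[of "P_coeff 1 b / P_coeff 1 1" "P_coeff 1 a / P_coeff 1 1" "k - 1"] le by (simp add: rate_def)
  also have "\<bar>P_coeff 1 b / P_coeff 1 1 - P_coeff 1 a / P_coeff 1 1\<bar> = \<bar>P_coeff 1 b - P_coeff 1 a\<bar> / P_coeff 1 1"
    using P1_pos[of 1] by (simp add: diff_divide_distrib[symmetric])
  also have "\<dots> \<le> Lip * (b - a) / P_coeff 1 1"
    using assms P1_pos[of 1] by (intro divide_right_mono P_coeff_Lipschitz) auto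
  finally show ?thesis
    by (simp add: mult_left_mono)
qed

lemma continuous_on_P_coeff: "continuous_on S (P_coeff i)"
  by (rule DERIV_continuous_on[OF P_coeff_has_derivative])

lemma continuous_on_inverse_rate:
  assumes "\<And>x. x \<in> S \<Longrightarrow> 0 < x"
  shows "continuous_on S (\<lambda>w. 1 / rate w)"
proof -
  have "continuous_on S rate"
    unfolding rate_def[abs_def] using P1_pos[of 1] by (intro continuous_intros continuous_on_P_coeff) auto
  moreover have "\<forall>x\<in>S. rate x \<noteq> 0"
    using rate_pos assms by (metis less_irrefl)
  ultimately show ?thesis
    by (intro continuous_on_divide continuous_on_const)
qed

lemma G_diff:
  assumes "0 < a" "a \<le> b" "b \<le> 1"
  shows "G a - G b = integral {a..b} (\<lambda>w. 1 / rate w)"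
proof -
  have "(\<lambda>w. 1 / rate w) integrable_on {a..1}"
    using assms by (intro integrable_continuous_interval continuous_on_inverse_rate) auto
  then have "integral {a..b} (\<lambda>w. 1 / rate w) + integral {b..1} (\<lambda>w. 1 / rate w) = integral {a..1} (\<lambda>w. 1 / rate w)"
    using assms by (intro Henstock_Kurzweil_Integration.integral_combine) auto
  then show ?thesis
    by (simp add: G_def)
qed

text \<open>The rate increases, so the integrand \<open>1 / rate\<close> lies between its values at
  the two ends.\<close>

lemma G_diff_bounds:
  assumes "0 < a" "a \<le> b" "b \<le> 1"
  shows "(b - a) / rate b \<le> G a - G b" "G a - G b \<le> (b - a) / rate a"
proof -
  have int: "(\<lambda>w. 1 / rate w) integrable_on {a..b}"
    using assms by (intro integrable_continuous_interval continuous_on_inverse_rate) auto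
  have mono: "rate x \<le> rate y" if "0 < x" "x \<le> y" for x y
    using rate_strict_mono[of x y] that by (cases "x = y") auto
  have "integral {a..b} (\<lambda>w. 1 / rate b) \<le> integral {a..b} (\<lambda>w. 1 / rate w)"
    using assms by (intro integral_le int) (auto intro!: divide_left_mono mono mult_pos_pos rate_pos)
  then show "(b - a) / rate b \<le> G a - G b"
    using assms by (simp add: G_diff)
  have "integral {a..b} (\<lambda>w. 1 / rate w) \<le> integral {a..b} (\<lambda>w. 1 / rate a)"
    using assms by (intro integral_le int) (auto intro!: divide_left_mono mono mult_pos_pos rate_pos)
  then show "G a - G b \<le> (b - a) / rate a"
    using assms by (simp add: G_diff)
qed

lemma G_diff_ge:
  assumes "0 < a" "a \<le> b" "b \<le> 1"
  shows "b - a \<le> G a - G b"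
proof -
  have "b - a \<le> (b - a) / rate b"
    using assms rate_pos[of b] rate_le_1[of b] by (simp add: pos_le_divide_eq mult_left_le)
  then show ?thesis
    using G_diff_bounds[OF assms] by linarith
qed

lemma G_1: "G 1 = 0"
  by (simp add: G_def)

lemma G_continuous:
  assumes "0 < a"
  shows "continuous_on {a..1} G"
proof -
  have "\<bar>G x - G y\<bar> \<le> 1 / rate a * \<bar>x - y\<bar>" if xy: "x \<in> {a..1}" "y \<in> {a..1}" "x \<le> y" for x y
  proof -
    have "(y - x) / rate x \<le> (y - x) / rate a"
      using xy assms rate_strict_mono[of a x] rate_pos[of a] rate_pos[of x]
      by (cases "a = x") (auto intro!: divide_left_mono)
    then show ?thesis
      using G_diff_bounds[of x y] G_diff_ge[of x y] xy assms by simp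
  qed
  then have "\<bar>G x - G y\<bar> \<le> 1 / rate a * \<bar>x - y\<bar>" if xy: "x \<in> {a..1}" "y \<in> {a..1}" for x y
    using xy by (metis abs_minus_commute linear)
  then have "(1 / rate a)-lipschitz_on {a..1} G"
    using rate_pos[OF assms] by (intro lipschitz_onI) (auto simp: dist_real_def)
  then show ?thesis
    by (rule lipschitz_on_continuous_on)
qed

lemma G_surj:
  assumes "0 \<le> y" "y \<le> 1"
  shows "\<exists>a. 0 < a \<and> a \<le> 1 \<and> G a = y"
proof -
  define r where "r = 1 / rate (1/2)"
  have r: "r > 1"
    using rate_strict_mono[of "1/2" 1] rate_pos[of "1/2"] rate_le_1[of 1] by (simp add: r_def)
  \<comment> \<open>The solution of \<open>(1/2 - a) * r = 1/2\<close>: it makes [a, 1/2] and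
    [1/2, 1] each contribute at least 1/2 to \<open>G a\<close>. It is positive because r >
    1.\<close>
  define a where "a = (r - 1) / (2 * r)"
  have a: "0 < a" "a < 1/2"
    using r by (auto simp: a_def field_simps)
  have "(1/2 - a) * r \<le> G a - G (1/2)"
    using G_diff_bounds(1)[of a "1/2"] a by (simp add: r_def)
  moreover have "(1/2 - a) * r = 1/2"
    using r by (simp add: a_def field_simps)
  moreover have "1/2 \<le> G (1/2)"
    using G_diff_ge[of "1/2" 1] by (simp add: G_1)
  ultimately have "1 \<le> G a"
    by simp
  then obtain x where "a \<le> x" "x \<le> 1" "G x = y"
    using IVT2'[of G 1 y a] assms a G_continuous[OF a(1)] by (auto simp: G_1)
  then show ?thesis
    using a by (intro exI[of _ x]) auto
qed

lemma G_inj: "0 < a \<Longrightarrow> a \<le> 1 \<Longrightarrow> 0 < b \<Longrightarrow> b \<le> 1 \<Longrightarrow> G a = G b \<Longrightarrow> a = b"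
  using G_diff_ge[of a b] G_diff_ge[of b a] by linarith

section \<open>The end root in terms of G\<close>

lemma Q_fun_eq:
  assumes "0 < a" "a \<le> 1"
  shows "Q_fun k \<Delta> \<zeta> a = a / P_coeff 1 a ^ (k - 1) + (G a - 1) / P_coeff 1 1 ^ (k - 1)"
proof -
  \<comment> \<open>The boundary term of the integration by parts: the derivative of
    \<open>F\<close> is the integrand of Q minus \<open>1 / P_coeff 1 w ^ (k - 1)\<close>, and the
    latter is a constant multiple of the integrand of \<open>G\<close>.\<close>
  define F where "F w = - (w / P_coeff 1 w ^ (k - 1))" for w
  have k1: "k - 1 = Suc (k - 2)" "k = Suc (Suc (k - 2))"
    using k by auto
  define f where "f = (\<lambda>w. (real k - 1) * w * (2 * P_coeff 2 w) / P_coeff 1 w ^ k)"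
  have F': "(F has_real_derivative f w - 1 / P_coeff 1 w ^ (k - 1)) (at w within {a..1})" if "w \<in> {a..1}" for w
  proof -
    have pos: "P_coeff 1 w > 0"
      using that assms by (intro P1_pos) auto
    have d: "(P_coeff 1 has_real_derivative 2 * P_coeff 2 w) (at w within {a..1})"
      using P_coeff_has_derivative[of 1 w] by (simp add: numeral_2_eq_2)
    have "((\<lambda>w. P_coeff 1 w ^ (k - 1)) has_real_derivative real (k - 1) * P_coeff 1 w ^ (k - 2) * (2 * P_coeff 2 w))
        (at w within {a..1})"
      using DERIV_power[OF d, of "k - 1"] by (simp add: numeral_2_eq_2 algebra_simps)
    from DERIV_minus[OF DERIV_divide[OF DERIV_ident this]]
    have "(F has_real_derivative - ((1 * P_coeff 1 w ^ (k - 1) -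
        w * (real (k - 1) * P_coeff 1 w ^ (k - 2) * (2 * P_coeff 2 w))) / (P_coeff 1 w ^ (k - 1) * P_coeff 1 w ^ (k - 1)))) (at w within {a..1})"
      unfolding F_def using pos by simp
    moreover have "- ((1 * P_coeff 1 w ^ (k - 1) -
        w * (real (k - 1) * P_coeff 1 w ^ (k - 2) * (2 * P_coeff 2 w))) / (P_coeff 1 w ^ (k - 1) * P_coeff 1 w ^ (k - 1))) =
        f w - 1 / P_coeff 1 w ^ (k - 1)"
    proof -
      obtain m where m: "k = Suc (Suc m)"
        using k1 by blast
      show ?thesis
        using pos by (simp add: f_def m field_simps)
    qed
    ultimately show ?thesis
      by simp
  qed
  have I1: "((\<lambda>w. f w - 1 / P_coeff 1 w ^ (k - 1)) has_integral (F 1 - F a)) {a..1}"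
    using assms F' by (intro fundamental_theorem_of_calculus) (auto simp: has_real_derivative_iff_has_vector_derivative)
  have I2: "((\<lambda>w. 1 / P_coeff 1 w ^ (k - 1)) has_integral (G a / P_coeff 1 1 ^ (k - 1))) {a..1}"
  proof -
    have "((\<lambda>w. 1 / rate w) has_integral G a) {a..1}"
      unfolding G_def using assms
      by (intro integrable_integral integrable_continuous_interval continuous_on_inverse_rate) auto
    then have "((\<lambda>w. 1 / rate w / P_coeff 1 1 ^ (k - 1)) has_integral (G a / P_coeff 1 1 ^ (k - 1))) {a..1}"
      by (rule has_integral_divide)
    then show ?thesis
      using P1_pos[of 1] by (simp add: rate_def power_divide)
  qed
  have "(f has_integral (F 1 - F a + G a / P_coeff 1 1 ^ (k - 1))) {a..1}"
    using has_integral_add[OF I1 I2] by simp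
  then have "integral {a..1} f = F 1 - F a + G a / P_coeff 1 1 ^ (k - 1)"
    by (rule integral_unique)
  then show ?thesis
    unfolding Q_fun_def deriv_deriv_P_fun unfolding deriv_P_fun by (simp add: f_def F_def diff_divide_distrib)
qed

text \<open>Multiplied by \<open>P_coeff 1 a ^ (k - 1)\<close>, the right side of
  \<open>Q_fun_eq\<close> becomes \<open>a + (G a - 1) * rate a\<close>, and the rate is
  positive.\<close>

lemma is_end_root_iff: "is_end_root k \<Delta> \<zeta> a \<longleftrightarrow> 0 < a \<and> a < 1 \<and> G a = 1"
proof (cases "0 < a \<and> a < 1")
  case True
  then have "Q_fun k \<Delta> \<zeta> a * P_coeff 1 a ^ (k - 1) = a + (G a - 1) * (P_coeff 1 a / P_coeff 1 1) ^ (k - 1)"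
    using P1_pos[of a] by (simp add: Q_fun_eq distrib_right power_divide)
  moreover have "(P_coeff 1 a / P_coeff 1 1) ^ (k - 1) \<noteq> 0"
    using True P1_pos[of a] P1_pos[of 1] by simp
  ultimately show ?thesis
    using True by (auto simp: is_end_root_def deriv_P_fun)
qed (auto simp: is_end_root_def)

lemma ex1_end_root: "\<exists>!a. is_end_root k \<Delta> \<zeta> a"
proof -
  obtain a where "0 < a" "a \<le> 1" "G a = 1"
    using G_surj[of 1] by auto
  moreover then have "a \<noteq> 1"
    using G_1 by auto
  ultimately show ?thesis
    unfolding is_end_root_iff by (intro ex1I[of _ a]) (auto intro: G_inj)
qed

text \<open>By \<open>G' = - 1 / rate\<close>, this inverse of \<open>1 - G\<close> solves \<open>\<alpha>' = rate \<alpha>\<close>; only its difference quotients are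
  needed.\<close>

definition \<alpha> :: "real \<Rightarrow> real" where
  "\<alpha> s = (SOME a. 0 < a \<and> a \<le> 1 \<and> G a = 1 - s)"

lemma \<alpha>:
  assumes "0 \<le> s" "s \<le> 1"
  shows "0 < \<alpha> s" "\<alpha> s \<le> 1" "G (\<alpha> s) = 1 - s"
  using someI_ex[OF G_surj[of "1 - s"]] assms unfolding \<alpha>_def by auto

lemma \<alpha>_0: "\<alpha> 0 = alpha_end k \<Delta> \<zeta>"
proof -
  have "\<alpha> 0 \<noteq> 1"
    using \<alpha>[of 0] G_1 by auto
  then have "is_end_root k \<Delta> \<zeta> (\<alpha> 0)"
    using \<alpha>[of 0] by (simp add: is_end_root_iff)
  then show ?thesis
    unfolding alpha_end_def using ex1_end_root by (metis the1_equality)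
qed

lemma \<alpha>_1: "\<alpha> 1 = 1"
  using \<alpha>[of 1] G_1 G_inj[of "\<alpha> 1" 1] by simp

text \<open>Since the rate is at most 1, time passes at least as fast as \<alpha> changes.\<close>

lemma \<alpha>_diff:
  assumes "0 \<le> s" "s \<le> t" "t \<le> 1"
  shows "\<alpha> s \<le> \<alpha> t" "\<alpha> t - \<alpha> s \<le> t - s"
proof -
  show "\<alpha> s \<le> \<alpha> t"
  proof (rule ccontr)
    assume "\<not> \<alpha> s \<le> \<alpha> t"
    then show False
      using G_diff_ge[of "\<alpha> t" "\<alpha> s"] \<alpha>[of s] \<alpha>[of t] assms by simp
  qed
  then show "\<alpha> t - \<alpha> s \<le> t - s"
    using G_diff_ge[of "\<alpha> s" "\<alpha> t"] \<alpha>[of s] \<alpha>[of t] assms by simp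
qed

text \<open>No inverse function is differentiated: the time \<open>h\<close> between two values of
  \<alpha> lies between their difference divided by the larger rate and by the smaller one, and the
  two rates differ by O(h).\<close>

lemma \<alpha>_Taylor:
  assumes "0 \<le> h" "h \<le> s" "s \<le> 1"
  shows "\<bar>\<alpha> (s - h) - \<alpha> s + h * rate (\<alpha> s)\<bar> \<le> real (k - 1) * (Lip / P_coeff 1 1) * h\<^sup>2"
proof -
  define a b where "a = \<alpha> (s - h)" and "b = \<alpha> s"
  define L where "L = real (k - 1) * (Lip / P_coeff 1 1)"
  have ab: "0 < a" "a \<le> b" "b \<le> 1" "b - a \<le> h" "G a - G b = h"
    using \<alpha>[of "s - h"] \<alpha>[of s] \<alpha>_diff[of "s - h" s] assms by (auto simp: a_def b_def)
  have L: "\<bar>rate b - rate a\<bar> \<le> L * (b - a)" "L \<ge> 0"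
    using rate_Lipschitz[of a b] ab P1_pos[of 1] Lip_pos by (auto simp: L_def)
  have "(b - a) \<le> h * rate b" "h * rate a \<le> b - a"
    using G_diff_bounds[of a b] ab rate_pos[of a] rate_pos[of b] by (simp_all add: field_simps)
  then have "\<bar>a - b + h * rate b\<bar> \<le> h * (rate b - rate a)"
    by (simp add: algebra_simps)
  also have "\<dots> \<le> h * (L * h)"
  proof -
    have "L * (b - a) \<le> L * h"
      using L ab by (intro mult_left_mono) auto
    then show ?thesis
      using L ab assms by (intro mult_left_mono) auto
  qed
  finally show ?thesis
    by (simp add: a_def b_def L_def power2_eq_square algebra_simps)
qed


text \<open>The limit of \<open>B\<^sub>i / n\<close> when a proportion \<open>s\<close> of the points is unrevealed.\<close>

definition traj :: "nat \<Rightarrow> real \<Rightarrow> real" where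
  "traj i s = s ^ i * P_coeff i (\<alpha> s)"

lemma traj_bounds:
  assumes "0 \<le> s" "s \<le> 1"
  shows "0 \<le> traj i s" "traj i s \<le> 2 ^ \<Delta>"
proof -
  have "0 \<le> P_coeff i (\<alpha> s)" "P_coeff i (\<alpha> s) \<le> 2 ^ \<Delta>"
    using \<alpha>[OF assms] by (auto intro: P_coeff_nonneg P_coeff_le)
  moreover have "s ^ i \<le> 1"
    using assms by (simp add: power_le_one)
  ultimately show "0 \<le> traj i s" "traj i s \<le> 2 ^ \<Delta>"
    using assms mult_mono[of "s ^ i" 1 "P_coeff i (\<alpha> s)" "2 ^ \<Delta>"] by (simp_all add: traj_def)
qed

section \<open>Difference quotients of the trajectory\<close>

lemma power_Taylor:
  fixes s h :: real
  assumes "0 \<le> h" "h \<le> s" "s \<le> 1"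
  shows "\<bar>(s - h) ^ i - s ^ i + h * (real i * s ^ (i - 1))\<bar> \<le> (real i)\<^sup>2 * h\<^sup>2"
proof (induction i)
  case (Suc i)
  have eq: "(s - h) ^ Suc i - s ^ Suc i + h * (real (Suc i) * s ^ (Suc i - 1)) =
      (s - h) * ((s - h) ^ i - s ^ i + h * (real i * s ^ (i - 1))) + real i * s ^ (i - 1) * h\<^sup>2"
    by (cases i) (simp_all add: power2_eq_square algebra_simps)
  have "\<bar>(s - h) * ((s - h) ^ i - s ^ i + h * (real i * s ^ (i - 1)))\<bar> \<le> 1 * ((real i)\<^sup>2 * h\<^sup>2)"
    unfolding abs_mult using Suc assms by (intro mult_mono) auto
  moreover have "\<bar>real i * s ^ (i - 1) * h\<^sup>2\<bar> \<le> real i * 1 * h\<^sup>2"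
    unfolding abs_mult using assms by (intro mult_mono) (auto simp: power_le_one)
  ultimately have "\<bar>(s - h) ^ Suc i - s ^ Suc i + h * (real (Suc i) * s ^ (Suc i - 1))\<bar> \<le>
      (real i)\<^sup>2 * h\<^sup>2 + real i * h\<^sup>2"
    unfolding eq by linarith
  also have "\<dots> \<le> (real (Suc i))\<^sup>2 * h\<^sup>2"
    unfolding distrib_right[symmetric] by (intro mult_right_mono) (auto simp: power2_eq_square algebra_simps)
  finally show ?case .
qed simp

text \<open>The product rule with an explicit remainder. The bound \<open>U\<close> is asked of the
  new value \<open>y\<close>, because this is what multiplies the remainder of
  \<open>u\<close>.\<close>

lemma product_Taylor:
  fixes u u' y y' h :: real
  assumes "0 \<le> h" "h \<le> 1" "0 \<le> A" "0 \<le> B"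
    and u: "\<bar>u - u0 + h * u1\<bar> \<le> A * h\<^sup>2" and y: "\<bar>y - y0 + h * y1\<bar> \<le> B * h\<^sup>2"
    and bounds: "\<bar>u0\<bar> \<le> U" "\<bar>u1\<bar> \<le> U" "\<bar>y\<bar> \<le> U" "\<bar>y1\<bar> \<le> U"
  shows "\<bar>u * y - u0 * y0 + h * (u1 * y0 + u0 * y1)\<bar> \<le> (A * U + B * U + U * (U + B)) * h\<^sup>2"
proof -
  have U: "0 \<le> U"
    using bounds by linarith
  have eq: "u * y - u0 * y0 + h * (u1 * y0 + u0 * y1) =
      (u - u0 + h * u1) * y + u0 * (y - y0 + h * y1) + h * (u1 * (y0 - y))"
    by (simp add: algebra_simps)
  have 1: "\<bar>(u - u0 + h * u1) * y\<bar> \<le> A * h\<^sup>2 * U"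
    unfolding abs_mult using assms by (intro mult_mono u) auto
  have 2: "\<bar>u0 * (y - y0 + h * y1)\<bar> \<le> U * (B * h\<^sup>2)"
    unfolding abs_mult using assms U by (intro mult_mono y) auto
  have "h * h \<le> h * 1"
    using assms by (intro mult_left_mono) auto
  then have "B * h\<^sup>2 \<le> B * h"
    using assms by (simp add: mult_left_mono power2_eq_square)
  moreover have "h * \<bar>y1\<bar> \<le> h * U"
    using assms by (intro mult_left_mono) auto
  then have "\<bar>h * y1\<bar> \<le> h * U"
    using assms by (simp add: abs_mult)
  ultimately have "\<bar>y0 - y\<bar> \<le> (U + B) * h"
    using y by (simp add: algebra_simps)
  then have "\<bar>u1\<bar> * \<bar>y0 - y\<bar> \<le> U * ((U + B) * h)"
    using bounds U by (intro mult_mono) auto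
  then have "h * (\<bar>u1\<bar> * \<bar>y0 - y\<bar>) \<le> h * (U * ((U + B) * h))"
    using assms(1) by (rule mult_left_mono)
  then have 3: "\<bar>h * (u1 * (y0 - y))\<bar> \<le> U * (U + B) * h\<^sup>2"
    using assms(1) by (simp add: abs_mult power2_eq_square mult.assoc mult.left_commute)
  show ?thesis
    unfolding eq using 1 2 3 by (simp add: algebra_simps)
qed

text \<open>\<open>K\<close> does not depend on s, since the division by s only undoes the surplus
  power of s in the two trajectory terms. For h = k / N with N \<ge> n the error per tuple is
  therefore O(1 / n^2).\<close>

lemma traj_Taylor:
  "\<exists>K\<ge>0. \<forall>s h i. i \<le> \<Delta> \<longrightarrow> 0 \<le> h \<longrightarrow> h \<le> s \<longrightarrow> 0 < s \<longrightarrow> s \<le> 1 \<longrightarrow>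
    \<bar>traj i (s - h) - traj i s + h / s * (real i * traj i s + real (Suc i) * rate (\<alpha> s) * traj (Suc i) s)\<bar> \<le> K * h\<^sup>2"
proof -
  define Kq where "Kq = real (k - 1) * (Lip / P_coeff 1 1)"
  define B where "B = (real \<Delta> + 2) * Lip + Lip * Kq"
  define A where "A = (real \<Delta>)\<^sup>2"
  define U where "U = real \<Delta> + 1 + Lip"
  define K where "K = A * U + B * U + U * (U + B)"
  have Kq: "Kq \<ge> 0"
    using P1_pos[of 1] Lip_pos by (simp add: Kq_def)
  have A: "A \<ge> 0" and B: "B \<ge> 0" and U: "U \<ge> 0"
    using Kq Lip_pos by (auto simp: A_def B_def U_def)
  have "\<bar>traj i (s - h) - traj i s + h / s * (real i * traj i s + real (Suc i) * rate (\<alpha> s) * traj (Suc i) s)\<bar> \<le> K * h\<^sup>2"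
    if i: "i \<le> \<Delta>" and h: "0 \<le> h" "h \<le> s" and s: "0 < s" "s \<le> 1" for s h i
  proof -
    define a b where "a = \<alpha> (s - h)" and "b = \<alpha> s"
    have ab: "0 < a" "a \<le> b" "b \<le> 1" "b - a \<le> h"
      using \<alpha>[of "s - h"] \<alpha>[of s] \<alpha>_diff[of "s - h" s] s h by (auto simp: a_def b_def)
    have q: "0 < rate b" "rate b \<le> 1"
      using rate_pos[of b] rate_le_1[of b] ab by auto
    have p': "0 \<le> real (Suc i) * P_coeff (Suc i) b" "real (Suc i) * P_coeff (Suc i) b \<le> Lip"
      using Suc_pc_le[of i b] P_coeff_nonneg[of b "Suc i"] ab i by auto
    have u: "\<bar>(s - h) ^ i - s ^ i + h * (real i * s ^ (i - 1))\<bar> \<le> A * h\<^sup>2"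
    proof -
      have "(real i)\<^sup>2 * h\<^sup>2 \<le> A * h\<^sup>2"
        unfolding A_def using i by (intro mult_right_mono power_mono) auto
      then show ?thesis
        using power_Taylor[of h s i] h s by linarith
    qed
    have y: "\<bar>P_coeff i a - P_coeff i b + h * (real (Suc i) * P_coeff (Suc i) b * rate b)\<bar> \<le> B * h\<^sup>2"
    proof -
      have "\<bar>P_coeff i a - P_coeff i b + (b - a) * (real (Suc i) * P_coeff (Suc i) b)\<bar> \<le> (real \<Delta> + 2) * Lip * (b - a)\<^sup>2"
        using ab i by (intro P_coeff_Taylor) auto
      also have "\<dots> \<le> (real \<Delta> + 2) * Lip * h\<^sup>2"
        using ab Lip_pos by (intro mult_left_mono power_mono) auto
      finally have 1: "\<bar>P_coeff i a - P_coeff i b + (b - a) * (real (Suc i) * P_coeff (Suc i) b)\<bar> \<le> (real \<Delta> + 2) * Lip * h\<^sup>2" .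
      have "\<bar>a - b + h * rate b\<bar> \<le> Kq * h\<^sup>2"
        using \<alpha>_Taylor[of h s] h s by (simp add: a_def b_def Kq_def)
      then have "(real (Suc i) * P_coeff (Suc i) b) * \<bar>a - b + h * rate b\<bar> \<le> Lip * (Kq * h\<^sup>2)"
        using p' Lip_pos by (intro mult_mono) auto
      then have 2: "\<bar>(real (Suc i) * P_coeff (Suc i) b) * (a - b + h * rate b)\<bar> \<le> Lip * (Kq * h\<^sup>2)"
        unfolding abs_mult[of "real (Suc i) * P_coeff (Suc i) b"] using p' by (simp only: abs_of_nonneg)
      have "P_coeff i a - P_coeff i b + h * (real (Suc i) * P_coeff (Suc i) b * rate b) =
          (P_coeff i a - P_coeff i b + (b - a) * (real (Suc i) * P_coeff (Suc i) b)) +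
          (real (Suc i) * P_coeff (Suc i) b) * (a - b + h * rate b)"
        by (simp only: algebra_simps)
      then have "\<bar>P_coeff i a - P_coeff i b + h * (real (Suc i) * P_coeff (Suc i) b * rate b)\<bar> \<le>
          (real \<Delta> + 2) * Lip * h\<^sup>2 + Lip * (Kq * h\<^sup>2)"
        using 1 2 by linarith
      then show ?thesis
        by (simp add: B_def distrib_right mult.assoc)
    qed
    have "\<bar>(s - h) ^ i * P_coeff i a - s ^ i * P_coeff i b +
        h * (real i * s ^ (i - 1) * P_coeff i b + s ^ i * (real (Suc i) * P_coeff (Suc i) b * rate b))\<bar> \<le> K * h\<^sup>2"
      unfolding K_def
    proof (rule product_Taylor[OF _ _ A B u y])
      show "\<bar>s ^ i\<bar> \<le> U"
        using s Lip_pos power_le_one[of s i] by (simp add: U_def)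
      have "real i * s ^ (i - 1) \<le> real \<Delta> * 1"
        using s i by (intro mult_mono) (auto simp: power_le_one)
      then show "\<bar>real i * s ^ (i - 1)\<bar> \<le> U"
        using s Lip_pos by (simp add: U_def)
      have "2 ^ \<Delta> \<le> Lip"
        by (simp add: Lip_def algebra_simps)
      then show "\<bar>P_coeff i a\<bar> \<le> U"
        using P_coeff_le[of a i] P_coeff_nonneg[of a i] ab by (simp add: U_def)
      have "(real (Suc i) * P_coeff (Suc i) b) * rate b \<le> Lip * 1"
        using p' q by (intro mult_mono) auto
      moreover have "0 \<le> (real (Suc i) * P_coeff (Suc i) b) * rate b"
        using mult_nonneg_nonneg[OF p'(1), of "rate b"] q by simp
      ultimately show "\<bar>real (Suc i) * P_coeff (Suc i) b * rate b\<bar> \<le> U"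
        by (simp add: U_def)
    qed (use h s in auto)
    moreover have "h * (real i * s ^ (i - 1) * P_coeff i b + s ^ i * (real (Suc i) * P_coeff (Suc i) b * rate b)) =
        h / s * (real i * traj i s + real (Suc i) * rate (\<alpha> s) * traj (Suc i) s)"
      using s by (cases i) (simp_all add: traj_def b_def field_simps)
    ultimately show ?thesis
      by (simp add: traj_def a_def b_def)
  qed
  moreover have "K \<ge> 0"
    using A B U by (simp add: K_def)
  ultimately show ?thesis
    by blast
qed

end

section \<open>One-step drift in the point model\<close>

definition next_cover :: "'v set \<Rightarrow> ('v \<times> 'b) list \<Rightarrow> 'v set" where
  "next_cover C l = (if distinct (map fst l) \<and> fst ` set l \<inter> C = {} then C \<union> fst ` set l else C)"

definition stat :: "'v set \<Rightarrow> (nat \<Rightarrow> real) \<Rightarrow> ('v \<times> 'b) set \<Rightarrow> 'v set \<Rightarrow> real" where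
  "stat V g A C = (\<Sum>v\<in>V - C. g (rem A v))"

section \<open>Sampling with replacement\<close>

lemma lists_Suc_eq:
  "{l. set l \<subseteq> A \<and> length l = Suc m} = (\<lambda>(x, l). x # l) ` (A \<times> {l. set l \<subseteq> A \<and> length l = m})"
  by (auto simp: image_iff length_Suc_conv)

lemma sum_lists_Suc:
  fixes F :: "'a list \<Rightarrow> 'b::comm_monoid_add"
  shows "(\<Sum>l | set l \<subseteq> A \<and> length l = Suc m. F l) = (\<Sum>x\<in>A. \<Sum>l | set l \<subseteq> A \<and> length l = m. F (x # l))"
  unfolding lists_Suc_eq sum.cartesian_product
  by (subst sum.reindex) (auto simp: inj_on_def intro!: sum.cong)

lemma sum_lists_prod:
  fixes u :: "'a \<Rightarrow> real"
  shows "(\<Sum>l | set l \<subseteq> A \<and> length l = m. prod_list (map u l)) = (\<Sum>x\<in>A. u x) ^ m"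
proof (induction m)
  case 0
  have "{l. set l \<subseteq> A \<and> length l = 0} = {[]}"
    by auto
  then show ?case
    by simp
next
  case (Suc m)
  then show ?case
    unfolding sum_lists_Suc by (simp add: sum_distrib_left[symmetric] sum_distrib_right[symmetric])
qed

text \<open>Each of the \<open>m\<close> coordinates in turn carries \<open>f x * u x\<close> while
  the others carry \<open>u x\<close>; with \<open>u\<close> an indicator this yields the powers of
  \<open>p\<close> in \<open>drift\<close>.\<close>

lemma sum_lists_sum_prod:
  fixes u f :: "'a \<Rightarrow> real"
  shows "(\<Sum>l | set l \<subseteq> A \<and> length l = m. sum_list (map f l) * prod_list (map u l)) =
    real m * (\<Sum>x\<in>A. f x * u x) * (\<Sum>x\<in>A. u x) ^ (m - 1)"
proof (induction m)
  case 0
  have "{l. set l \<subseteq> A \<and> length l = 0} = {[]}"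
    by auto
  then show ?case
    by simp
next
  case (Suc m)
  define L where "L = {l. set l \<subseteq> A \<and> length l = m}"
  have "(\<Sum>l | set l \<subseteq> A \<and> length l = Suc m. sum_list (map f l) * prod_list (map u l)) =
      (\<Sum>x\<in>A. \<Sum>l\<in>L. f x * u x * prod_list (map u l) + u x * (sum_list (map f l) * prod_list (map u l)))"
    unfolding sum_lists_Suc L_def by (intro sum.cong refl) (simp add: algebra_simps)
  also have "\<dots> = (\<Sum>x\<in>A. f x * u x) * (\<Sum>l\<in>L. prod_list (map u l)) +
      (\<Sum>x\<in>A. u x) * (\<Sum>l\<in>L. sum_list (map f l) * prod_list (map u l))"
    by (simp add: sum.distrib sum_distrib_left[symmetric] sum_distrib_right)
  also have "\<dots> = (\<Sum>x\<in>A. f x * u x) * (\<Sum>x\<in>A. u x) ^ m +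
      (\<Sum>x\<in>A. u x) * (real m * (\<Sum>x\<in>A. f x * u x) * (\<Sum>x\<in>A. u x) ^ (m - 1))"
    unfolding L_def sum_lists_prod Suc.IH ..
  also have "\<dots> = real (Suc m) * (\<Sum>x\<in>A. f x * u x) * (\<Sum>x\<in>A. u x) ^ (Suc m - 1)"
    by (cases m) (simp_all add: algebra_simps)
  finally show ?case .
qed

text \<open>A union bound: a further point collides with one of at most \<open>m * D\<close> points,
  those of the vertices already present.\<close>

lemma card_repeating_lists:
  fixes A :: "('v \<times> 'b) set"
  assumes "finite A" "\<And>v. rem A v \<le> D"
  shows "card {l. set l \<subseteq> A \<and> length l = m \<and> \<not> distinct (map fst l)} \<le> m\<^sup>2 * D * card A ^ (m - 1)"
proof (induction m)
  case 0
  have "{l. set l \<subseteq> A \<and> length l = 0 \<and> \<not> distinct (map fst l)} = {}"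
    by auto
  then show ?case
    by (simp only: card.empty)
next
  case (Suc m)
  define L where "L = {l. set l \<subseteq> A \<and> length l = m}"
  define R where "R = {l. set l \<subseteq> A \<and> length l = m \<and> \<not> distinct (map fst l)}"
  define X where "X l = {x\<in>A. fst x \<in> fst ` set l}" for l :: "('v \<times> 'b) list"
  have L: "finite L" "card L = card A ^ m"
    using assms(1) by (simp_all add: L_def finite_lists_length_eq card_lists_length_eq)
  have R: "finite R"
    by (rule finite_subset[OF _ L(1)]) (auto simp: R_def L_def)
  have X: "card (X l) \<le> m * D" if "l \<in> L" for l
  proof -
    have "X l \<subseteq> (\<Union>v\<in>fst ` set l. {x\<in>A. fst x = v})"
      by (auto simp: X_def)
    then have "card (X l) \<le> card (\<Union>v\<in>fst ` set l. {x\<in>A. fst x = v})"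
      using assms(1) by (intro card_mono) auto
    also have "\<dots> \<le> (\<Sum>v\<in>fst ` set l. card {x\<in>A. fst x = v})"
      by (intro card_UN_le) auto
    also have "\<dots> \<le> (\<Sum>v\<in>fst ` set l. D)"
      using assms(2) by (intro sum_mono) (auto simp: rem_def)
    also have "\<dots> \<le> m * D"
    proof -
      have "card (fst ` set l) \<le> m"
        using that card_image_le[of "set l" fst] card_length[of l] by (simp add: L_def)
      then show ?thesis
        by simp
    qed
    finally show ?thesis .
  qed
  have "{l. set l \<subseteq> A \<and> length l = Suc m \<and> \<not> distinct (map fst l)} \<subseteq>
      (\<lambda>(x, l). x # l) ` (A \<times> R) \<union> (\<lambda>(l, x). x # l) ` (SIGMA l:L. X l)" (is "?S \<subseteq> ?T1 \<union> ?T2")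
  proof
    fix l assume l: "l \<in> ?S"
    then obtain x l' where "l = x # l'"
      by (cases l) auto
    then show "l \<in> ?T1 \<union> ?T2"
      using l by (auto simp: L_def R_def X_def image_iff)
  qed
  moreover have fin: "finite ?T1" "finite ?T2"
    using assms(1) R L by (auto simp: X_def)
  ultimately have "card ?S \<le> card (?T1 \<union> ?T2)"
    by (intro card_mono) auto
  also have "\<dots> \<le> card ?T1 + card ?T2"
    by (rule card_Un_le)
  also have "card ?T1 \<le> card A * card R"
    using card_image_le[of "A \<times> R" "\<lambda>(x, l). x # l"] assms(1) R by (simp add: card_cartesian_product)
  also have "card ?T2 \<le> card (SIGMA l:L. X l)"
    using assms(1) L by (intro card_image_le) (auto simp: X_def)
  also have "card (SIGMA l:L. X l) = (\<Sum>l\<in>L. card (X l))"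
    using L assms(1) by (simp add: X_def)
  also have "\<dots> \<le> card A ^ m * (m * D)"
    using sum_mono[of L "\<lambda>l. card (X l)" "\<lambda>_. m * D"] X L by simp
  also have "card A * card R \<le> card A * (m\<^sup>2 * D * card A ^ (m - 1))"
    using Suc.IH by (simp add: R_def)
  also have "\<dots> = m\<^sup>2 * D * card A ^ m"
    by (cases m) simp_all
  finally have "card ?S \<le> (m\<^sup>2 + m) * D * card A ^ m"
    by (simp add: algebra_simps)
  also have "\<dots> \<le> (Suc m)\<^sup>2 * D * card A ^ m"
    by (intro mult_le_mono1) (simp add: power2_eq_square)
  finally show ?case
    by simp
qed

text \<open>Below, \<open>TT\<close> are the tuples of distinct points, \<open>AA\<close> all tuples and \<open>DD\<close> those with distinct vertices:
  sampling with replacement makes the coordinates independent.\<close>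

lemma avg_perturb:
  fixes F \<Phi> :: "'a \<Rightarrow> real"
  assumes fin: "finite AA" and sub: "DD \<subseteq> TT" "TT \<subseteq> AA" and ne: "TT \<noteq> {}"
    and F: "\<And>l. l \<in> TT \<Longrightarrow> 0 \<le> F l \<and> F l \<le> M"
    and \<Phi>: "\<And>l. l \<in> AA \<Longrightarrow> 0 \<le> \<Phi> l \<and> \<Phi> l \<le> M"
    and eq: "\<And>l. l \<in> DD \<Longrightarrow> F l = \<Phi> l"
    and few: "real (card (AA - DD)) \<le> \<eta> * real (card AA)"
  shows "\<bar>(\<Sum>l\<in>TT. F l) / card TT - (\<Sum>l\<in>AA. \<Phi> l) / card AA\<bar> \<le> M * \<eta>"
proof -
  define x where "x = (\<Sum>l\<in>TT. F l) / card TT"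
  have finT: "finite TT" "finite DD"
    using finite_subset[OF sub(2) fin] finite_subset[OF order.trans[OF sub] fin] by simp_all
  have cT: "real (card TT) > 0" "real (card AA) > 0"
    using ne finT fin sub by (auto simp: card_gt_0_iff)
  have M: "0 \<le> M"
    using F ne by force
  have sumT: "0 \<le> (\<Sum>l\<in>TT. F l)" "(\<Sum>l\<in>TT. F l) \<le> card TT * M"
    using F sum_mono[of TT F "\<lambda>_. M"] by (auto intro: sum_nonneg)
  have x: "0 \<le> x" "x \<le> M" "(\<Sum>l\<in>TT. F l) = card TT * x"
    using sumT cT by (auto simp: x_def field_simps)
  have S1: "(\<Sum>l\<in>TT. F l) = (\<Sum>l\<in>TT - DD. F l) + (\<Sum>l\<in>DD. \<Phi> l)"
    using sum.subset_diff[of DD TT F] sub finT eq by simp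
  have S2: "(\<Sum>l\<in>AA. \<Phi> l) = (\<Sum>l\<in>AA - DD. \<Phi> l) + (\<Sum>l\<in>DD. \<Phi> l)"
    using sum.subset_diff[of DD AA \<Phi>] sub fin by auto
  have R1: "0 \<le> (\<Sum>l\<in>TT - DD. F l)" "(\<Sum>l\<in>TT - DD. F l) \<le> card (TT - DD) * M"
    using F sum_mono[of "TT - DD" F "\<lambda>_. M"] by (auto intro: sum_nonneg)
  have R2: "0 \<le> (\<Sum>l\<in>AA - DD. \<Phi> l)" "(\<Sum>l\<in>AA - DD. \<Phi> l) \<le> card (AA - DD) * M"
    using \<Phi> sum_mono[of "AA - DD" \<Phi> "\<lambda>_. M"] by (auto intro: sum_nonneg)
  have cards: "real (card AA) - card TT \<ge> 0" "real (card (AA - DD)) = (real (card AA) - card TT) + card (TT - DD)"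
    using finT fin sub card_mono[OF fin sub(2)] card_mono[OF finT(1) sub(1)]
      card_mono[OF fin order.trans[OF sub]]
    by (auto simp: card_Diff_subset of_nat_diff)
  have a: "0 \<le> (real (card AA) - card TT) * x" "(real (card AA) - card TT) * x \<le> (real (card AA) - card TT) * M"
    using cards x by (auto intro: mult_left_mono)
  \<comment> \<open>Both averages are compared on the scale \<open>card AA\<close>. The first two
    terms on the right are nonnegative and together at most \<open>card (AA - DD) * M\<close>; the
    subtracted one lies in the same range, so no factor 2 arises.\<close>
  have b: "card AA * x - (\<Sum>l\<in>AA. \<Phi> l) =
      (real (card AA) - card TT) * x + ((\<Sum>l\<in>TT - DD. F l) - (\<Sum>l\<in>AA - DD. \<Phi> l))"
    using S1 S2 x(3) by (simp add: algebra_simps)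
  have "\<bar>card AA * x - (\<Sum>l\<in>AA. \<Phi> l)\<bar> \<le> card (AA - DD) * M"
  proof -
    have "card (AA - DD) * M = (real (card AA) - card TT) * M + card (TT - DD) * M"
      unfolding cards(2) by (rule distrib_right)
    then show ?thesis
      using R1 R2 a b
      by linarith
  qed
  also have "\<dots> \<le> \<eta> * card AA * M"
    using few M by (rule mult_right_mono)
  finally have "\<bar>card AA * x - (\<Sum>l\<in>AA. \<Phi> l)\<bar> / card AA \<le> M * \<eta>"
    using cT by (simp add: pos_divide_le_eq algebra_simps)
  moreover have "x - (\<Sum>l\<in>AA. \<Phi> l) / card AA = (card AA * x - (\<Sum>l\<in>AA. \<Phi> l)) / card AA"
    using cT by (simp add: field_simps)
  ultimately show ?thesis
    unfolding x_def[symmetric] by (simp add: abs_divide)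
qed

section \<open>The loss of a statistic caused by one tuple\<close>

locale statistic =
  fixes V C :: "'v set" and A :: "('v \<times> 'b) set" and k D :: nat and g :: "nat \<Rightarrow> real" and H :: real
  assumes finV: "finite V" and finA: "finite A" and AV: "fst ` A \<subseteq> V"
    and rem_le: "\<And>v. rem A v \<le> D"
    and g: "mono g" "0 \<le> g 0" "g D \<le> H"
    and kA: "1 \<le> k" "k \<le> card A"
begin

lemma g_bounds: "i \<le> j \<Longrightarrow> j \<le> D \<Longrightarrow> 0 \<le> g i \<and> g i \<le> g j \<and> g j \<le> H"
  using g(2,3) monoD[OF g(1), of 0 i] monoD[OF g(1), of i j] monoD[OF g(1), of j D] by linarith

definition u :: "'v \<times> 'b \<Rightarrow> real" where
  "u x = of_bool (fst x \<notin> C)"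

definition f1 :: "'v \<times> 'b \<Rightarrow> real" where
  "f1 x = u x * (g (rem A (fst x)) - g (rem A (fst x) - 1))"

definition f2 :: "'v \<times> 'b \<Rightarrow> real" where
  "f2 x = u x * g (rem A (fst x) - 1)"

text \<open>The loss in a form that suits independent coordinates: \<open>f1\<close> is the loss of
  an uncovered vertex that has a point revealed, \<open>f2\<close> what it loses in addition when it
  becomes covered, which happens if all coordinates are uncovered. The sum of \<open>f1\<close> and
  \<open>f2\<close> is the full weight of the vertex.\<close>

definition \<phi> :: "('v \<times> 'b) list \<Rightarrow> real" where
  "\<phi> l = sum_list (map f1 l) + sum_list (map f2 l) * prod_list (map u l)"

definition \<psi> :: "('v \<times> 'b) list \<Rightarrow> real" where
  "\<psi> l = stat V g A C - stat V g (A - set l) (next_cover C l)"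

lemma H: "0 \<le> H"
  using g_bounds[of 0 0] by auto

lemma prod_u: "prod_list (map u l) = of_bool (fst ` set l \<inter> C = {})"
  by (induction l) (auto simp: u_def)

lemma \<phi>_bounds:
  assumes "length l = k"
  shows "0 \<le> \<phi> l \<and> \<phi> l \<le> real k * H"
proof -
  have f: "0 \<le> f1 x" "0 \<le> f2 x" "f1 x + f2 x \<le> H" for x
    using g_bounds[of "rem A (fst x) - 1" "rem A (fst x)"] rem_le[of "fst x"] H
    by (auto simp: f1_def f2_def u_def)
  have p: "0 \<le> prod_list (map u l)" "prod_list (map u l) \<le> 1"
    by (auto simp: prod_u)
  have s: "0 \<le> sum_list (map f1 l)" "0 \<le> sum_list (map f2 l)"
    using f by (auto intro!: sum_list_nonneg)
  have "sum_list (map f1 l) + sum_list (map f2 l) \<le> (\<Sum>x\<leftarrow>l. H)"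
    unfolding sum_list_addf[symmetric] using f by (intro sum_list_mono) auto
  moreover have "sum_list (map f2 l) * prod_list (map u l) \<le> sum_list (map f2 l) * 1"
    using p s by (intro mult_left_mono) auto
  ultimately show ?thesis
    using s p assms by (simp add: \<phi>_def sum_list_triv)
qed

lemma rem_Diff_le: "rem (A - B) v \<le> rem A v"
  unfolding rem_def using finA by (intro card_mono) auto

lemma rem_Diff_eq: "v \<notin> fst ` B \<Longrightarrow> rem (A - B) v = rem A v"
  unfolding rem_def by (intro arg_cong[of _ _ card]) force

text \<open>By monotonicity of \<open>g\<close> every vertex loses between 0 and \<open>H\<close>,
  and only the at most \<open>k\<close> vertices of the tuple lose anything.\<close>

lemma \<psi>_bounds:
  assumes l: "l \<in> tuples k A"
  shows "0 \<le> \<psi> l \<and> \<psi> l \<le> real k * H"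
proof -
  define e where "e = fst ` set l"
  define C' where "C' = next_cover C l"
  have C': "C \<subseteq> C'" "C' \<subseteq> C \<union> e"
    by (auto simp: C'_def next_cover_def e_def)
  define t where "t v = g (rem A v) - (if v \<in> C' then 0 else g (rem (A - set l) v))" for v
  have "stat V g (A - set l) C' = (\<Sum>v\<in>V - C. if v \<in> C' then 0 else g (rem (A - set l) v))"
    unfolding stat_def using finV C' by (intro sum.mono_neutral_cong_left) auto
  then have eq: "\<psi> l = (\<Sum>v\<in>V - C. t v)"
    by (simp add: \<psi>_def C'_def[symmetric] stat_def[of V g A C] t_def sum_subtractf)
  have t0: "0 \<le> t v" "t v \<le> H" for v
    using g_bounds[of "rem (A - set l) v" "rem A v"] rem_Diff_le rem_le[of v] by (auto simp: t_def)
  have "t v = 0" if "v \<in> V - C - e" for v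
    using that C' rem_Diff_eq[of v "set l"] by (auto simp: t_def e_def)
  then have "\<psi> l = (\<Sum>v\<in>(V - C) \<inter> e. t v)"
    unfolding eq using finV by (intro sum.mono_neutral_right) auto
  also have "\<dots> \<le> (\<Sum>v\<in>(V - C) \<inter> e. H)"
    using t0 by (intro sum_mono) auto
  also have "\<dots> \<le> real k * H"
  proof -
    have "card ((V - C) \<inter> e) \<le> card e"
      by (intro card_mono) (auto simp: e_def)
    also have "\<dots> \<le> length l"
      unfolding e_def using card_image_le[of "set l" fst] card_length[of l] by simp
    finally have "card ((V - C) \<inter> e) \<le> k"
      using l by (simp add: tuples_def)
    then show ?thesis
      using H by (simp add: mult_right_mono)
  qed
  finally show ?thesis
    using t0 by (auto simp: eq intro: sum_nonneg)
qed

text \<open>With distinct vertices each vertex of the tuple has exactly one point revealed, so the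
  loss splits over the coordinates.\<close>

lemma \<psi>_eq_\<phi>:
  assumes l: "l \<in> tuples k A" and dist: "distinct (map fst l)"
  shows "\<psi> l = \<phi> l"
proof -
  define e where "e = fst ` set l"
  have le: "l \<in> edge_tuples k e A"
    using l dist by (simp add: edge_tuples_def e_def)
  have inj: "inj_on fst (set l)" and dl: "distinct l"
    using dist by (auto simp: distinct_map)
  have eV: "e \<subseteq> V" "finite e"
    using AV l by (auto simp: e_def tuples_def)
  have sum_e: "(\<Sum>x\<leftarrow>l. h (fst x)) = (\<Sum>v\<in>e. h v)" for h :: "'v \<Rightarrow> real"
    using dl inj by (simp add: sum_list_distinct_conv_sum_set e_def sum.reindex)
  have remv: "rem (A - set l) v = rem A v - (if v \<in> e then 1 else 0)" for v
    using rem_Diff_tuple[OF finA le] by simp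
  show ?thesis
  proof (cases "e \<inter> C = {}")
    case True
    have "next_cover C l = C \<union> e"
      using dist True by (simp add: next_cover_def e_def)
    then have "stat V g (A - set l) (next_cover C l) = (\<Sum>v\<in>V - C - e. g (rem A v))"
      unfolding stat_def by (intro sum.cong) (auto simp: remv)
    moreover have "stat V g A C = (\<Sum>v\<in>V - C - e. g (rem A v)) + (\<Sum>v\<in>e. g (rem A v))"
      unfolding stat_def using True eV finV by (intro sum.subset_diff) auto
    ultimately have "\<psi> l = (\<Sum>x\<leftarrow>l. g (rem A (fst x)))"
      using sum_e[of "\<lambda>v. g (rem A v)"] by (simp add: \<psi>_def)
    also have "\<dots> = sum_list (map f1 l) + sum_list (map f2 l)"
      unfolding sum_list_addf[symmetric] using True
      by (intro arg_cong[of _ _ sum_list] map_cong refl) (auto simp: f1_def f2_def u_def e_def)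
    finally show ?thesis
      using True by (simp add: \<phi>_def prod_u e_def)
  next
    case False
    have "next_cover C l = C"
      using False by (auto simp: next_cover_def e_def)
    then have "\<psi> l = (\<Sum>v\<in>V - C. g (rem A v) - g (rem (A - set l) v))"
      by (simp add: \<psi>_def stat_def sum_subtractf)
    also have "\<dots> = (\<Sum>v\<in>e. of_bool (v \<notin> C) * (g (rem A v) - g (rem A v - 1)))"
      using finV eV by (intro sum.mono_neutral_cong) (auto simp: remv)
    also have "\<dots> = sum_list (map f1 l)"
      using sum_e[of "\<lambda>v. of_bool (v \<notin> C) * (g (rem A v) - g (rem A v - 1))"]
      by (simp add: f1_def[abs_def] u_def)
    finally show ?thesis
      using False by (simp add: \<phi>_def prod_u e_def)
  qed
qed

lemma sum_points: "(\<Sum>x\<in>A. u x * h (rem A (fst x))) = (\<Sum>v\<in>V - C. real (rem A v) * h (rem A v))"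
proof -
  have "(\<Sum>x\<in>A. u x * h (rem A (fst x))) = (\<Sum>v\<in>V. \<Sum>x | x \<in> A \<and> fst x = v. u x * h (rem A (fst x)))"
    using finA finV AV by (rule sum.group[symmetric])
  also have "\<dots> = (\<Sum>v\<in>V. \<Sum>x | x \<in> A \<and> fst x = v. of_bool (v \<notin> C) * h (rem A v))"
    by (intro sum.cong refl) (auto simp: u_def)
  also have "\<dots> = (\<Sum>v\<in>V. real (rem A v) * (of_bool (v \<notin> C) * h (rem A v)))"
    by (simp add: rem_def)
  also have "\<dots> = (\<Sum>v\<in>V - C. real (rem A v) * h (rem A v))"
    using finV by (intro sum.mono_neutral_cong_right) auto
  finally show ?thesis .
qed

text \<open>\<open>p\<close> is the proportion of unrevealed points at uncovered vertices. With
  replacement, a coordinate at an uncovered vertex always costs it a point, and costs the vertex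
  itself with probability \<open>p ^ (k - 1)\<close>, the chance that the other coordinates are
  uncovered. The right side pays for replacement and for repeated vertices.\<close>

lemma drift:
  defines "T \<equiv> real (card A)"
  defines "p \<equiv> (\<Sum>v\<in>V - C. real (rem A v)) / T"
  shows "\<bar>(\<Sum>l\<in>tuples k A. \<psi> l) / card (tuples k A) -
    real k / T * ((\<Sum>v\<in>V - C. real (rem A v) * (g (rem A v) - g (rem A v - 1))) +
      p ^ (k - 1) * (\<Sum>v\<in>V - C. real (rem A v) * g (rem A v - 1)))\<bar>
    \<le> real k * H * (real (k\<^sup>2 * D) / T)"
proof -
  define AA where "AA = {l. set l \<subseteq> A \<and> length l = k}"
  define DD where "DD = {l\<in>AA. distinct (map fst l)}"
  have T: "T > 0"
    using kA by (simp add: T_def)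
  have Tk: "T ^ k = T * T ^ (k - 1)"
    using power_minus_mult[of k T] kA(1) by (simp add: mult.commute)
  have AA: "finite AA" "real (card AA) = T ^ k"
    using finA by (simp_all add: AA_def finite_lists_length_eq card_lists_length_eq T_def)
  have "card (AA - DD) \<le> k\<^sup>2 * D * card A ^ (k - 1)"
  proof -
    have "AA - DD = {l. set l \<subseteq> A \<and> length l = k \<and> \<not> distinct (map fst l)}"
      by (auto simp: AA_def DD_def)
    then show ?thesis
      using card_repeating_lists[OF finA rem_le, of k] by simp
  qed
  then have "real (card (AA - DD)) \<le> real (k\<^sup>2 * D * card A ^ (k - 1))"
    by (rule of_nat_mono)
  also have "\<dots> = real (k\<^sup>2 * D) / T * real (card AA)"
    unfolding AA(2) Tk using T by (simp add: T_def)
  finally have few: "real (card (AA - DD)) \<le> real (k\<^sup>2 * D) / T * real (card AA)" .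
  have "\<bar>(\<Sum>l\<in>tuples k A. \<psi> l) / card (tuples k A) - (\<Sum>l\<in>AA. \<phi> l) / card AA\<bar> \<le>
      real k * H * (real (k\<^sup>2 * D) / T)"
  proof (rule avg_perturb[OF AA(1) _ _ _ _ _ _ few])
    show "DD \<subseteq> tuples k A"
      by (auto simp: DD_def AA_def tuples_def distinct_map)
    then show "\<psi> l = \<phi> l" if "l \<in> DD" for l
      using that by (intro \<psi>_eq_\<phi>) (auto simp: DD_def)
    show "tuples k A \<subseteq> AA"
      by (auto simp: AA_def tuples_def)
    show "tuples k A \<noteq> {}"
      using card_tuples_pos[OF finA kA(2)] by auto
    show "0 \<le> \<phi> l \<and> \<phi> l \<le> real k * H" if "l \<in> AA" for l
      using that by (intro \<phi>_bounds) (simp add: AA_def)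
  qed (rule \<psi>_bounds)
  moreover have "(\<Sum>l\<in>AA. \<phi> l) / card AA =
      real k / T * ((\<Sum>v\<in>V - C. real (rem A v) * (g (rem A v) - g (rem A v - 1))) +
      p ^ (k - 1) * (\<Sum>v\<in>V - C. real (rem A v) * g (rem A v - 1)))"
  proof -
    define S1 S2 where "S1 = (\<Sum>v\<in>V - C. real (rem A v) * (g (rem A v) - g (rem A v - 1)))"
      and "S2 = (\<Sum>v\<in>V - C. real (rem A v) * g (rem A v - 1))"
    have 1: "(\<Sum>l\<in>AA. sum_list (map f1 l)) = real k * S1 * T ^ (k - 1)"
    proof -
      have "(\<Sum>l\<in>AA. sum_list (map f1 l) * prod_list (map (\<lambda>_. 1) l)) = real k * (\<Sum>x\<in>A. f1 x * 1) * (\<Sum>x\<in>A. 1) ^ (k - 1)"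
        unfolding AA_def by (rule sum_lists_sum_prod)
      moreover have "prod_list (map (\<lambda>_. 1::real) l) = 1" for l :: "('v \<times> 'b) list"
        by (induction l) auto
      moreover have "(\<Sum>x\<in>A. f1 x) = S1"
        unfolding f1_def S1_def using sum_points[of "\<lambda>r. g r - g (r - 1)"] by simp
      ultimately show ?thesis
        by (simp add: T_def)
    qed
    have 2: "(\<Sum>l\<in>AA. sum_list (map f2 l) * prod_list (map u l)) = real k * S2 * (p * T) ^ (k - 1)"
    proof -
      have "(\<Sum>l\<in>AA. sum_list (map f2 l) * prod_list (map u l)) = real k * (\<Sum>x\<in>A. f2 x * u x) * (\<Sum>x\<in>A. u x) ^ (k - 1)"
        unfolding AA_def by (rule sum_lists_sum_prod)
      moreover have "(\<Sum>x\<in>A. f2 x * u x) = S2"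
      proof -
        have "f2 x * u x = u x * g (rem A (fst x) - 1)" for x
          by (cases "fst x \<in> C") (simp_all add: f2_def u_def)
        then show ?thesis
          unfolding S2_def using sum_points[of "\<lambda>r. g (r - 1)"] by (simp only:)
      qed
      moreover have "(\<Sum>x\<in>A. u x) = p * T"
        using sum_points[of "\<lambda>_. 1"] T by (simp add: p_def)
      ultimately show ?thesis
        by simp
    qed
    show ?thesis
      unfolding \<phi>_def sum.distrib 1 2 AA(2) Tk S1_def[symmetric] S2_def[symmetric]
      using T by (simp add: power_mult_distrib field_simps)
  qed
  ultimately show ?thesis
    by simp
qed

end

section \<open>Exponential moment of the potential\<close>

lemma exp_le_quadratic:
  fixes x :: real
  assumes "\<bar>x\<bar> \<le> 1"
  shows "exp x \<le> 1 + x + x\<^sup>2"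
proof (cases "0 \<le> x")
  case True
  then show ?thesis
    using assms exp_bound[of x] by simp
next
  case False
  define y where "y = - x"
  have y: "0 \<le> y"
    using False by (simp add: y_def)
  \<comment> \<open>The claim at x = - y is multiplied by \<open>exp y\<close>, for which the
    quadratic Taylor polynomial is a sufficient lower bound.\<close>
  have "1 \<le> (1 - y + y\<^sup>2) * (1 + y + y\<^sup>2 / 2)"
  proof -
    have "(1 - y + y\<^sup>2) * (1 + y + y\<^sup>2 / 2) = 1 + (y\<^sup>2 + y ^ 3 + y ^ 4) / 2"
      by (simp add: field_simps power2_eq_square power3_eq_cube power4_eq_xxxx)
    then show ?thesis
      using y by simp
  qed
  also have "\<dots> \<le> (1 - y + y\<^sup>2) * exp y"
  proof (rule mult_left_mono)
    show "1 + y + y\<^sup>2 / 2 \<le> exp y"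
      using exp_lower_Taylor_quadratic[OF y] by simp
    have "0 \<le> (1 - y)\<^sup>2 + y"
      using y by simp
    then show "0 \<le> 1 - y + y\<^sup>2"
      by (simp add: power2_eq_square algebra_simps)
  qed
  finally have "exp (- y) \<le> 1 - y + y\<^sup>2"
    by (simp add: exp_minus divide_simps)
  then show ?thesis
    by (simp add: y_def)
qed

text \<open>Let F be the sum of the squares of \<open>E i\<close> and Y its increment. The mean of Y
  is O(F / n + 1), because the mean of \<delta> is at most 1 / n times the errors up to constants,
  and Y^2 is O(F + 1). By \<open>exp_le_quadratic\<close> the exponent grows by O(\<theta> F / n^2 +
  1 / n) only. As \<open>c\<close> depends on neither \<open>n\<close> nor \<theta>, the step can be
  iterated.\<close>

lemma exp_potential_step:
  fixes c0 c1 c3 :: real and m :: nat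
  assumes "0 \<le> c0" "0 \<le> c1" "0 \<le> c3"
  defines "\<theta>0 \<equiv> 1 / (real m * (2 * c1 * c0 + c1\<^sup>2) + 1)"
    and "c \<equiv> 4 * real m * c3 + 8 * real m * c1\<^sup>2 + 2 * c3 + real m * c1\<^sup>2 + 2 * (real m)\<^sup>2 * c1 ^ 4"
  fixes E :: "nat \<Rightarrow> real" and \<delta> :: "nat \<Rightarrow> 'l \<Rightarrow> real" and L :: "'l set" and n :: nat and \<theta> :: real
  assumes L: "finite L" "L \<noteq> {}" and n: "n \<ge> 1" and \<theta>: "0 \<le> \<theta>" "\<theta> \<le> \<theta>0"
    and \<delta>: "\<And>i l. i < m \<Longrightarrow> l \<in> L \<Longrightarrow> \<bar>\<delta> i l\<bar> \<le> c1"
    and E: "\<And>i. i < m \<Longrightarrow> \<bar>E i\<bar> \<le> c0 * n"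
    and mean: "\<And>i. i < m \<Longrightarrow> \<bar>(\<Sum>l\<in>L. \<delta> i l) / card L\<bar> \<le> c3 / n * (1 + (\<Sum>j<m. \<bar>E j\<bar>))"
  shows "(\<Sum>l\<in>L. exp (\<theta> * ((\<Sum>i<m. (E i + \<delta> i l)\<^sup>2) / n))) \<le>
    card L * exp (\<theta> * (1 + c / n) * ((\<Sum>i<m. (E i)\<^sup>2) / n) + c / n)"
proof -
  define F where "F = (\<Sum>i<m. (E i)\<^sup>2)"
  define M where "M = (\<Sum>i<m. \<bar>E i\<bar>)"
  define Y where "Y l = (\<Sum>i<m. 2 * E i * \<delta> i l + (\<delta> i l)\<^sup>2)" for l
  define a where "a i = 2 * c1 * \<bar>E i\<bar> + c1\<^sup>2" for i
  have n': "real n \<ge> 1" "real n > 0"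
    using n by auto
  have Lip: "real (card L) > 0"
    using L by (simp add: card_gt_0_iff)
  have F: "0 \<le> F" and M: "0 \<le> M"
    by (auto simp: F_def M_def intro: sum_nonneg)
  have MF: "M\<^sup>2 \<le> real m * F"
    using sum_squared_le_sum_of_squares[of "\<lambda>i. \<bar>E i\<bar>" "{..<m}"] by (simp add: M_def F_def mult.commute)
  have a0: "0 \<le> a i" for i
    using assms(2) by (simp add: a_def)
  have summand: "\<bar>2 * E i * \<delta> i l + (\<delta> i l)\<^sup>2\<bar> \<le> a i" if "i < m" "l \<in> L" for i l
  proof -
    have "\<bar>E i\<bar> * \<bar>\<delta> i l\<bar> \<le> \<bar>E i\<bar> * c1"
      using \<delta>[OF that] by (intro mult_left_mono) auto
    moreover have "(\<delta> i l)\<^sup>2 \<le> c1\<^sup>2"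
      using power_mono[OF \<delta>[OF that], of 2] by simp
    moreover have "\<bar>2 * E i * \<delta> i l\<bar> = 2 * (\<bar>E i\<bar> * \<bar>\<delta> i l\<bar>)"
      by (simp add: abs_mult)
    moreover have "0 \<le> (\<delta> i l)\<^sup>2"
      by simp
    ultimately show ?thesis
      unfolding a_def using abs_triangle_ineq[of "2 * E i * \<delta> i l" "(\<delta> i l)\<^sup>2"] by (simp add: mult.commute mult.left_commute)
  qed
  have Ya: "\<bar>Y l\<bar> \<le> (\<Sum>i<m. a i)" if "l \<in> L" for l
    unfolding Y_def using summand that by (intro order.trans[OF sum_abs] sum_mono) auto
  have Yn: "\<bar>Y l\<bar> \<le> n * (real m * (2 * c1 * c0 + c1\<^sup>2))" if "l \<in> L" for l
  proof -
    have "a i \<le> n * (2 * c1 * c0 + c1\<^sup>2)" if "i < m" for i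
    proof -
      have "2 * c1 * \<bar>E i\<bar> \<le> 2 * c1 * (c0 * n)"
        using E[OF that] assms(2) by (intro mult_left_mono) auto
      moreover have "1 * c1\<^sup>2 \<le> n * c1\<^sup>2"
        using n' by (intro mult_right_mono) auto
      ultimately show ?thesis
        by (simp add: a_def algebra_simps)
    qed
    then have "(\<Sum>i<m. a i) \<le> (\<Sum>i<m. n * (2 * c1 * c0 + c1\<^sup>2))"
      by (intro sum_mono) auto
    then show ?thesis
      using Ya[OF that] by (simp add: algebra_simps)
  qed
  have Y2: "(Y l)\<^sup>2 \<le> 8 * real m * c1\<^sup>2 * F + 2 * (real m)\<^sup>2 * c1 ^ 4" if "l \<in> L" for l
  proof -
    have "(Y l)\<^sup>2 \<le> (\<Sum>i<m. a i)\<^sup>2"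
      using power_mono[OF Ya[OF that], of 2] by simp
    also have "\<dots> \<le> (\<Sum>i<m. (a i)\<^sup>2) * real m"
      using sum_squared_le_sum_of_squares[of a "{..<m}"] by simp
    also have "\<dots> \<le> (\<Sum>i<m. 8 * c1\<^sup>2 * (E i)\<^sup>2 + 2 * c1 ^ 4) * real m"
    proof (intro mult_right_mono sum_mono)
      fix i
      have "(x + y)\<^sup>2 \<le> 2 * x\<^sup>2 + 2 * y\<^sup>2" for x y :: real
        using zero_le_power2[of "x - y"] by (simp add: power2_eq_square algebra_simps)
      from this[of "2 * c1 * \<bar>E i\<bar>" "c1\<^sup>2"]
      show "(a i)\<^sup>2 \<le> 8 * c1\<^sup>2 * (E i)\<^sup>2 + 2 * c1 ^ 4"
        by (simp add: a_def power_mult_distrib)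
    qed simp
    also have "\<dots> = 8 * real m * c1\<^sup>2 * F + 2 * (real m)\<^sup>2 * c1 ^ 4"
    proof -
      have "(\<Sum>i<m. 8 * c1\<^sup>2 * (E i)\<^sup>2 + 2 * c1 ^ 4) = 8 * c1\<^sup>2 * F + real m * (2 * c1 ^ 4)"
        by (simp add: F_def sum.distrib sum_distrib_left)
      then show ?thesis
        by (simp add: power2_eq_square algebra_simps)
    qed
    finally show ?thesis .
  qed
  have avgY: "(\<Sum>l\<in>L. Y l) / card L \<le> 4 * real m * c3 * (F / n) + 2 * c3 + real m * c1\<^sup>2"
  proof -
    define b where "b i = (\<Sum>l\<in>L. \<delta> i l) / card L" for i
    have "(\<Sum>l\<in>L. Y l) = (\<Sum>i<m. 2 * E i * (\<Sum>l\<in>L. \<delta> i l) + (\<Sum>l\<in>L. (\<delta> i l)\<^sup>2))"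
      unfolding Y_def by (subst sum.swap) (simp add: sum.distrib sum_distrib_left)
    then have "(\<Sum>l\<in>L. Y l) / card L = (\<Sum>i<m. 2 * E i * b i + (\<Sum>l\<in>L. (\<delta> i l)\<^sup>2) / card L)"
      by (simp add: b_def sum_divide_distrib[of _ "{..<m}"] add_divide_distrib)
    also have "\<dots> \<le> (\<Sum>i<m. 2 * c3 / n * (1 + M) * \<bar>E i\<bar> + c1\<^sup>2)"
    proof (intro sum_mono add_mono)
      fix i assume i: "i \<in> {..<m}"
      have "\<bar>E i\<bar> * \<bar>b i\<bar> \<le> \<bar>E i\<bar> * (c3 / n * (1 + M))"
        using mean[of i] i by (intro mult_left_mono) (auto simp: b_def M_def)
      moreover have "E i * b i \<le> \<bar>E i\<bar> * \<bar>b i\<bar>"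
        by (simp add: abs_mult[symmetric])
      moreover have "2 * E i * b i = 2 * (E i * b i)"
        "2 * c3 / n * (1 + M) * \<bar>E i\<bar> = 2 * (\<bar>E i\<bar> * (c3 / n * (1 + M)))"
        by simp_all
      ultimately show "2 * E i * b i \<le> 2 * c3 / n * (1 + M) * \<bar>E i\<bar>"
        by linarith
      have "(\<Sum>l\<in>L. (\<delta> i l)\<^sup>2) \<le> (\<Sum>l\<in>L. c1\<^sup>2)"
        using \<delta>[of i] i power_mono[of "\<bar>\<delta> i l\<bar>" c1 2 for l] by (intro sum_mono) auto
      then show "(\<Sum>l\<in>L. (\<delta> i l)\<^sup>2) / card L \<le> c1\<^sup>2"
        using Lip by (simp add: divide_simps mult.commute)
    qed
    also have "\<dots> = 2 * c3 / n * (M * (1 + M)) + real m * c1\<^sup>2"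
      unfolding sum.distrib sum_distrib_left[symmetric] M_def[symmetric] by (simp add: mult.commute mult.left_commute)
    also have "2 * c3 / n * (M * (1 + M)) \<le> 2 * c3 / n * (1 + 2 * (real m * F))"
    proof (rule mult_left_mono)
      have "2 * M \<le> 1 + M\<^sup>2"
        using zero_le_power2[of "1 - M"] by (simp add: power2_eq_square algebra_simps)
      then have "M \<le> 1 + M\<^sup>2"
        using M by linarith
      then show "M * (1 + M) \<le> 1 + 2 * (real m * F)"
        using MF by (simp add: power2_eq_square algebra_simps)
    qed (use assms(3) in simp)
    also have "\<dots> \<le> 2 * c3 + 4 * real m * c3 * (F / n)"
    proof -
      have "2 * c3 / n \<le> 2 * c3"
        using divide_left_mono[of 1 "real n" "2 * c3"] n' assms(3) by simp
      then show ?thesis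
        by (simp add: algebra_simps)
    qed
    finally show ?thesis
      by simp
  qed
  have den: "real m * (2 * c1 * c0 + c1\<^sup>2) \<ge> 0"
    using assms by simp
  have \<theta>1: "\<theta> \<le> 1"
  proof -
    have "\<theta>0 \<le> 1"
      unfolding \<theta>0_def using den by (simp add: divide_simps)
    then show ?thesis
      using \<theta> by simp
  qed
  \<comment> \<open>The denominator of \<theta>0 is the a priori bound for Y / n, plus 1 so that
    also \<theta>0 \<le> 1.\<close>
  have small: "\<bar>\<theta> * (Y l / n)\<bar> \<le> 1" if "l \<in> L" for l
  proof -
    have "\<bar>Y l\<bar> / n \<le> real m * (2 * c1 * c0 + c1\<^sup>2)"
      using Yn[OF that] n' by (simp add: divide_simps mult.commute)
    then have "\<theta> * (\<bar>Y l\<bar> / n) \<le> \<theta>0 * (real m * (2 * c1 * c0 + c1\<^sup>2))"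
      using \<theta> den by (intro mult_mono) auto
    also have "\<dots> \<le> 1"
      unfolding \<theta>0_def using den by (simp add: divide_simps)
    finally show ?thesis
      using \<theta> by (simp add: abs_mult)
  qed
  have "(\<Sum>l\<in>L. exp (\<theta> * (Y l / n))) \<le> (\<Sum>l\<in>L. 1 + \<theta> * (Y l / n) + (\<theta> * (Y l / n))\<^sup>2)"
    using small by (intro sum_mono exp_le_quadratic) auto
  also have "\<dots> \<le> (\<Sum>l\<in>L. 1 + \<theta> / n * Y l + \<theta> * ((8 * real m * c1\<^sup>2 * F + 2 * (real m)\<^sup>2 * c1 ^ 4) / (real n)\<^sup>2))"
  proof (intro sum_mono add_mono order.refl)
    fix l assume l: "l \<in> L"
    have "(\<theta> * (Y l / n))\<^sup>2 = \<theta>\<^sup>2 * ((Y l)\<^sup>2 / (real n)\<^sup>2)"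
      by (simp add: power_mult_distrib power_divide)
    also have "\<dots> \<le> \<theta> * ((8 * real m * c1\<^sup>2 * F + 2 * (real m)\<^sup>2 * c1 ^ 4) / (real n)\<^sup>2)"
    proof (rule mult_mono)
      \<comment> \<open>Replacing the square by \<theta> lets the second moment be absorbed in the
        factor \<open>1 + c / n\<close> of \<theta>.\<close>
      show "\<theta>\<^sup>2 \<le> \<theta>"
        using \<theta> \<theta>1 mult_left_mono[of \<theta> 1 \<theta>] by (simp add: power2_eq_square)
      show "(Y l)\<^sup>2 / (real n)\<^sup>2 \<le> (8 * real m * c1\<^sup>2 * F + 2 * (real m)\<^sup>2 * c1 ^ 4) / (real n)\<^sup>2"
        using Y2[OF l] by (intro divide_right_mono) auto
    qed (use \<theta> in auto)
    finally show "(\<theta> * (Y l / n))\<^sup>2 \<le> \<theta> * ((8 * real m * c1\<^sup>2 * F + 2 * (real m)\<^sup>2 * c1 ^ 4) / (real n)\<^sup>2)" .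
  qed simp
  also have "\<dots> = card L * (1 + \<theta> / n * ((\<Sum>l\<in>L. Y l) / card L) +
      \<theta> * ((8 * real m * c1\<^sup>2 * F + 2 * (real m)\<^sup>2 * c1 ^ 4) / (real n)\<^sup>2))"
    unfolding sum.distrib sum_distrib_left[symmetric] using Lip by (simp add: distrib_left)
  also have "\<dots> \<le> card L * (1 + (\<theta> * (c / n) * (F / n) + c / n))"
  proof (rule mult_left_mono)
    have 1: "\<theta> / n * ((\<Sum>l\<in>L. Y l) / card L) \<le> \<theta> / n * (4 * real m * c3 * (F / n) + 2 * c3 + real m * c1\<^sup>2)"
      using avgY \<theta> by (intro mult_left_mono) auto
    have 2: "\<theta> / n * (2 * c3 + real m * c1\<^sup>2) \<le> 1 / n * (2 * c3 + real m * c1\<^sup>2)"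
      using \<theta>1 assms(3) n' by (intro mult_right_mono divide_right_mono) auto
    have 3: "\<theta> * (2 * (real m)\<^sup>2 * c1 ^ 4 / (real n)\<^sup>2) \<le> 1 * (2 * (real m)\<^sup>2 * c1 ^ 4 / n)"
      using \<theta>1 \<theta> n' by (intro mult_mono divide_left_mono) (auto simp: power2_eq_square)
    define P where "P = \<theta> * (F / n) / n"
    have P: "0 \<le> P"
      using F \<theta> by (simp add: P_def)
    have "c * P = (4 * real m * c3 + 8 * real m * c1\<^sup>2) * P +
        (2 * c3 + real m * c1\<^sup>2 + 2 * (real m)\<^sup>2 * c1 ^ 4) * P"
      by (simp add: c_def algebra_simps)
    moreover have "0 \<le> (2 * c3 + real m * c1\<^sup>2 + 2 * (real m)\<^sup>2 * c1 ^ 4) * P"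
      using P assms(3) by (intro mult_nonneg_nonneg add_nonneg_nonneg) auto
    ultimately have 4: "(4 * real m * c3 + 8 * real m * c1\<^sup>2) * P \<le> c * P"
      by linarith
    have 5: "1 / n * (2 * c3 + real m * c1\<^sup>2) + 2 * (real m)\<^sup>2 * c1 ^ 4 / n \<le> c / n"
      unfolding add_divide_distrib[symmetric] times_divide_eq_left mult_1_left
      using assms(3) by (intro divide_right_mono) (auto simp: c_def)
    have 6: "\<theta> / n * (4 * real m * c3 * (F / n) + 2 * c3 + real m * c1\<^sup>2) =
        4 * real m * c3 * P + \<theta> / n * (2 * c3 + real m * c1\<^sup>2)"
      by (simp add: P_def algebra_simps)
    have 7: "\<theta> * ((8 * real m * c1\<^sup>2 * F + 2 * (real m)\<^sup>2 * c1 ^ 4) / (real n)\<^sup>2) =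
        8 * real m * c1\<^sup>2 * P + \<theta> * (2 * (real m)\<^sup>2 * c1 ^ 4 / (real n)\<^sup>2)"
      by (simp add: P_def add_divide_distrib distrib_left power2_eq_square)
    have 8: "\<theta> * (c / n) * (F / n) = c * P"
      by (simp add: P_def)
    show "1 + \<theta> / n * ((\<Sum>l\<in>L. Y l) / card L) + \<theta> * ((8 * real m * c1\<^sup>2 * F + 2 * (real m)\<^sup>2 * c1 ^ 4) / (real n)\<^sup>2)
        \<le> 1 + (\<theta> * (c / n) * (F / n) + c / n)"
      using 1 2 3 4 5 unfolding 6 7 8 distrib_right by linarith
  qed simp
  also have "\<dots> \<le> card L * exp (\<theta> * (c / n) * (F / n) + c / n)"
    by (intro mult_left_mono exp_ge_add_one_self) simp
  finally have main: "(\<Sum>l\<in>L. exp (\<theta> * (Y l / n))) \<le> card L * exp (\<theta> * (c / n) * (F / n) + c / n)" .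
  have split: "exp (\<theta> * ((\<Sum>i<m. (E i + \<delta> i l)\<^sup>2) / n)) = exp (\<theta> * (F / n)) * exp (\<theta> * (Y l / n))" for l
  proof -
    have "(\<Sum>i<m. (E i + \<delta> i l)\<^sup>2) = F + Y l"
      unfolding F_def Y_def sum.distrib[symmetric]
      by (intro sum.cong refl) (simp add: power2_eq_square algebra_simps)
    then show ?thesis
      by (simp add: exp_add[symmetric] add_divide_distrib distrib_left)
  qed
  have "(\<Sum>l\<in>L. exp (\<theta> * ((\<Sum>i<m. (E i + \<delta> i l)\<^sup>2) / n))) =
      exp (\<theta> * (F / n)) * (\<Sum>l\<in>L. exp (\<theta> * (Y l / n)))"
    unfolding split sum_distrib_left ..
  also have "\<dots> \<le> exp (\<theta> * (F / n)) * (card L * exp (\<theta> * (c / n) * (F / n) + c / n))"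
    using main by (intro mult_left_mono) auto
  also have "\<dots> = card L * exp (\<theta> * (1 + c / n) * (F / n) + c / n)"
    by (simp add: exp_add[symmetric] algebra_simps)
  finally show ?thesis
    by (simp add: F_def)
qed

section \<open>Concentration around the trajectory\<close>

text \<open>The quantity \<open>B\<^sub>i\<close>; in particular \<open>B\<^sub>0\<close> counts the uncovered vertices and \<open>B\<^sub>1\<close> their unrevealed points.\<close>

definition fstat :: "'v set \<Rightarrow> nat \<Rightarrow> ('v \<times> 'b) set \<Rightarrow> 'v set \<Rightarrow> real" where
  "fstat V i = stat V (\<lambda>r. real (r choose i))"

text \<open>The absorption identities turn the two sums in \<open>drift\<close> into binomial sums
  again, of index \<open>i\<close> and \<open>Suc i\<close>; this closes the system for the
  \<open>B\<^sub>i\<close>.\<close>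

lemma choose_step:
  assumes "r \<ge> 1"
  shows "real r * (real (r choose i) - real ((r - 1) choose i)) = real i * real (r choose i)"
    and "real r * real ((r - 1) choose i) = real (Suc i) * real (r choose Suc i)"
proof -
  have "Suc i * (r choose Suc i) = r * ((r - 1) choose i)"
    by (rule binomial_absorption)
  then show 2: "real r * real ((r - 1) choose i) = real (Suc i) * real (r choose Suc i)"
    by (metis of_nat_mult)
  show "real r * (real (r choose i) - real ((r - 1) choose i)) = real i * real (r choose i)"
  proof (cases "i \<le> r")
    case True
    have "(r - i) * (r choose i) = r * ((r - 1) choose i)"
      by (rule binomial_absorb_comp)
    then have "(real r - real i) * real (r choose i) = real r * real ((r - 1) choose i)"
      using True by (metis of_nat_diff of_nat_mult)
    then show ?thesis
      by (simp add: algebra_simps)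
  qed (simp add: binomial_eq_0)
qed

lemma fstat_drift:
  fixes A :: "('v \<times> 'b) set" and C :: "'v set"
  assumes "finite V" "finite A" "fst ` A \<subseteq> V" and rem_le: "\<And>v. rem A v \<le> D"
    and "1 \<le> k" "k \<le> card A"
  defines "T \<equiv> real (card A)"
  defines "p \<equiv> fstat V 1 A C / T"
  shows "\<bar>(\<Sum>l\<in>tuples k A. fstat V i A C - fstat V i (A - set l) (next_cover C l)) / card (tuples k A) -
      real k / T * (real i * fstat V i A C + real (Suc i) * (p ^ (k - 1) * fstat V (Suc i) A C))\<bar>
      \<le> real k * 2 ^ D * (real (k\<^sup>2 * D) / T)" (is ?th1)
    and "l \<in> tuples k A \<Longrightarrow> 0 \<le> fstat V i A C - fstat V i (A - set l) (next_cover C l) \<and>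
      fstat V i A C - fstat V i (A - set l) (next_cover C l) \<le> real k * 2 ^ D" (is "_ \<Longrightarrow> ?th2")
proof -
  have "(D choose i) \<le> 2 ^ D"
    by (cases "i \<le> D") (simp_all add: binomial_le_pow2 binomial_eq_0)
  then have "real (D choose i) \<le> 2 ^ D"
    by (metis of_nat_le_iff of_nat_numeral of_nat_power)
  then interpret statistic V C A k D "\<lambda>r. real (r choose i)" "2 ^ D"
    using assms by unfold_locales (auto simp: mono_def binomial_right_mono)
  have \<psi>: "\<psi> l = fstat V i A C - fstat V i (A - set l) (next_cover C l)" for l
    by (simp add: \<psi>_def fstat_def)
  have 1: "(\<Sum>v\<in>V - C. real (rem A v)) = fstat V 1 A C"
    by (simp add: fstat_def stat_def)
  have 2: "(\<Sum>v\<in>V - C. real (rem A v) * (real (rem A v choose i) - real ((rem A v - 1) choose i))) = real i * fstat V i A C"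
    unfolding fstat_def stat_def sum_distrib_left
  proof (intro sum.cong refl)
    fix v
    show "real (rem A v) * (real (rem A v choose i) - real ((rem A v - 1) choose i)) = real i * real (rem A v choose i)"
      using choose_step(1)[of "rem A v" i] by (cases "rem A v = 0"; cases i) auto
  qed
  have 3: "(\<Sum>v\<in>V - C. real (rem A v) * real ((rem A v - 1) choose i)) = real (Suc i) * fstat V (Suc i) A C"
    unfolding fstat_def stat_def sum_distrib_left
  proof (intro sum.cong refl)
    fix v
    show "real (rem A v) * real ((rem A v - 1) choose i) = real (Suc i) * real (rem A v choose Suc i)"
      using choose_step(2)[of "rem A v" i] by (cases "rem A v = 0") auto
  qed
  show ?th1
    using drift unfolding \<psi> 1 2 3 T_def p_def by (simp add: mult.left_commute)
  show ?th2 if "l \<in> tuples k A"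
    using \<psi>_bounds[OF that] unfolding \<psi> .
qed

lemma fstat_bounds:
  fixes A :: "('v \<times> 'b) set"
  assumes "finite V" and rem_le: "\<And>v. rem A v \<le> D"
  shows "0 \<le> fstat V i A C" "fstat V i A C \<le> real (card V) * 2 ^ D"
    "D < i \<Longrightarrow> fstat V i A C = 0"
proof -
  show "0 \<le> fstat V i A C"
    by (simp add: fstat_def stat_def sum_nonneg)
  have le: "real (rem A v choose i) \<le> 2 ^ D" for v
  proof -
    have "(rem A v choose i) \<le> 2 ^ rem A v"
      by (cases "i \<le> rem A v") (simp_all add: binomial_le_pow2 binomial_eq_0)
    also have "\<dots> \<le> 2 ^ D"
      using rem_le by (intro power_increasing) auto
    finally show ?thesis
      by (metis of_nat_le_iff of_nat_numeral of_nat_power)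
  qed
  have "fstat V i A C \<le> (\<Sum>v\<in>V - C. 2 ^ D)"
    unfolding fstat_def stat_def using le by (intro sum_mono) auto
  also have "\<dots> = real (card (V - C)) * 2 ^ D"
    by simp
  also have "\<dots> \<le> real (card V) * 2 ^ D"
    using assms(1) by (intro mult_right_mono) (auto intro: card_mono)
  finally show "fstat V i A C \<le> real (card V) * 2 ^ D" .
  show "fstat V i A C = 0" if "D < i"
    unfolding fstat_def stat_def using that rem_le le_less_trans by (intro sum.neutral) (auto simp: binomial_eq_0)
qed

lemma fstat_1_le:
  fixes A :: "('v \<times> 'b) set"
  assumes "finite V" "finite A" "fst ` A \<subseteq> V"
  shows "fstat V 1 A C \<le> real (card A)"
proof -
  have "fstat V 1 A C \<le> (\<Sum>v\<in>V. real (rem A v))"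
    unfolding fstat_def stat_def using assms(1) by (simp add: sum_mono2)
  also have "(\<Sum>v\<in>V. rem A v) = card A"
  proof -
    have "(\<Sum>v\<in>V. rem A v) = (\<Sum>v\<in>V. \<Sum>x | x \<in> A \<and> fst x = v. 1)"
      by (simp add: rem_def)
    also have "\<dots> = (\<Sum>x\<in>A. 1)"
      using assms by (intro sum.group)
    finally show ?thesis
      by simp
  qed
  then have "(\<Sum>v\<in>V. real (rem A v)) = real (card A)"
    by (metis of_nat_sum)
  finally show ?thesis .
qed

section \<open>Deviation from the trajectory in one step\<close>

lemma abs_le_of_abs_add_le:
  fixes a b :: real
  shows "\<bar>a + b\<bar> \<le> c \<Longrightarrow> c \<le> c' \<Longrightarrow> 0 \<le> b \<Longrightarrow> b \<le> b' \<Longrightarrow> \<bar>a\<bar> \<le> c' + b'"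
  by linarith

lemma abs_diff3_le:
  fixes a b c x :: real
  shows "x = - a - b - c \<Longrightarrow> \<bar>a\<bar> \<le> A \<Longrightarrow> \<bar>b\<bar> \<le> B \<Longrightarrow> A \<le> A' \<Longrightarrow> B \<le> B' \<Longrightarrow> \<bar>c\<bar> \<le> C \<Longrightarrow>
    \<bar>x\<bar> \<le> A' + B' + C"
  by linarith

context degree_distribution
begin

definition err :: "nat \<Rightarrow> nat \<Rightarrow> 'v set \<Rightarrow> nat \<Rightarrow> ('v \<times> 'b) set \<Rightarrow> 'v set \<Rightarrow> real" where
  "err n N V i A C = fstat V i A C - real n * traj i (real (card A) / real N)"

text \<open>The first argument of \<open>err\<close> and \<open>pot\<close> is the number of vertices, the second the initial number of points.\<close>

definition pot :: "nat \<Rightarrow> nat \<Rightarrow> 'v set \<Rightarrow> ('v \<times> 'b) set \<Rightarrow> 'v set \<Rightarrow> real" where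
  "pot n N V A C = (\<Sum>i<Suc \<Delta>. (err n N V i A C)\<^sup>2) / real n"

text \<open>All conditions pass to subsets of \<open>A\<close>, so they hold throughout the scan.
  The last one leaves room for the rounding in \<open>degree_profile\<close>.\<close>

definition state :: "nat \<Rightarrow> nat \<Rightarrow> 'v set \<Rightarrow> ('v \<times> 'b) set \<Rightarrow> bool" where
  "state n N V A \<longleftrightarrow> n \<ge> 1 \<and> finite V \<and> card V = n \<and> finite A \<and> fst ` A \<subseteq> V \<and>
     (\<forall>v. rem A v \<le> \<Delta>) \<and> n \<le> N \<and> card A \<le> N \<and> \<bar>real n * P_coeff 1 1 - real N\<bar> \<le> (real \<Delta>)\<^sup>2"

lemma traj_eq_0: "\<Delta> < i \<Longrightarrow> traj i s = 0"
  by (auto simp: traj_def P_coeff_def binomial_eq_0 intro!: sum.neutral)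

lemma err_bound:
  fixes A :: "('v \<times> 'b) set"
  assumes "state n N V A"
  shows "\<bar>err n N V i A C\<bar> \<le> 2 ^ \<Delta> * real n" "\<Delta> < i \<Longrightarrow> err n N V i A C = 0"
proof -
  have s: "finite V" "\<And>v. rem A v \<le> \<Delta>" "card V = n" "0 \<le> real (card A) / real N" "real (card A) / real N \<le> 1"
    using assms by (auto simp: state_def divide_simps)
  have "0 \<le> fstat V i A C" "fstat V i A C \<le> real n * 2 ^ \<Delta>"
    using fstat_bounds[OF s(1,2), of i C] s by auto
  moreover have "0 \<le> real n * traj i (real (card A) / real N)" "real n * traj i (real (card A) / real N) \<le> real n * 2 ^ \<Delta>"
    using traj_bounds[OF s(4,5), of i] by (auto intro: mult_left_mono)
  ultimately show "\<bar>err n N V i A C\<bar> \<le> 2 ^ \<Delta> * real n"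
    by (simp add: err_def mult.commute)
  show "err n N V i A C = 0" if "\<Delta> < i"
    using fstat_bounds(3)[OF s(1,2) that] that by (simp add: err_def traj_eq_0)
qed

text \<open>Once the trajectory is subtracted, three sources of drift remain: sampling,
  discretisation, and the current errors, which enter linearly. All carry a factor 1 / n since at
  least \<sigma> N points are unrevealed; the constants depend on \<sigma> but not on the
  state.\<close>

lemma err_increment:
  assumes \<sigma>: "0 < \<sigma>" "\<sigma> \<le> 1"
  shows "\<exists>c1\<ge>0. \<exists>c3\<ge>0. \<forall>n N (V :: 'v set) (A :: ('v \<times> 'b) set) C i.
    state n N V A \<longrightarrow> \<sigma> * real N \<le> real (card A) \<longrightarrow> k \<le> card A \<longrightarrow> i < Suc \<Delta> \<longrightarrow>
    (\<forall>l\<in>tuples k A. \<bar>err n N V i (A - set l) (next_cover C l) - err n N V i A C\<bar> \<le> c1) \<and>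
    \<bar>(\<Sum>l\<in>tuples k A. err n N V i (A - set l) (next_cover C l) - err n N V i A C) / card (tuples k A)\<bar>
      \<le> c3 / n * (1 + (\<Sum>j<Suc \<Delta>. \<bar>err n N V j A C\<bar>))"
proof -
  obtain K where K: "K \<ge> 0" and Taylor: "\<And>s h i. i \<le> \<Delta> \<Longrightarrow> 0 \<le> h \<Longrightarrow> h \<le> s \<Longrightarrow> 0 < s \<Longrightarrow> s \<le> 1 \<Longrightarrow>
    \<bar>traj i (s - h) - traj i s + h / s * (real i * traj i s + real (Suc i) * rate (\<alpha> s) * traj (Suc i) s)\<bar> \<le> K * h\<^sup>2"
    using traj_Taylor by blast
  \<comment> \<open>Controls the replacement of \<open>p ^ (k - 1)\<close> by its limit: k - 1 is
    the Lipschitz constant of the power on [0, 1], \<open>2 ^ \<Delta> / \<sigma>\<close> bounds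
    \<open>n * traj (Suc i) s / T\<close>, and the last factor collects the error of
    \<open>p\<close>.\<close>
  define R where "R = real (k - 1) * (2 ^ \<Delta> / \<sigma>) * (1 + 2 ^ \<Delta> * (real \<Delta>)\<^sup>2 / P_coeff 1 1)"
  define c1 where "c1 = real k * 2 ^ \<Delta> + (K * (real k)\<^sup>2 + real k / \<sigma> * ((2 * real \<Delta> + 1) * 2 ^ \<Delta>))"
  define c2 where "c2 = real k * 2 ^ \<Delta> * real (k\<^sup>2 * \<Delta>) / \<sigma> + K * (real k)\<^sup>2"
  define c3 where "c3 = c2 + real k / \<sigma> * (real \<Delta> + (real \<Delta> + 1) * (1 + R))"
  have R: "0 \<le> R"
    using \<sigma> P1_pos[of 1] by (simp add: R_def)
  have c: "0 \<le> c1" "0 \<le> c2" "0 \<le> c3"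
    using \<sigma> K R by (auto simp: c1_def c2_def c3_def)
  have main: "(\<forall>l\<in>tuples k A. \<bar>err n N V i (A - set l) (next_cover C l) - err n N V i A C\<bar> \<le> c1) \<and>
    \<bar>(\<Sum>l\<in>tuples k A. err n N V i (A - set l) (next_cover C l) - err n N V i A C) / card (tuples k A)\<bar>
      \<le> c3 / n * (1 + (\<Sum>j<Suc \<Delta>. \<bar>err n N V j A C\<bar>))"
    if st: "state n N V A" and T\<sigma>: "\<sigma> * real N \<le> real (card A)" and kA: "k \<le> card A" and i: "i < Suc \<Delta>"
    for n N i C and V :: "'v set" and A :: "('v \<times> 'b) set"
  proof -
    define T where "T = real (card A)"
    define s where "s = T / real N"
    define h where "h = real k / real N"
    define p where "p = fstat V 1 A C / T"
    define q where "q = rate (\<alpha> s)"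
    define e where "e j = err n N V j A C" for j
    define M where "M = (\<Sum>j<Suc \<Delta>. \<bar>e j\<bar>)"
    define d where "d = traj i (s - h) - traj i s"
    define D where "D l = fstat V i A C - fstat V i (A - set l) (next_cover C l)" for l
    have S: "finite V" "finite A" "fst ` A \<subseteq> V" "\<And>v. rem A v \<le> \<Delta>" "1 \<le> k"
      "n \<ge> 1" "n \<le> N" "card A \<le> N" "card V = n"
      using st k by (auto simp: state_def)
    have pos: "real n > 0" "real N > 0" "T > 0" "real N \<ge> real n"
      using S kA by (auto simp: T_def)
    have s: "0 < s" "s \<le> 1"
      using pos S(8) by (auto simp: s_def T_def)
    have h: "0 \<le> h" "h \<le> s" "h \<le> 1"
      using kA S(8) pos by (auto simp: h_def s_def T_def divide_simps)
    have nT: "real n / T \<le> 1 / \<sigma>" "1 / T \<le> 1 / (\<sigma> * n)"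
    proof -
      have "\<sigma> * n \<le> \<sigma> * N"
        using pos \<sigma> by (intro mult_left_mono) auto
      then have "\<sigma> * n \<le> T"
        using T\<sigma> by (simp add: T_def)
      then show "real n / T \<le> 1 / \<sigma>" "1 / T \<le> 1 / (\<sigma> * n)"
        using pos \<sigma> by (auto simp: field_simps)
    qed
    have hs: "h / s = real k / T"
      using pos by (simp add: h_def s_def)
    have nh: "real n * h\<^sup>2 \<le> (real k)\<^sup>2 / n" "real n * h\<^sup>2 \<le> (real k)\<^sup>2"
    proof -
      have "real n * real n \<le> real N * real N"
        using pos by (intro mult_mono) auto
      then have "real n / (real N)\<^sup>2 \<le> 1 / real n"
        using pos by (simp add: divide_simps power2_eq_square)
      then have "(real k)\<^sup>2 * (real n / (real N)\<^sup>2) \<le> (real k)\<^sup>2 * (1 / real n)"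
        by (rule mult_left_mono) simp
      then show 1: "real n * h\<^sup>2 \<le> (real k)\<^sup>2 / n"
        by (simp add: h_def power_divide mult.commute)
      have "(real k)\<^sup>2 / n \<le> (real k)\<^sup>2 / 1"
        using pos S(6) by (intro divide_left_mono) auto
      then show "real n * h\<^sup>2 \<le> (real k)\<^sup>2"
        using 1 by simp
    qed
    have q: "0 \<le> q" "q \<le> 1"
      using rate_pos[of "\<alpha> s"] rate_le_1[of "\<alpha> s"] \<alpha>[of s] s by (auto simp: q_def)
    have xti: "0 \<le> traj j s" "traj j s \<le> 2 ^ \<Delta>" for j
      using traj_bounds[of s j] s by auto
    have d: "\<bar>real n * d + real k / T * (real i * (n * traj i s) + real (Suc i) * (q * (n * traj (Suc i) s)))\<bar> \<le> K * (n * h\<^sup>2)"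
    proof -
      have "\<bar>d + real k / T * (real i * traj i s + real (Suc i) * q * traj (Suc i) s)\<bar> \<le> K * h\<^sup>2"
        using Taylor[of i h s] i h s hs by (simp add: d_def q_def)
      then have "real n * \<bar>d + real k / T * (real i * traj i s + real (Suc i) * q * traj (Suc i) s)\<bar> \<le> real n * (K * h\<^sup>2)"
        by (rule mult_left_mono) simp
      moreover have "real n * \<bar>d + real k / T * (real i * traj i s + real (Suc i) * q * traj (Suc i) s)\<bar> =
          \<bar>real n * (d + real k / T * (real i * traj i s + real (Suc i) * q * traj (Suc i) s))\<bar>"
        by (simp only: abs_mult abs_of_nat)
      moreover have "real n * (d + real k / T * (real i * traj i s + real (Suc i) * q * traj (Suc i) s)) =
          real n * d + real k / T * (real i * (n * traj i s) + real (Suc i) * (q * (n * traj (Suc i) s)))"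
        by (simp only: algebra_simps)
      ultimately show ?thesis
        by (simp only: mult.left_commute)
    qed
    have eq: "err n N V i (A - set l) (next_cover C l) - err n N V i A C = - D l - n * d" if "l \<in> tuples k A" for l
    proof -
      have "card (A - set l) = card A - k" "k \<le> card A"
        using that S(2) kA by (auto simp: tuples_def card_Diff_subset distinct_card)
      then have "real (card (A - set l)) / real N = s - h"
        by (simp add: s_def h_def T_def of_nat_diff diff_divide_distrib)
      then show ?thesis
        unfolding err_def D_def d_def by (simp only: T_def[symmetric] s_def[symmetric]) (simp only: algebra_simps)
    qed
    have Dl: "0 \<le> D l" "D l \<le> real k * 2 ^ \<Delta>" if "l \<in> tuples k A" for l
      using fstat_drift(2)[OF S(1-5) kA that] by (auto simp: D_def)
    have part1: "\<bar>err n N V i (A - set l) (next_cover C l) - err n N V i A C\<bar> \<le> c1" if "l \<in> tuples k A" for l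
    proof -
      define w where "w = real i * traj i s + real (Suc i) * (q * traj (Suc i) s)"
      have "real i * traj i s \<le> real \<Delta> * 2 ^ \<Delta>"
        using xti i by (intro mult_mono) auto
      moreover have "real (Suc i) * (q * traj (Suc i) s) \<le> real (Suc \<Delta>) * (1 * 2 ^ \<Delta>)"
        using xti q i by (intro mult_mono) auto
      moreover have "real (Suc \<Delta>) * (1 * 2 ^ \<Delta>) = real \<Delta> * 2 ^ \<Delta> + 2 ^ \<Delta>"
        "(2 * real \<Delta> + 1) * 2 ^ \<Delta> = 2 * (real \<Delta> * 2 ^ \<Delta>) + 2 ^ \<Delta>"
        by (simp_all add: algebra_simps)
      ultimately have w: "w \<le> (2 * real \<Delta> + 1) * 2 ^ \<Delta>"
        unfolding w_def by linarith
      have w0: "0 \<le> w"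
        unfolding w_def using xti q by (intro add_nonneg_nonneg mult_nonneg_nonneg) auto
      have "real k / T * (real i * (n * traj i s) + real (Suc i) * (q * (n * traj (Suc i) s))) =
          real k * (real n / T) * w"
        using pos by (simp add: w_def field_simps)
      also have "\<dots> \<le> real k * (1 / \<sigma>) * ((2 * real \<Delta> + 1) * 2 ^ \<Delta>)"
        using nT(1) \<sigma> pos w w0 by (intro mult_mono) auto
      finally have le: "real k / T * (real i * (n * traj i s) + real (Suc i) * (q * (n * traj (Suc i) s)))
          \<le> real k * (1 / \<sigma>) * ((2 * real \<Delta> + 1) * 2 ^ \<Delta>)" .
      have ge: "0 \<le> real k / T * (real i * (n * traj i s) + real (Suc i) * (q * (n * traj (Suc i) s)))"
        using xti q pos by (intro mult_nonneg_nonneg add_nonneg_nonneg) auto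
      have "K * (n * h\<^sup>2) \<le> K * (real k)\<^sup>2"
        using nh K by (intro mult_left_mono) auto
      then have "\<bar>real n * d\<bar> \<le> K * (real k)\<^sup>2 + real k * (1 / \<sigma>) * ((2 * real \<Delta> + 1) * 2 ^ \<Delta>)"
        by (rule abs_le_of_abs_add_le[OF d _ ge le])
      then show ?thesis
        unfolding eq[OF that] c1_def using Dl[OF that] by simp
    qed
    have cT: "real (card (tuples k A)) > 0"
      using card_tuples_pos[OF S(2) kA] by simp
    have avg: "(\<Sum>l\<in>tuples k A. err n N V i (A - set l) (next_cover C l) - err n N V i A C) / card (tuples k A) =
        - ((\<Sum>l\<in>tuples k A. D l) / card (tuples k A)) - n * d"
      using cT by (simp add: eq sum_subtractf sum_negf diff_divide_distrib cong: sum.cong)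
    have drift: "\<bar>(\<Sum>l\<in>tuples k A. D l) / card (tuples k A) -
      real k / T * (real i * fstat V i A C + real (Suc i) * (p ^ (k - 1) * fstat V (Suc i) A C))\<bar>
      \<le> real k * 2 ^ \<Delta> * (real (k\<^sup>2 * \<Delta>) / T)"
      using fstat_drift(1)[OF S(1-5) kA, of i C] by (simp add: D_def p_def T_def)
    define r where "r = P_coeff 1 (\<alpha> s) / P_coeff 1 1"
    have p: "0 \<le> p" "p \<le> 1"
      using fstat_bounds(1)[OF S(1,4)] fstat_1_le[OF S(1-3)] pos by (auto simp: p_def T_def)
    have r: "0 \<le> r" "r \<le> 1"
      using P_coeff_nonneg[of "\<alpha> s" 1] P1_mono[of "\<alpha> s" 1] \<alpha>[of s] s P1_pos[of 1] by (auto simp: r_def)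
    \<comment> \<open>The drift of index \<Delta> involves index \<Delta> + 1, where
      \<open>err\<close> vanishes; thus the finite sum \<open>M\<close> controls every error that
      occurs.\<close>
    have eM: "\<bar>e j\<bar> \<le> M" for j
    proof (cases "j < Suc \<Delta>")
      case True
      then show ?thesis
        unfolding M_def by (intro member_le_sum[of j "{..<Suc \<Delta>}" "\<lambda>j. \<bar>e j\<bar>"]) auto
    next
      case False
      then show ?thesis
        using err_bound(2)[OF st, of j C] by (simp add: e_def M_def sum_nonneg)
    qed
    have M: "0 \<le> M"
      using eM[of 0] by linarith
    have fs: "fstat V j A C = e j + n * traj j s" for j
      by (simp add: e_def err_def s_def T_def)
    \<comment> \<open>\<open>p\<close> differs from its limit \<open>r\<close> by the error of
      \<open>B\<^sub>1\<close> and by the rounding error of \<open>N\<close> against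
      \<open>n * P_coeff 1 1\<close>, both divided by T.\<close>
    have pr: "\<bar>p - r\<bar> \<le> (M + 2 ^ \<Delta> * (real \<Delta>)\<^sup>2 / P_coeff 1 1) / T"
    proof -
      have r_eq: "r = traj 1 s * real N / (T * P_coeff 1 1)"
        using s pos by (simp add: r_def traj_def s_def)
      have p_eq: "p = e 1 / T + n * traj 1 s / T"
        by (simp add: p_def fs add_divide_distrib)
      have eq: "p - r = (e 1 + traj 1 s * (n * P_coeff 1 1 - N) / P_coeff 1 1) / T"
        unfolding p_eq r_eq using pos P1_pos[of 1] by (simp add: field_simps)
      have "\<bar>traj 1 s * (n * P_coeff 1 1 - N)\<bar> \<le> 2 ^ \<Delta> * (real \<Delta>)\<^sup>2"
        unfolding abs_mult using xti[of 1] st by (intro mult_mono) (auto simp: state_def)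
      then have "\<bar>traj 1 s * (n * P_coeff 1 1 - N) / P_coeff 1 1\<bar> \<le> 2 ^ \<Delta> * (real \<Delta>)\<^sup>2 / P_coeff 1 1"
        using P1_pos[of 1] by (simp add: divide_right_mono)
      then have "\<bar>e 1 + traj 1 s * (n * P_coeff 1 1 - N) / P_coeff 1 1\<bar> \<le> M + 2 ^ \<Delta> * (real \<Delta>)\<^sup>2 / P_coeff 1 1"
        using eM[of 1] by linarith
      then show ?thesis
        unfolding eq using pos by (simp add: divide_right_mono)
    qed
    have pq: "\<bar>p ^ (k - 1) - q\<bar> \<le> real (k - 1) * \<bar>p - r\<bar>"
      using norm_power_diff[of p r "k - 1"] p r by (simp add: q_def rate_def r_def)
    have X: "\<bar>p ^ (k - 1) * fstat V (Suc i) A C - q * (n * traj (Suc i) s)\<bar> \<le> M + R * (1 + M)"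
    proof -
      have "p ^ (k - 1) * fstat V (Suc i) A C - q * (n * traj (Suc i) s) =
          p ^ (k - 1) * e (Suc i) + (p ^ (k - 1) - q) * (n * traj (Suc i) s)"
        by (simp add: fs algebra_simps)
      moreover have "\<bar>p ^ (k - 1) * e (Suc i)\<bar> \<le> 1 * M"
        unfolding abs_mult using p eM by (intro mult_mono) (auto simp: power_le_one)
      moreover have "\<bar>(p ^ (k - 1) - q) * (n * traj (Suc i) s)\<bar> \<le>
          (real (k - 1) * ((M + 2 ^ \<Delta> * (real \<Delta>)\<^sup>2 / P_coeff 1 1) / T)) * (real n * 2 ^ \<Delta>)"
        unfolding abs_mult[of "p ^ (k - 1) - q"]
      proof (rule mult_mono)
        have "real (k - 1) * \<bar>p - r\<bar> \<le> real (k - 1) * ((M + 2 ^ \<Delta> * (real \<Delta>)\<^sup>2 / P_coeff 1 1) / T)"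
          using pr by (rule mult_left_mono) simp
        then show "\<bar>p ^ (k - 1) - q\<bar> \<le> real (k - 1) * ((M + 2 ^ \<Delta> * (real \<Delta>)\<^sup>2 / P_coeff 1 1) / T)"
          using pq by linarith
        show "\<bar>real n * traj (Suc i) s\<bar> \<le> real n * 2 ^ \<Delta>"
          using xti[of "Suc i"] by (simp add: abs_mult mult_left_mono)
        show "0 \<le> real (k - 1) * ((M + 2 ^ \<Delta> * (real \<Delta>)\<^sup>2 / P_coeff 1 1) / T)"
          using M pos P1_pos[of 1] by simp
      qed simp
      moreover have "(real (k - 1) * ((M + 2 ^ \<Delta> * (real \<Delta>)\<^sup>2 / P_coeff 1 1) / T)) * (real n * 2 ^ \<Delta>) \<le> R * (1 + M)"
      proof -
        define y where "y = 2 ^ \<Delta> * (real \<Delta>)\<^sup>2 / P_coeff 1 1"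
        have y: "0 \<le> y"
          using P1_pos[of 1] by (simp add: y_def)
        have "(real (k - 1) * ((M + y) / T)) * (real n * 2 ^ \<Delta>) = real (k - 1) * 2 ^ \<Delta> * ((M + y) * (n / T))"
          by simp
        also have "\<dots> \<le> real (k - 1) * 2 ^ \<Delta> * (((1 + y) * (1 + M)) * (1 / \<sigma>))"
        proof (intro mult_left_mono mult_mono nT)
          show "M + y \<le> (1 + y) * (1 + M)"
            using y M by (simp add: algebra_simps)
        qed (use y M pos in auto)
        also have "\<dots> = R * (1 + M)"
          by (simp add: R_def y_def)
        finally show ?thesis
          by (simp add: y_def)
      qed
      ultimately show ?thesis
        by linarith
    qed
    have Y: "\<bar>real i * fstat V i A C - real i * (n * traj i s)\<bar> \<le> real \<Delta> * M"
    proof -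
      have "real i * fstat V i A C - real i * (n * traj i s) = real i * e i"
        by (simp add: fs algebra_simps)
      moreover have "real i * \<bar>e i\<bar> \<le> real \<Delta> * M"
        using i eM M by (intro mult_mono) auto
      ultimately show ?thesis
        by (simp add: abs_mult)
    qed
    \<comment> \<open>The drift at the current state minus the drift at the trajectory at the same
      time; it is linear in the errors, up to rounding.\<close>
    define Z where "Z = (real i * fstat V i A C + real (Suc i) * (p ^ (k - 1) * fstat V (Suc i) A C)) -
        (real i * (n * traj i s) + real (Suc i) * (q * (n * traj (Suc i) s)))"
    have Z: "\<bar>Z\<bar> \<le> (real \<Delta> + (real \<Delta> + 1) * (1 + R)) * (1 + M)"
    proof -
      have "real (Suc i) * \<bar>p ^ (k - 1) * fstat V (Suc i) A C - q * (n * traj (Suc i) s)\<bar> \<le> real (Suc \<Delta>) * (M + R * (1 + M))"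
        using X i by (intro mult_mono) auto
      then have "\<bar>real (Suc i) * (p ^ (k - 1) * fstat V (Suc i) A C - q * (n * traj (Suc i) s))\<bar> \<le> real (Suc \<Delta>) * (M + R * (1 + M))"
        by (simp only: abs_mult abs_of_nat)
      moreover have "Z = (real i * fstat V i A C - real i * (n * traj i s)) +
          real (Suc i) * (p ^ (k - 1) * fstat V (Suc i) A C - q * (n * traj (Suc i) s))"
        by (simp only: Z_def algebra_simps)
      ultimately have "\<bar>Z\<bar> \<le> real \<Delta> * M + real (Suc \<Delta>) * (M + R * (1 + M))"
        using Y by linarith
      also have "\<dots> \<le> (real \<Delta> + (real \<Delta> + 1) * (1 + R)) * (1 + M)"
        using M R by (simp add: algebra_simps)
      finally show ?thesis .
    qed
    have "\<bar>real k / T * Z\<bar> \<le> real k * (1 / (\<sigma> * n)) * ((real \<Delta> + (real \<Delta> + 1) * (1 + R)) * (1 + M))"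
    proof -
      have "real k * (1 / T) * \<bar>Z\<bar> \<le> real k * (1 / (\<sigma> * n)) * ((real \<Delta> + (real \<Delta> + 1) * (1 + R)) * (1 + M))"
        using nT(2) Z \<sigma> pos by (intro mult_mono) auto
      then show ?thesis
        using pos by (simp add: abs_mult)
    qed
    moreover have "real k * 2 ^ \<Delta> * (real (k\<^sup>2 * \<Delta>) / T) \<le> real k * 2 ^ \<Delta> * (real (k\<^sup>2 * \<Delta>) * (1 / (\<sigma> * n)))"
    proof -
      have "real (k\<^sup>2 * \<Delta>) * (1 / T) \<le> real (k\<^sup>2 * \<Delta>) * (1 / (\<sigma> * n))"
        using nT(2) by (intro mult_left_mono) auto
      then show ?thesis
        by (intro mult_left_mono) auto
    qed
    moreover have "K * (n * h\<^sup>2) \<le> K * ((real k)\<^sup>2 / n)"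
      using nh K by (intro mult_left_mono) auto
    moreover have "- ((\<Sum>l\<in>tuples k A. D l) / card (tuples k A)) - n * d =
        - ((\<Sum>l\<in>tuples k A. D l) / card (tuples k A) -
          real k / T * (real i * fstat V i A C + real (Suc i) * (p ^ (k - 1) * fstat V (Suc i) A C)))
        - (real n * d + real k / T * (real i * (n * traj i s) + real (Suc i) * (q * (n * traj (Suc i) s))))
        - real k / T * Z"
      by (simp only: Z_def algebra_simps)
    \<comment> \<open>The three terms stem from sampling, discretisation and \<open>Z\<close>, in
      this order.\<close>
    ultimately have "\<bar>- ((\<Sum>l\<in>tuples k A. D l) / card (tuples k A)) - n * d\<bar> \<le>
        real k * 2 ^ \<Delta> * (real (k\<^sup>2 * \<Delta>) * (1 / (\<sigma> * n))) + K * ((real k)\<^sup>2 / n) +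
        real k * (1 / (\<sigma> * n)) * ((real \<Delta> + (real \<Delta> + 1) * (1 + R)) * (1 + M))"
      by (intro abs_diff3_le[OF _ drift d])
    also have "\<dots> = 1 / n * (c2 + real k / \<sigma> * (real \<Delta> + (real \<Delta> + 1) * (1 + R)) * (1 + M))"
      using pos \<sigma> by (simp add: c2_def field_simps)
    also have "\<dots> \<le> 1 / n * (c3 * (1 + M))"
    proof (rule mult_left_mono)
      have "c2 * 1 \<le> c2 * (1 + M)"
        using c M by (intro mult_left_mono) auto
      then show "c2 + real k / \<sigma> * (real \<Delta> + (real \<Delta> + 1) * (1 + R)) * (1 + M) \<le> c3 * (1 + M)"
        unfolding c3_def distrib_right[of c2] by linarith
    qed simp
    finally have "\<bar>- ((\<Sum>l\<in>tuples k A. D l) / card (tuples k A)) - n * d\<bar> \<le> c3 / n * (1 + M)"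
      by simp
    then show ?thesis
      using part1 unfolding avg M_def e_def by blast
  qed
  show ?thesis
    by (rule exI[of _ c1], rule conjI[OF c(1)], rule exI[of _ c3], rule conjI[OF c(3)]) (use main in blast)
qed


lemma exp_pot_step:
  assumes \<sigma>: "0 < \<sigma>" "\<sigma> \<le> 1"
  shows "\<exists>c\<ge>0. \<exists>\<theta>0>0. \<forall>n N (V :: 'v set) (A :: ('v \<times> 'b) set) C \<theta>.
    state n N V A \<longrightarrow> \<sigma> * real N \<le> real (card A) \<longrightarrow> k \<le> card A \<longrightarrow> 0 \<le> \<theta> \<longrightarrow> \<theta> \<le> \<theta>0 \<longrightarrow>
    (\<Sum>l\<in>tuples k A. exp (\<theta> * pot n N V (A - set l) (next_cover C l)))
      \<le> card (tuples k A) * exp (\<theta> * (1 + c / n) * pot n N V A C + c / n)"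
proof -
  obtain c1 c3 where c: "c1 \<ge> 0" "c3 \<ge> 0" and incr: "\<And>n N (V :: 'v set) (A :: ('v \<times> 'b) set) C i.
    state n N V A \<Longrightarrow> \<sigma> * real N \<le> real (card A) \<Longrightarrow> k \<le> card A \<Longrightarrow> i < Suc \<Delta> \<Longrightarrow>
    (\<forall>l\<in>tuples k A. \<bar>err n N V i (A - set l) (next_cover C l) - err n N V i A C\<bar> \<le> c1) \<and>
    \<bar>(\<Sum>l\<in>tuples k A. err n N V i (A - set l) (next_cover C l) - err n N V i A C) / card (tuples k A)\<bar>
      \<le> c3 / n * (1 + (\<Sum>j<Suc \<Delta>. \<bar>err n N V j A C\<bar>))"
    using err_increment[OF \<sigma>, where ?'v = 'v and ?'b = 'b] by blast
  define \<theta>0 where "\<theta>0 = 1 / (real (Suc \<Delta>) * (2 * c1 * 2 ^ \<Delta> + c1\<^sup>2) + 1)"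
  define c' where "c' = 4 * real (Suc \<Delta>) * c3 + 8 * real (Suc \<Delta>) * c1\<^sup>2 + 2 * c3 + real (Suc \<Delta>) * c1\<^sup>2 +
    2 * (real (Suc \<Delta>))\<^sup>2 * c1 ^ 4"
  have "0 \<le> real (Suc \<Delta>) * (2 * c1 * 2 ^ \<Delta> + c1\<^sup>2)"
    using c by simp
  then have \<theta>0: "0 < \<theta>0"
    unfolding \<theta>0_def by simp
  have c': "0 \<le> c'"
    using c by (simp add: c'_def)
  have main: "(\<Sum>l\<in>tuples k A. exp (\<theta> * pot n N V (A - set l) (next_cover C l)))
      \<le> card (tuples k A) * exp (\<theta> * (1 + c' / n) * pot n N V A C + c' / n)"
    if st: "state n N V A" and T: "\<sigma> * real N \<le> real (card A)" "k \<le> card A" and \<theta>: "0 \<le> \<theta>" "\<theta> \<le> \<theta>0"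
    for n N \<theta> C and V :: "'v set" and A :: "('v \<times> 'b) set"
  proof -
    have fin: "finite (tuples k A)" "tuples k A \<noteq> {}"
      using st finite_tuples[of A k] card_tuples_pos[of A k] T by (auto simp: state_def)
    have n: "1 \<le> n"
      using st by (simp add: state_def)
    have "(\<Sum>l\<in>tuples k A. exp (\<theta> * ((\<Sum>i<Suc \<Delta>. (err n N V i A C +
        (err n N V i (A - set l) (next_cover C l) - err n N V i A C))\<^sup>2) / n))) \<le>
        card (tuples k A) * exp (\<theta> * (1 + c' / n) * ((\<Sum>i<Suc \<Delta>. (err n N V i A C)\<^sup>2) / n) + c' / n)"
      unfolding c'_def
    proof (rule exp_potential_step[where ?c0.0 = "2 ^ \<Delta>", OF _ c fin n \<theta>(1)])
      show "\<theta> \<le> 1 / (real (Suc \<Delta>) * (2 * c1 * 2 ^ \<Delta> + c1\<^sup>2) + 1)"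
        using \<theta>(2) by (simp add: \<theta>0_def)
      show "\<bar>err n N V i A C\<bar> \<le> 2 ^ \<Delta> * real n" for i
        by (rule err_bound(1)[OF st])
      show "\<bar>err n N V i (A - set l) (next_cover C l) - err n N V i A C\<bar> \<le> c1"
        if "i < Suc \<Delta>" "l \<in> tuples k A" for i l
        using incr[OF st T that(1)] that(2) by blast
      show "\<bar>(\<Sum>l\<in>tuples k A. err n N V i (A - set l) (next_cover C l) - err n N V i A C) / card (tuples k A)\<bar>
        \<le> c3 / n * (1 + (\<Sum>j<Suc \<Delta>. \<bar>err n N V j A C\<bar>))" if "i < Suc \<Delta>" for i
        using incr[OF st T that] by blast
    qed simp
    then show ?thesis
      by (simp only: pot_def add_diff_cancel_left' diff_add_cancel add.commute[of _ "_ - _"])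
  qed
  show ?thesis
    by (rule exI[of _ c'], rule conjI[OF c'], rule exI[of _ \<theta>0], rule conjI[OF \<theta>0]) (use main in blast)
qed

lemma state_Diff:
  assumes "state n N V A"
  shows "state n N V (A - B)"
proof -
  have "rem (A - B) v \<le> rem A v" for v
    unfolding rem_def using assms by (intro card_mono) (auto simp: state_def)
  moreover have "card (A - B) \<le> card A"
    using assms by (intro card_mono) (auto simp: state_def)
  ultimately show ?thesis
    using assms le_trans unfolding state_def by (metis finite_Diff image_mono order.trans Diff_subset)
qed

end

section \<open>Iteration over the revealed tuples\<close>

primrec num_seqs :: "nat \<Rightarrow> nat \<Rightarrow> nat \<Rightarrow> nat" where
  "num_seqs k 0 t = 1"
| "num_seqs k (Suc m) t = \<Prod>{t - k + 1..t} * num_seqs k m (t - k)"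

lemma card_tuples: "finite A \<Longrightarrow> k \<le> card A \<Longrightarrow> card (tuples k A) = \<Prod>{card A - k + 1..card A}"
  unfolding tuples_def using card_lists_distinct_length_eq[of A k] by simp

lemma card_Diff_tuple: "finite A \<Longrightarrow> l \<in> tuples k A \<Longrightarrow> card (A - set l) = card A - k"
  by (auto simp: tuples_def card_Diff_subset distinct_card)

lemma card_seqs_Suc: "finite A \<Longrightarrow> card (seqs k (Suc m) A) = (\<Sum>l\<in>tuples k A. card (seqs k m (A - set l)))"
  using sum_seqs_Suc[of A "\<lambda>_. 1::nat" k m] by simp

text \<open>Only the number of points matters, so in a sum over the leading tuple the number of
  continuations is a constant factor.\<close>

lemma card_seqs: "finite A \<Longrightarrow> k * m \<le> card A \<Longrightarrow> card (seqs k m A) = num_seqs k m (card A)"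
proof (induction m arbitrary: A)
  case (Suc m)
  have "card (seqs k m (A - set l)) = num_seqs k m (card A - k)" if "l \<in> tuples k A" for l
    using Suc.IH[of "A - set l"] Suc.prems card_Diff_tuple[OF Suc.prems(1) that] by simp
  then show ?case
    using Suc.prems by (simp only: card_seqs_Suc card_tuples sum_constant num_seqs.simps) (simp add: card_tuples)
qed simp

context degree_distribution
begin

text \<open>The induction splits off the leading tuple. The continuation is bounded by the moment at
  \<open>\<theta> * (1 + c / n) ^ m\<close>, to which the one-step bound is applied; the exponent
  thus grows with the number of steps, and its final value has to stay below \<theta>0. The
  \<open>M0\<close> unrevealed blocks keep at least \<sigma> N points in reserve at every
  step.\<close>

lemma sum_exp_pot_le:
  fixes V :: "'v set" and A :: "('v \<times> 'b) set"
  assumes step: "\<And>(A :: ('v \<times> 'b) set) C \<theta>.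
    state n N V A \<Longrightarrow> \<sigma> * real N \<le> real (card A) \<Longrightarrow> k \<le> card A \<Longrightarrow> 0 \<le> \<theta> \<Longrightarrow> \<theta> \<le> \<theta>0 \<Longrightarrow>
    (\<Sum>l\<in>tuples k A. exp (\<theta> * pot n N V (A - set l) (next_cover C l)))
      \<le> card (tuples k A) * exp (\<theta> * (1 + c / n) * pot n N V A C + c / n)"
    and "0 \<le> c" "\<sigma> * real N \<le> real (k * M0)" "0 \<le> \<theta>"
    and "state n N V A" "card A = k * (M0 + m)" "\<theta> * (1 + c / n) ^ m \<le> \<theta>0"
  shows "(\<Sum>ls\<in>seqs k (M0 + m) A. exp (\<theta> * pot n N V (A - set (concat (take m ls))) (foldl next_cover C (take m ls))))
    \<le> card (seqs k (M0 + m) A) * exp (\<theta> * (1 + c / n) ^ m * pot n N V A C + real m * (c / n))"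
  using assms(5-)
proof (induction m arbitrary: A C)
  case (Suc m)
  define \<theta>' where "\<theta>' = \<theta> * (1 + c / n) ^ m"
  have finA: "finite A"
    using Suc.prems by (simp add: state_def)
  have kA: "k \<le> card A"
    using Suc.prems by simp
  have "\<theta>' * 1 \<le> \<theta>' * (1 + c / n)"
    unfolding \<theta>'_def using assms by (intro mult_left_mono) auto
  moreover have "\<theta>' * (1 + c / n) \<le> \<theta>0"
    using Suc.prems(3) by (simp add: \<theta>'_def ac_simps)
  moreover have "0 \<le> \<theta>'"
    unfolding \<theta>'_def using assms by (intro mult_nonneg_nonneg) auto
  ultimately have \<theta>': "0 \<le> \<theta>'" "\<theta>' \<le> \<theta>0"
    by linarith+
  have "\<sigma> * real N \<le> real (card A)"
  proof -
    have "k * M0 \<le> card A"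
      unfolding Suc.prems(2) by (rule mult_le_mono2) simp
    then have "real (k * M0) \<le> real (card A)"
      by (rule of_nat_mono)
    then show ?thesis
      using assms(3) by linarith
  qed
  note st = step[OF Suc.prems(1) this kA \<theta>']
  define S where "S = num_seqs k (M0 + m) (card A - k)"
  have S: "card (seqs k (M0 + m) (A - set l)) = S" if "l \<in> tuples k A" for l
    using card_seqs[of "A - set l" k "M0 + m"] card_Diff_tuple[OF finA that] finA Suc.prems(2) by (simp add: S_def)
  have "(\<Sum>ls\<in>seqs k (M0 + Suc m) A. exp (\<theta> * pot n N V (A - set (concat (take (Suc m) ls))) (foldl next_cover C (take (Suc m) ls)))) =
      (\<Sum>l\<in>tuples k A. \<Sum>ls\<in>seqs k (M0 + m) (A - set l).
        exp (\<theta> * pot n N V (A - set l - set (concat (take m ls))) (foldl next_cover (next_cover C l) (take m ls))))"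
    unfolding add_Suc_right sum_seqs_Suc[OF finA] by (simp add: Diff_eq Int_assoc)
  also have "\<dots> \<le> (\<Sum>l\<in>tuples k A. real S * exp (\<theta>' * pot n N V (A - set l) (next_cover C l) + real m * (c / n)))"
  proof (rule sum_mono)
    fix l assume l: "l \<in> tuples k A"
    show "(\<Sum>ls\<in>seqs k (M0 + m) (A - set l).
        exp (\<theta> * pot n N V (A - set l - set (concat (take m ls))) (foldl next_cover (next_cover C l) (take m ls))))
        \<le> real S * exp (\<theta>' * pot n N V (A - set l) (next_cover C l) + real m * (c / n))"
      unfolding S[OF l, symmetric] \<theta>'_def
    proof (rule Suc.IH)
      show "state n N V (A - set l)"
        by (rule state_Diff[OF Suc.prems(1)])
      show "card (A - set l) = k * (M0 + m)"
        using card_Diff_tuple[OF finA l] Suc.prems(2) by simp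
      show "\<theta> * (1 + c / n) ^ m \<le> \<theta>0"
        using \<theta>' by (simp add: \<theta>'_def)
    qed
  qed
  also have "\<dots> = real S * exp (real m * (c / n)) * (\<Sum>l\<in>tuples k A. exp (\<theta>' * pot n N V (A - set l) (next_cover C l)))"
    unfolding exp_add sum_distrib_left by (intro sum.cong refl) (simp only: ac_simps)
  also have "\<dots> \<le> real S * exp (real m * (c / n)) * (card (tuples k A) * exp (\<theta>' * (1 + c / n) * pot n N V A C + c / n))"
    using st by (intro mult_left_mono) auto
  also have "\<dots> = real (card (tuples k A) * S) * exp (\<theta>' * (1 + c / n) * pot n N V A C + real (Suc m) * (c / n))"
    by (simp add: exp_add distrib_right add_divide_distrib)
  also have "card (tuples k A) * S = card (seqs k (M0 + Suc m) A)"
    unfolding add_Suc_right card_seqs_Suc[OF finA] using S by simp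
  also have "\<theta>' * (1 + c / n) = \<theta> * (1 + c / n) ^ Suc m"
    by (simp add: \<theta>'_def)
  finally show ?case .
qed simp

text \<open>Markov's inequality: a deviation above \<epsilon> n in \<open>B\<^sub>0\<close> alone
  makes \<open>pot\<close> at least \<epsilon>^2 n, while the exponential moment stays bounded
  because bounded initial errors give a bounded initial potential.\<close>

lemma concentration:
  assumes \<sigma>: "0 < \<sigma>" "\<sigma> \<le> 1" and \<epsilon>: "0 < \<epsilon>" and "0 \<le> b"
  shows "\<exists>K>0. \<exists>c>0. \<forall>n N (V :: 'v set) (A :: ('v \<times> 'b) set) M M0.
    state n N V A \<longrightarrow> card A = N \<longrightarrow> N = k * M \<longrightarrow> M0 \<le> M \<longrightarrow> \<sigma> * real N \<le> real (k * M0) \<longrightarrow> N \<le> \<Delta> * n \<longrightarrow>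
    (\<forall>i<Suc \<Delta>. \<bar>err n N V i A {}\<bar> \<le> b) \<longrightarrow>
    real (card {ls\<in>seqs k M A. \<epsilon> * n <
      \<bar>err n N V 0 (A - set (concat (take (M - M0) ls))) (foldl next_cover {} (take (M - M0) ls))\<bar>})
    \<le> K * exp (- c * n) * card (seqs k M A)"
proof -
  obtain c \<theta>0 where c: "0 \<le> c" "0 < \<theta>0" and step: "\<And>n N (V :: 'v set) (A :: ('v \<times> 'b) set) C \<theta>.
    state n N V A \<Longrightarrow> \<sigma> * real N \<le> real (card A) \<Longrightarrow> k \<le> card A \<Longrightarrow> 0 \<le> \<theta> \<Longrightarrow> \<theta> \<le> \<theta>0 \<Longrightarrow>
    (\<Sum>l\<in>tuples k A. exp (\<theta> * pot n N V (A - set l) (next_cover C l)))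
      \<le> card (tuples k A) * exp (\<theta> * (1 + c / n) * pot n N V A C + c / n)"
    using exp_pot_step[OF \<sigma>, where ?'v = 'v and ?'b = 'b] by blast
  \<comment> \<open>The factor compensates the growth
    \<open>(1 + c / n) ^ m \<le> exp (c * \<Delta>)\<close> of the exponent, as at most
    \<open>\<Delta> * n\<close> tuples are revealed.\<close>
  define \<theta> where "\<theta> = \<theta>0 * exp (- (c * \<Delta>))"
  define K where "K = exp (\<theta>0 * (real (Suc \<Delta>) * b\<^sup>2) + c * \<Delta>)"
  have \<theta>: "0 < \<theta>"
    using c by (simp add: \<theta>_def)
  have main: "real (card {ls\<in>seqs k M A. \<epsilon> * n <
      \<bar>err n N V 0 (A - set (concat (take (M - M0) ls))) (foldl next_cover {} (take (M - M0) ls))\<bar>})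
    \<le> K * exp (- (\<theta> * \<epsilon>\<^sup>2) * n) * card (seqs k M A)"
    if st: "state n N V A" and N: "card A = N" "N = k * M" "M0 \<le> M" "\<sigma> * real N \<le> real (k * M0)" "N \<le> \<Delta> * n"
      and init: "\<forall>i<Suc \<Delta>. \<bar>err n N V i A {}\<bar> \<le> b"
    for n N M M0 and V :: "'v set" and A :: "('v \<times> 'b) set"
  proof -
    define m where "m = M - M0"
    define X where "X ls = pot n N V (A - set (concat (take m ls))) (foldl next_cover {} (take m ls))" for ls
    define Bad where "Bad = {ls\<in>seqs k M A. \<epsilon> * n <
      \<bar>err n N V 0 (A - set (concat (take m ls))) (foldl next_cover {} (take m ls))\<bar>}"
    have n: "real n \<ge> 1" and finA: "finite A"
      using st by (auto simp: state_def)
    have M: "M0 + m = M"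
      using N by (simp add: m_def)
    have "M \<le> k * M"
      using mult_le_mono1[of 1 k M] k by simp
    then have "m \<le> \<Delta> * n"
      using N(2,5) unfolding m_def by linarith
    then have "real m \<le> real \<Delta> * real n"
      by (metis of_nat_le_iff of_nat_mult)
    then have mc: "real m * (c / n) \<le> c * \<Delta>"
      using n c mult_left_mono[of "real m" "real \<Delta> * real n" "c / n"] by (simp add: mult.commute)
    have "(1 + c / n) ^ m \<le> exp (c / n) ^ m"
      using c n by (intro power_mono exp_ge_add_one_self) auto
    also have "\<dots> = exp (real m * (c / n))"
      by (rule exp_of_nat_mult[symmetric])
    also have "\<dots> \<le> exp (c * \<Delta>)"
      using mc by simp
    finally have "\<theta> * (1 + c / n) ^ m \<le> \<theta> * exp (c * \<Delta>)"
      using \<theta> by (intro mult_left_mono) auto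
    also have "\<dots> = \<theta>0"
      by (simp add: \<theta>_def mult.assoc exp_add[symmetric])
    finally have \<theta>m: "\<theta> * (1 + c / n) ^ m \<le> \<theta>0" .
    have pot0: "0 \<le> pot n N V A {}" "pot n N V A {} \<le> real (Suc \<Delta>) * b\<^sup>2"
    proof -
      show "0 \<le> pot n N V A {}"
        by (simp add: pot_def sum_nonneg)
      have "(\<Sum>i<Suc \<Delta>. (err n N V i A {})\<^sup>2) \<le> (\<Sum>i<Suc \<Delta>. b\<^sup>2)"
        using init power_mono[of "\<bar>err n N V i A {}\<bar>" b 2 for i] by (intro sum_mono) auto
      then have "pot n N V A {} \<le> real (Suc \<Delta>) * b\<^sup>2 / n"
        unfolding pot_def using n by (intro divide_right_mono) auto
      also have "\<dots> \<le> real (Suc \<Delta>) * b\<^sup>2 / 1"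
        using n by (intro divide_left_mono) auto
      finally show "pot n N V A {} \<le> real (Suc \<Delta>) * b\<^sup>2"
        by simp
    qed
    have "(\<Sum>ls\<in>seqs k M A. exp (\<theta> * X ls)) \<le>
        card (seqs k M A) * exp (\<theta> * (1 + c / n) ^ m * pot n N V A {} + real m * (c / n))"
      using sum_exp_pot_le[OF step c(1) N(4) less_imp_le[OF \<theta>] st _ \<theta>m, of "{}"] N(1,2) unfolding M X_def by simp
    also have "\<dots> \<le> card (seqs k M A) * K"
    proof (rule mult_left_mono)
      have "\<theta> * (1 + c / n) ^ m * pot n N V A {} \<le> \<theta>0 * (real (Suc \<Delta>) * b\<^sup>2)"
        using \<theta>m pot0 c by (intro mult_mono) auto
      then show "exp (\<theta> * (1 + c / n) ^ m * pot n N V A {} + real m * (c / n)) \<le> K"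
        using mc by (simp add: K_def)
    qed simp
    finally have total: "(\<Sum>ls\<in>seqs k M A. exp (\<theta> * X ls)) \<le> card (seqs k M A) * K" .
    have "real (card Bad) * exp (\<theta> * \<epsilon>\<^sup>2 * n) = (\<Sum>ls\<in>Bad. exp (\<theta> * \<epsilon>\<^sup>2 * n))"
      by simp
    also have "\<dots> \<le> (\<Sum>ls\<in>Bad. exp (\<theta> * X ls))"
    proof (rule sum_mono)
      fix ls assume "ls \<in> Bad"
      define e where "e i = err n N V i (A - set (concat (take m ls))) (foldl next_cover {} (take m ls))" for i
      have "\<epsilon> * n < \<bar>e 0\<bar>"
        using \<open>ls \<in> Bad\<close> by (simp add: Bad_def e_def)
      then have "(\<epsilon> * n)\<^sup>2 \<le> \<bar>e 0\<bar>\<^sup>2"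
        using \<epsilon> by (intro power_mono) auto
      also have "\<dots> \<le> (\<Sum>i<Suc \<Delta>. (e i)\<^sup>2)"
        using member_le_sum[of 0 "{..<Suc \<Delta>}" "\<lambda>i. (e i)\<^sup>2"] by simp
      finally have "(\<epsilon> * n)\<^sup>2 / n \<le> X ls"
        unfolding X_def pot_def e_def using n by (intro divide_right_mono) auto
      moreover have "(\<epsilon> * n)\<^sup>2 / n = \<epsilon>\<^sup>2 * n"
        using n by (simp add: power2_eq_square)
      ultimately have "\<theta> * (\<epsilon>\<^sup>2 * n) \<le> \<theta> * X ls"
        using \<theta> by (intro mult_left_mono) auto
      then show "exp (\<theta> * \<epsilon>\<^sup>2 * n) \<le> exp (\<theta> * X ls)"
        by (simp add: mult.assoc)
    qed
    also have "\<dots> \<le> (\<Sum>ls\<in>seqs k M A. exp (\<theta> * X ls))"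
      using finite_seqs[OF finA] by (intro sum_mono2) (auto simp: Bad_def)
    finally have "real (card Bad) * exp (\<theta> * \<epsilon>\<^sup>2 * n) \<le> card (seqs k M A) * K"
      using total by linarith
    then have "real (card Bad) * exp (\<theta> * \<epsilon>\<^sup>2 * n) * exp (- (\<theta> * \<epsilon>\<^sup>2) * n) \<le> card (seqs k M A) * K * exp (- (\<theta> * \<epsilon>\<^sup>2) * n)"
      by (rule mult_right_mono) simp
    then show ?thesis
      unfolding Bad_def m_def by (simp add: mult.assoc exp_add[symmetric]) (simp add: mult.commute mult.left_commute)
  qed
  have "0 < K" "0 < \<theta> * \<epsilon>\<^sup>2"
    using \<theta> \<epsilon> by (auto simp: K_def)
  then show ?thesis
    by (intro exI[of _ K] conjI exI[of _ "\<theta> * \<epsilon>\<^sup>2"]) (use main in blast)+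
qed

end

section \<open>Transfer to simple hypergraphs\<close>

lemma rem_concat:
  assumes "distinct (concat ls)" "\<forall>l\<in>set ls. distinct (map fst l)"
  shows "rem (set (concat ls)) v = length (filter (\<lambda>e. v \<in> e) (map (\<lambda>l. fst ` set l) ls))"
  using assms
proof (induction ls)
  case (Cons l ls)
  have "{x\<in>set (concat (l # ls)). fst x = v} = {x\<in>set l. fst x = v} \<union> {x\<in>set (concat ls). fst x = v}"
    by auto
  moreover have "{x\<in>set l. fst x = v} \<inter> {x\<in>set (concat ls). fst x = v} = {}"
    using Cons.prems by auto
  ultimately have "rem (set (concat (l # ls))) v = card {x\<in>set l. fst x = v} + rem (set (concat ls)) v"
    unfolding rem_def by (simp add: card_Un_disjoint)
  moreover have "card {x\<in>set l. fst x = v} = (if v \<in> fst ` set l then 1 else 0)"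
    using Cons.prems(2) by (simp add: card_fst_eq)
  ultimately show ?case
    using Cons by simp
qed (simp add: rem_def)

lemma foldl_next_cover_greedy:
  assumes "\<forall>l\<in>set ls. distinct (map fst l)"
  shows "foldl next_cover (\<Union>M) ls = \<Union>(fold greedy_step (map (\<lambda>l. fst ` set l) ls) M)"
  using assms
proof (induction ls arbitrary: M)
  case (Cons l ls)
  have "next_cover (\<Union>M) l = \<Union>(greedy_step (fst ` set l) M)"
    using Cons.prems by (auto simp: next_cover_def greedy_step_def)
  then show ?case
    using Cons by simp
qed simp

lemma foldl_next_cover_bounds:
  assumes "\<forall>l\<in>set ls. length l = k" "finite C"
  shows "C \<subseteq> foldl next_cover C ls \<and> finite (foldl next_cover C ls) \<and>
    card (foldl next_cover C ls) \<le> card C + k * length ls"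
  using assms
proof (induction ls arbitrary: C)
  case (Cons l ls)
  have C': "C \<subseteq> next_cover C l" "finite (next_cover C l)"
    using Cons.prems by (auto simp: next_cover_def)
  have "card (fst ` set l) \<le> k"
    using card_image_le[of "set l" fst] card_length[of l] Cons.prems by simp
  then have "card (next_cover C l) \<le> card C + k"
    using card_Un_le[of C "fst ` set l"] by (simp add: next_cover_def)
  moreover have "next_cover C l \<subseteq> foldl next_cover (next_cover C l) ls \<and>
      finite (foldl next_cover (next_cover C l) ls) \<and>
      card (foldl next_cover (next_cover C l) ls) \<le> card (next_cover C l) + k * length ls"
    using Cons.IH[OF _ C'(2)] Cons.prems(1) by simp
  ultimately show ?case
    using C' by auto
qed simp

section \<open>Degree sequences and ordered hypergraphs\<close>

definition points :: "nat \<Rightarrow> (nat \<Rightarrow> nat) \<Rightarrow> (nat \<times> nat) set" where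
  "points n \<delta> = (SIGMA v:{..<n}. {..<\<delta> v})"

lemma finite_points: "finite (points n \<delta>)"
  by (simp add: points_def)

lemma card_points: "card (points n \<delta>) = (\<Sum>v<n. \<delta> v)"
  by (simp add: points_def)

lemma rem_points: "rem (points n \<delta>) v = (if v < n then \<delta> v else 0)"
proof (cases "v < n")
  case True
  then have "{x\<in>points n \<delta>. fst x = v} = {v} \<times> {..<\<delta> v}"
    by (auto simp: points_def)
  then show ?thesis
    using True by (simp add: rem_def card_cartesian_product)
next
  case False
  then have "{x\<in>points n \<delta>. fst x = v} = {}"
    by (auto simp: points_def)
  then show ?thesis
    using False by (simp only: rem_def card.empty if_False)
qed

text \<open>Every vertex has its own degree prescribed, as in the point model. For a degree profile,
  \<open>hypergraphs\<close> prescribes only how many vertices have each degree and is a disjoint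
  union of such classes.\<close>

definition degree_class :: "nat \<Rightarrow> nat \<Rightarrow> (nat \<Rightarrow> nat) \<Rightarrow> hypergraph set" where
  "degree_class n k \<delta> = {E. uniform_hypergraph n k E \<and> (\<forall>v<n. vertex_degree E v = \<delta> v)}"

lemma finite_degree_class: "finite (degree_class n k \<delta>)"
  by (rule finite_subset[of _ "Pow (Pow {..<n})"]) (auto simp: degree_class_def uniform_hypergraph_def)

lemma card_degree_class:
  assumes "E \<in> degree_class n k \<delta>"
  shows "k * card E = (\<Sum>v<n. \<delta> v)"
proof -
  have E: "finite E" "\<And>e. e \<in> E \<Longrightarrow> e \<subseteq> {..<n} \<and> card e = k"
    using assms finite_uniform by (auto simp: degree_class_def uniform_hypergraph_def)
  have "(\<Sum>v<n. \<delta> v) = (\<Sum>v<n. card {e\<in>E. v \<in> e})"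
    using assms by (auto simp: degree_class_def vertex_degree_def intro!: sum.cong)
  also have "\<dots> = (\<Sum>v<n. \<Sum>e\<in>E. of_bool (v \<in> e))"
    using E by (simp add: of_bool_def sum.If_cases Int_def)
  also have "\<dots> = (\<Sum>e\<in>E. \<Sum>v<n. of_bool (v \<in> e))"
    by (rule sum.swap)
  also have "\<dots> = (\<Sum>e\<in>E. k)"
  proof (rule sum.cong[OF refl])
    fix e assume "e \<in> E"
    then have "{..<n} \<inter> {v. v \<in> e} = e" "card e = k"
      using E by auto
    then show "(\<Sum>v<n. of_bool (v \<in> e)) = k"
      by (simp add: of_bool_def sum.If_cases)
  qed
  finally show ?thesis
    by simp
qed

definition edge_orders :: "nat \<Rightarrow> nat \<Rightarrow> (nat \<Rightarrow> nat) \<Rightarrow> nat set list set" where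
  "edge_orders n k \<delta> = {es. distinct es \<and> set es \<in> degree_class n k \<delta>}"

lemma vertex_degree_set:
  "distinct es \<Longrightarrow> vertex_degree (set es) v = length (filter (\<lambda>e. v \<in> e) es)"
  unfolding vertex_degree_def using distinct_card[of "filter (\<lambda>e. v \<in> e) es"] by simp

text \<open>The \<open>M\<close> tuples use up all points, so their edges give each vertex exactly
  its prescribed degree.\<close>

lemma simple_seqs_eq_UN:
  assumes "(\<Sum>v<n. \<delta> v) = k * M" "k \<ge> 1"
  shows "{ls\<in>seqs k M (points n \<delta>). simple_seq ls \<and> Q (map (\<lambda>l. fst ` set l) ls)} =
    (\<Union>es\<in>{es\<in>edge_orders n k \<delta>. Q es}. edge_seqs k es (points n \<delta>))" (is "?L = ?R")
proof
  show "?L \<subseteq> ?R"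
  proof
    fix ls assume ls: "ls \<in> ?L"
    define es where "es = map (\<lambda>l. fst ` set l) ls"
    have simple: "\<forall>l\<in>set ls. distinct (map fst l)" "distinct es"
      using ls by (auto simp: simple_seq_def es_def)
    have seq: "length ls = M" "\<forall>l\<in>set ls. length l = k" "distinct (concat ls)" "set (concat ls) \<subseteq> points n \<delta>"
      using ls by (auto simp: in_seqs_iff)
    have len: "length (concat ls) = k * M"
      using length_concat_blocks[OF seq(2)] seq(1) by simp
    then have "card (set (concat ls)) = card (points n \<delta>)"
      using assms distinct_card[OF seq(3)] by (simp only: card_points)
    then have all: "set (concat ls) = points n \<delta>"
      using seq(4) finite_points by (intro card_subset_eq)
    have "vertex_degree (set es) v = \<delta> v" if "v < n" for v
      using rem_concat[OF seq(3) simple(1), of v] that rem_points[of n \<delta> v] vertex_degree_set[OF simple(2)]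
      unfolding all es_def by simp
    moreover have "e \<subseteq> {..<n} \<and> card e = k" if "e \<in> set es" for e
    proof -
      from that obtain l where l: "l \<in> set ls" "e = fst ` set l"
        by (auto simp: es_def)
      have "fst ` set l \<subseteq> {..<n}"
        using l(1) seq(4) by (force simp: points_def)
      moreover have "card (fst ` set l) = k"
        using simple(1) seq(2) l(1) distinct_card[of "map fst l"] by simp
      ultimately show ?thesis
        using l by simp
    qed
    ultimately have "es \<in> edge_orders n k \<delta>"
      using simple by (auto simp: edge_orders_def degree_class_def uniform_hypergraph_def)
    moreover have "ls \<in> edge_seqs k es (points n \<delta>)"
      using ls simple seq(1) by (auto simp: edge_seqs_def es_def list_all2_map2 list.rel_refl_strong)
    ultimately show "ls \<in> ?R"
      using ls by (auto simp: es_def)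
  qed
  show "?R \<subseteq> ?L"
  proof
    fix ls assume "ls \<in> ?R"
    then obtain es where es: "es \<in> edge_orders n k \<delta>" "Q es" and ls: "ls \<in> edge_seqs k es (points n \<delta>)"
      by auto
    have "k * length es = (\<Sum>v<n. \<delta> v)"
      using es card_degree_class[of "set es" n k \<delta>] by (auto simp: edge_orders_def distinct_card)
    then have "length es = M"
      using assms by simp
    moreover have rel: "list_all2 (\<lambda>l e. distinct (map fst l) \<and> fst ` set l = e) ls es"
      using ls by (simp add: edge_seqs_def)
    then have "map (\<lambda>l. fst ` set l) ls = es \<and> (\<forall>l\<in>set ls. distinct (map fst l))"
      by (induction rule: list_all2_induct) auto
    ultimately show "ls \<in> ?L"
      using ls es by (auto simp: edge_seqs_def simple_seq_def edge_orders_def)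
  qed
qed

lemma finite_edge_orders: "finite (edge_orders n k \<delta>)"
proof (rule finite_subset)
  show "edge_orders n k \<delta> \<subseteq> (\<Union>E\<in>degree_class n k \<delta>. permutations_of_set E)"
    by (auto simp: edge_orders_def permutations_of_set_def)
qed (use finite_degree_class in auto)

text \<open>By \<open>card_edge_seqs\<close> the fibres over the edge orders have equal size, so an
  event about edge orders is as frequent there as among the simple sequences.\<close>

lemma card_simple_seqs_eq:
  assumes "(\<Sum>v<n. \<delta> v) = k * M" "k \<ge> 1"
  shows "card {ls\<in>seqs k M (points n \<delta>). simple_seq ls \<and> Q (map (\<lambda>l. fst ` set l) ls)} =
    card {es\<in>edge_orders n k \<delta>. Q es} * (fact k ^ M * (\<Prod>v<n. fact (\<delta> v)))"
proof -
  let ?A = "points n \<delta>"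
  have fin: "finite (edge_seqs k es ?A)" for es
    by (rule finite_subset[OF _ finite_seqs[OF finite_points]]) (auto simp: edge_seqs_def)
  have disj: "edge_seqs k es ?A \<inter> edge_seqs k es' ?A = {}" if "es \<noteq> es'" for es es'
  proof -
    have eq: "map (\<lambda>l. fst ` set l) ls = es" if "ls \<in> edge_seqs k es ?A" for ls es
    proof -
      have "list_all2 (\<lambda>l e. distinct (map fst l) \<and> fst ` set l = e) ls es"
        using that by (simp add: edge_seqs_def)
      then show ?thesis
        by (induction rule: list_all2_induct) auto
    qed
    show ?thesis
    proof (rule ccontr)
      assume "edge_seqs k es ?A \<inter> edge_seqs k es' ?A \<noteq> {}"
      then obtain ls where "ls \<in> edge_seqs k es ?A" "ls \<in> edge_seqs k es' ?A"
        by auto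
      then show False
        using eq[of ls es] eq[of ls es'] that by simp
    qed
  qed
  have card: "card (edge_seqs k es ?A) = fact k ^ M * (\<Prod>v<n. fact (\<delta> v))" if es: "es \<in> edge_orders n k \<delta>" for es
  proof -
    have "length es = M"
      using es card_degree_class[of "set es" n k \<delta>] assms by (auto simp: edge_orders_def distinct_card)
    moreover have "card (edge_seqs k es ?A) = fact k ^ length es * (\<Prod>v\<in>{..<n}. fact (rem ?A v))"
    proof (rule card_edge_seqs)
      show "rem ?A v = length (filter (\<lambda>e. v \<in> e) es)" if "v \<in> {..<n}" for v
        using es that vertex_degree_set[of es v] by (auto simp: edge_orders_def degree_class_def rem_points)
      show "e \<subseteq> {..<n} \<and> card e = k" if "e \<in> set es" for e
        using es that by (auto simp: edge_orders_def degree_class_def uniform_hypergraph_def)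
    qed (auto simp: finite_points)
    ultimately show ?thesis
      by (simp add: rem_points)
  qed
  have "card {ls\<in>seqs k M ?A. simple_seq ls \<and> Q (map (\<lambda>l. fst ` set l) ls)} =
      (\<Sum>es\<in>{es\<in>edge_orders n k \<delta>. Q es}. card (edge_seqs k es ?A))"
    unfolding simple_seqs_eq_UN[OF assms] using fin disj finite_edge_orders
    by (intro card_UN_disjoint) auto
  also have "\<dots> = (\<Sum>es\<in>{es\<in>edge_orders n k \<delta>. Q es}. fact k ^ M * (\<Prod>v<n. fact (\<delta> v)))"
    using card by (intro sum.cong) auto
  finally show ?thesis
    by simp
qed

text \<open>Supplies one degree sequence with the given profile. A hypergraph realising it shows
  that \<open>hypergraphs\<close> is nonempty, so that \<open>pmf_of_set\<close> is the uniform
  distribution there.\<close>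

lemma ex_degree_function:
  assumes "(\<Sum>i=1..\<Delta>. d i) = n"
  shows "\<exists>\<delta> :: nat \<Rightarrow> nat. (\<forall>v<n. \<delta> v \<in> {1..\<Delta>}) \<and> (\<forall>i\<in>{1..\<Delta>}. card {v\<in>{..<n}. \<delta> v = i} = d i)"
proof -
  define xs where "xs = concat (map (\<lambda>i. replicate (d i) i) [1..<Suc \<Delta>])"
  have "length xs = sum_list (map d [1..<Suc \<Delta>])"
    by (simp add: xs_def length_concat o_def del: upt_Suc)
  also have "\<dots> = (\<Sum>i\<in>{1..<Suc \<Delta>}. d i)"
    by (simp only: sum_set_upt_conv_sum_list_nat set_upt[symmetric])
  also have "{1..<Suc \<Delta>} = {1..\<Delta>}"
    by auto
  finally have len: "length xs = n"
    using assms by simp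
  have "card {v\<in>{..<n}. xs ! v = i} = d i" if i: "i \<in> {1..\<Delta>}" for i
  proof -
    have "card {v\<in>{..<n}. xs ! v = i} = length (filter (\<lambda>x. x = i) xs)"
      by (simp add: length_filter_conv_card len)
    also have "\<dots> = sum_list (map (\<lambda>j. if j = i then d j else 0) [1..<Suc \<Delta>])"
    proof -
      have "length (filter (\<lambda>x. x = i) (replicate (d j) j)) = (if j = i then d j else 0)" for j
        by simp
      then show ?thesis
        unfolding xs_def filter_concat length_concat map_map o_def by (simp del: upt_Suc)
    qed
    also have "\<dots> = (\<Sum>j\<in>{1..<Suc \<Delta>}. if j = i then d j else 0)"
      by (simp only: sum_set_upt_conv_sum_list_nat set_upt[symmetric])
    also have "\<dots> = d i"
      using i by simp
    finally show ?thesis .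
  qed
  moreover have "xs ! v \<in> {1..\<Delta>}" if "v < n" for v
  proof -
    have "xs ! v \<in> set xs"
      using that len by simp
    then show ?thesis
      by (auto simp: xs_def split: if_splits)
  qed
  ultimately show ?thesis
    by (intro exI[of _ "\<lambda>v. xs ! v"]) blast
qed

lemma sum_by_degree:
  fixes f :: "nat \<Rightarrow> 'a::comm_semiring_1" and \<delta> :: "nat \<Rightarrow> nat"
  assumes "\<forall>v<n. \<delta> v \<in> {1..\<Delta>}" "\<forall>i\<in>{1..\<Delta>}. card {v\<in>{..<n}. \<delta> v = i} = d i"
  shows "(\<Sum>v<n. f (\<delta> v)) = (\<Sum>i=1..\<Delta>. of_nat (d i) * f i)"
proof -
  have "(\<Sum>v<n. f (\<delta> v)) = (\<Sum>i\<in>{1..\<Delta>}. \<Sum>v | v \<in> {..<n} \<and> \<delta> v = i. f (\<delta> v))"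
    using assms(1) by (intro sum.group[symmetric]) auto
  also have "\<dots> = (\<Sum>i\<in>{1..\<Delta>}. \<Sum>v | v \<in> {..<n} \<and> \<delta> v = i. f i)"
    by (intro sum.cong refl) auto
  also have "\<dots> = (\<Sum>i=1..\<Delta>. of_nat (d i) * f i)"
    using assms(2) by (intro sum.cong refl) simp
  finally show ?thesis .
qed

text \<open>All members of \<open>H\<close> have \<open>M\<close> edges and hence
  \<open>fact M\<close> edge orders, so a hypergraph together with its scan order is a uniform pair.
  Grouping the pairs by degree sequence reduces the claim to the bound in each class;
  \<open>cls\<close> ensures that each group is a whole class.\<close>

lemma prob_random_greedy_le:
  assumes H: "finite H" "H \<noteq> {}" and unif: "\<And>E. E \<in> H \<Longrightarrow> uniform_hypergraph n k E" and k: "k \<ge> 1" and \<eta>: "\<eta> \<ge> 0"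
    and cls: "\<And>E. E \<in> H \<Longrightarrow> degree_class n k (\<lambda>v. if v < n then vertex_degree E v else 0) \<subseteq> H"
    and card: "\<And>E. E \<in> H \<Longrightarrow> card E = M"
    and bound: "\<And>E. E \<in> H \<Longrightarrow>
      real (card {es\<in>edge_orders n k (\<lambda>v. if v < n then vertex_degree E v else 0). fold greedy_step es {} \<in> B})
        \<le> \<eta> * real (card (edge_orders n k (\<lambda>v. if v < n then vertex_degree E v else 0)))"
  shows "measure_pmf.prob (bind_pmf (pmf_of_set H) random_greedy) B \<le> \<eta>"
proof -
  define bad where "bad E = {es\<in>permutations_of_set E. fold greedy_step es {} \<in> B}" for E
  define dg where "dg E = (\<lambda>v. if v < n then vertex_degree E v else 0)" for E
  have E: "finite E" "{} \<notin> E" if "E \<in> H" for E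
    using unif[OF that] k finite_uniform by (auto simp: uniform_hypergraph_def)
  have one: "measure_pmf.prob (random_greedy E) B = card (bad E) / fact M" if "E \<in> H" for E
  proof -
    have "measure_pmf.prob (random_greedy E) B =
        measure_pmf.prob (pmf_of_set (permutations_of_set E)) {es. fold greedy_step es {} \<in> B}"
      using E[OF that] by (simp add: random_greedy_eq_fold measure_map_pmf vimage_def)
    also have "\<dots> = card (permutations_of_set E \<inter> {es. fold greedy_step es {} \<in> B}) / card (permutations_of_set E)"
      using E[OF that] by (intro measure_pmf_of_set) auto
    also have "permutations_of_set E \<inter> {es. fold greedy_step es {} \<in> B} = bad E"
      by (auto simp: bad_def)
    finally show ?thesis
      using E[OF that] card[OF that] by simp
  qed
  have "measure_pmf.prob (bind_pmf (pmf_of_set H) random_greedy) B =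
      pmf (map_pmf (\<lambda>M. M \<in> B) (bind_pmf (pmf_of_set H) random_greedy)) True"
    by (simp add: pmf_map vimage_def)
  also have "\<dots> = (\<Sum>E\<in>H. pmf (map_pmf (\<lambda>M. M \<in> B) (random_greedy E)) True) / card H"
    using H by (simp add: map_bind_pmf pmf_bind_pmf_of_set)
  also have "\<dots> = (\<Sum>E\<in>H. card (bad E) / fact M) / card H"
    using one by (simp add: pmf_map vimage_def)
  also have "\<dots> = (\<Sum>E\<in>H. real (card (bad E))) / (fact M * card H)"
    by (simp add: sum_divide_distrib[symmetric] mult.commute)
  also have "(\<Sum>E\<in>H. real (card (bad E))) \<le> \<eta> * (fact M * card H)"
  proof -
    have grp: "(\<Sum>E\<in>H. f E) = (\<Sum>\<delta>\<in>dg ` H. \<Sum>E | E \<in> H \<and> dg E = \<delta>. f E)" for f :: "hypergraph \<Rightarrow> real"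
      using H by (intro sum.group[symmetric]) auto
    have orders: "card {es\<in>edge_orders n k \<delta>. Q es} = (\<Sum>E | E \<in> H \<and> dg E = \<delta>. card {es\<in>permutations_of_set E. Q es})"
      if "\<delta> \<in> dg ` H" for \<delta> Q
    proof -
      from that obtain E0 where E0: "E0 \<in> H" "\<delta> = dg E0"
        by auto
      have "{E. E \<in> H \<and> dg E = \<delta>} = degree_class n k \<delta>"
      proof (intro set_eqI iffI)
        fix E assume "E \<in> {E. E \<in> H \<and> dg E = \<delta>}"
        then show "E \<in> degree_class n k \<delta>"
          using unif[of E] by (auto simp: degree_class_def dg_def)
      next
        fix E assume E: "E \<in> degree_class n k \<delta>"
        have "E \<in> H"
          using cls[OF E0(1)] E E0(2) by (auto simp: dg_def)
        moreover have "dg E = \<delta>"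
          using E E0(2) by (auto simp: dg_def degree_class_def fun_eq_iff)
        ultimately show "E \<in> {E. E \<in> H \<and> dg E = \<delta>}"
          by simp
      qed
      moreover have "{es\<in>edge_orders n k \<delta>. Q es} = (\<Union>E\<in>degree_class n k \<delta>. {es\<in>permutations_of_set E. Q es})"
        by (auto simp: edge_orders_def permutations_of_set_def)
      moreover have "card (\<Union>E\<in>degree_class n k \<delta>. {es\<in>permutations_of_set E. Q es}) =
          (\<Sum>E\<in>degree_class n k \<delta>. card {es\<in>permutations_of_set E. Q es})"
      proof (intro card_UN_disjoint finite_degree_class ballI)
        show "finite {es\<in>permutations_of_set E. Q es}" for E
          by (rule finite_subset[of _ "permutations_of_set E"]) auto
      qed (auto simp: permutations_of_set_def)
      ultimately show ?thesis
        by simp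
    qed
    have "(\<Sum>E\<in>H. real (card (bad E))) = (\<Sum>\<delta>\<in>dg ` H. real (card {es\<in>edge_orders n k \<delta>. fold greedy_step es {} \<in> B}))"
      unfolding grp[of "\<lambda>E. real (card (bad E))"]
      by (rule sum.cong[OF refl]) (simp only: orders bad_def of_nat_sum)
    also have "\<dots> \<le> (\<Sum>\<delta>\<in>dg ` H. \<eta> * real (card {es\<in>edge_orders n k \<delta>. True}))"
      using bound by (intro sum_mono) (auto simp: dg_def)
    also have "\<dots> = (\<Sum>\<delta>\<in>dg ` H. \<eta> * (\<Sum>E | E \<in> H \<and> dg E = \<delta>. real (card {es\<in>permutations_of_set E. True})))"
      by (intro sum.cong refl) (simp only: orders of_nat_sum)
    also have "\<dots> = \<eta> * (\<Sum>E\<in>H. real (card {es\<in>permutations_of_set E. True}))"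
      unfolding grp sum_distrib_left ..
    also have "(\<Sum>E\<in>H. real (card {es\<in>permutations_of_set E. True})) = (\<Sum>E\<in>H. fact M)"
      using E card by (intro sum.cong refl) simp
    finally show ?thesis
      by (simp add: mult.commute)
  qed
  then have "(\<Sum>E\<in>H. real (card (bad E))) / (fact M * card H) \<le> \<eta>"
    using H by (simp add: pos_divide_le_eq card_gt_0_iff)
  finally show ?thesis .
qed

lemma card_seqs_pos: "finite A \<Longrightarrow> k * m \<le> card A \<Longrightarrow> 0 < card (seqs k m A)"
proof (induction m arbitrary: A)
  case (Suc m)
  have "tuples k A \<noteq> {}"
    using card_tuples_pos[OF Suc.prems(1), of k] Suc.prems(2) by auto
  then obtain l where l: "l \<in> tuples k A"
    by blast
  have "0 < card (seqs k m (A - set l))"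
    using Suc.IH[of "A - set l"] Suc.prems card_Diff_tuple[OF Suc.prems(1) l] by simp
  also have "\<dots> \<le> (\<Sum>l\<in>tuples k A. card (seqs k m (A - set l)))"
    using l finite_tuples[OF Suc.prems(1)] by (intro member_le_sum[of l _ "\<lambda>l. card (seqs k m (A - set l))"]) auto
  finally show ?case
    by (simp only: card_seqs_Suc[OF Suc.prems(1)])
qed simp

section \<open>Failure probability for a degree profile\<close>

context degree_distribution
begin

definition has_profile :: "nat \<Rightarrow> (nat \<Rightarrow> nat) \<Rightarrow> bool" where
  "has_profile n \<delta> \<longleftrightarrow> (\<exists>d. degree_profile k \<Delta> \<zeta> n d \<and> (\<forall>v<n. \<delta> v \<in> {1..\<Delta>}) \<and>
     (\<forall>i\<in>{1..\<Delta>}. card {v\<in>{..<n}. \<delta> v = i} = d i))"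

text \<open>Rounding changes the number of vertices of each degree by less than one, so
  \<open>N\<close> and the initial \<open>B\<^sub>i\<close> are within constants of
  \<open>n * P_coeff 1 1\<close> and of the trajectory at s = 1.\<close>

lemma profile_state:
  assumes "has_profile n \<delta>" "n \<ge> 1"
  defines "N \<equiv> (\<Sum>v<n. \<delta> v)"
  shows "state n N {..<n} (points n \<delta>)" "k dvd N" "n \<le> N" "N \<le> \<Delta> * n"
    and "\<bar>err n N {..<n} i (points n \<delta>) {}\<bar> \<le> real \<Delta> * 2 ^ \<Delta>"
proof -
  obtain d where d: "degree_profile k \<Delta> \<zeta> n d" "\<forall>v<n. \<delta> v \<in> {1..\<Delta>}"
    "\<forall>i\<in>{1..\<Delta>}. card {v\<in>{..<n}. \<delta> v = i} = d i"
    using assms(1) by (auto simp: has_profile_def)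
  have dz: "\<bar>real (d j) - \<zeta> j * real n\<bar> \<le> 1" if "j \<in> {1..\<Delta>}" for j
    using d(1) that by (force simp: degree_profile_def)
  have Nd: "N = (\<Sum>i=1..\<Delta>. d i * i)"
    unfolding N_def using sum_by_degree[OF d(2,3), of "\<lambda>i. i"] by simp
  then show "k dvd N"
    using d(1) by (simp add: degree_profile_def mult.commute)
  have "(\<Sum>v<n. 1) \<le> N" "N \<le> (\<Sum>v<n. \<Delta>)"
    unfolding N_def using d(2) by (intro sum_mono; simp)+
  then show nN: "n \<le> N" "N \<le> \<Delta> * n"
    by (simp_all add: mult.commute)
  have diff: "\<bar>(\<Sum>j=1..\<Delta>. real (d j) * f j) - real n * (\<Sum>j=1..\<Delta>. \<zeta> j * f j)\<bar> \<le> (\<Sum>j=1..\<Delta>. f j)"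
    if "\<And>j. 0 \<le> f j" for f :: "nat \<Rightarrow> real"
  proof -
    have "(\<Sum>j=1..\<Delta>. real (d j) * f j) - real n * (\<Sum>j=1..\<Delta>. \<zeta> j * f j) =
        (\<Sum>j=1..\<Delta>. (real (d j) - \<zeta> j * real n) * f j)"
      by (simp add: sum_distrib_left sum_subtractf[symmetric] algebra_simps)
    also have "\<bar>\<dots>\<bar> \<le> (\<Sum>j=1..\<Delta>. \<bar>(real (d j) - \<zeta> j * real n) * f j\<bar>)"
      by (rule sum_abs)
    also have "\<dots> \<le> (\<Sum>j=1..\<Delta>. 1 * f j)"
      unfolding abs_mult using dz that by (intro sum_mono mult_mono) auto
    finally show ?thesis
      by simp
  qed
  have "\<bar>real N - real n * P_coeff 1 1\<bar> \<le> (\<Sum>j=1..\<Delta>. real j)"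
    using diff[of real] by (simp add: Nd P_coeff_def)
  also have "\<dots> \<le> (\<Sum>j=1..\<Delta>. real \<Delta>)"
    by (intro sum_mono) simp
  finally have "\<bar>real n * P_coeff 1 1 - real N\<bar> \<le> (real \<Delta>)\<^sup>2"
    by (simp add: power2_eq_square abs_minus_commute)
  moreover have "rem (points n \<delta>) v \<le> \<Delta>" for v
    using d(2) by (auto simp: rem_points)
  moreover have "fst ` points n \<delta> \<subseteq> {..<n}"
    by (auto simp: points_def)
  ultimately show "state n N {..<n} (points n \<delta>)"
    using assms(2) nN by (simp add: state_def finite_points card_points N_def[symmetric])
  have N0: "real (card (points n \<delta>)) / real N = 1"
    using nN assms(2) by (simp add: card_points N_def[symmetric])
  have "fstat {..<n} i (points n \<delta>) {} = (\<Sum>v<n. real (\<delta> v choose i))"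
    by (simp add: fstat_def stat_def rem_points)
  also have "\<dots> = (\<Sum>j=1..\<Delta>. real (d j) * real (j choose i))"
    by (rule sum_by_degree[OF d(2,3)])
  finally have "err n N {..<n} i (points n \<delta>) {} =
      (\<Sum>j=1..\<Delta>. real (d j) * real (j choose i)) - real n * (\<Sum>j=1..\<Delta>. \<zeta> j * real (j choose i))"
    unfolding err_def N0 by (simp add: traj_def \<alpha>_1 P_coeff_def)
  also have "\<bar>\<dots>\<bar> \<le> (\<Sum>j=1..\<Delta>. real (j choose i))"
    by (rule diff) simp
  also have "\<dots> \<le> (\<Sum>j=1..\<Delta>. 2 ^ \<Delta>)"
  proof (rule sum_mono)
    fix j assume j: "j \<in> {1..\<Delta>}"
    have "(j choose i) \<le> 2 ^ j"
      by (cases "i \<le> j") (simp_all add: binomial_le_pow2 binomial_eq_0)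
    also have "\<dots> \<le> 2 ^ \<Delta>"
      using j by (intro power_increasing) auto
    finally show "real (j choose i) \<le> 2 ^ \<Delta>"
      by (metis of_nat_le_iff of_nat_numeral of_nat_power)
  qed
  finally show "\<bar>err n N {..<n} i (points n \<delta>) {}\<bar> \<le> real \<Delta> * 2 ^ \<Delta>"
    by simp
qed

text \<open>By \<open>\<alpha>_0\<close> the reference value is P at the end root; the inequality is
  strict because this is the complement of the event in the theorem.\<close>

definition bad_matchings :: "nat \<Rightarrow> real \<Rightarrow> hypergraph set" where
  "bad_matchings n \<epsilon> = {M. \<epsilon> * real n < \<bar>real (card (uncovered n M)) - P_coeff 0 (\<alpha> 0) * real n\<bar>}"

text \<open>The last \<open>M0\<close> tuples cover at most \<open>k * M0\<close> further vertices,
  and in the same period the trajectory moves by at most \<open>n * Lip * s\<close>, where s is the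
  unrevealed proportion. A large final deviation is thus visible when the scan is stopped.\<close>

lemma bad_seq_imp_err:
  assumes ls: "ls \<in> seqs k M (points n \<delta>)" "simple_seq ls"
    and N: "N = (\<Sum>v<n. \<delta> v)" "N = k * M" "M0 \<le> M" "N > 0"
    and bad: "fold greedy_step (map (\<lambda>l. fst ` set l) ls) {} \<in> bad_matchings n \<epsilon>"
  shows "\<epsilon> * real n - real (k * M0) - real n * Lip * (real (k * M0) / real N) <
    \<bar>err n N {..<n} 0 (points n \<delta> - set (concat (take (M - M0) ls))) (foldl next_cover {} (take (M - M0) ls))\<bar>"
proof -
  define m where "m = M - M0"
  define C1 C2 where "C1 = foldl next_cover {} (take m ls)" and "C2 = foldl next_cover {} ls"
  define s where "s = real (k * M0) / real N"
  have seq: "length ls = M" "\<forall>l\<in>set ls. length l = k" "distinct (concat ls)" "set (concat ls) \<subseteq> points n \<delta>"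
    using ls(1) by (auto simp: in_seqs_iff)
  have dist: "\<forall>l\<in>set ls. distinct (map fst l)"
    using ls(2) by (simp add: simple_seq_def)
  have U2: "uncovered n (fold greedy_step (map (\<lambda>l. fst ` set l) ls) {}) = {..<n} - C2"
    using foldl_next_cover_greedy[OF dist, of "{}"] by (simp add: uncovered_def C2_def)
  have "C2 = foldl next_cover C1 (drop m ls)"
    unfolding C1_def C2_def foldl_append[symmetric] by simp
  moreover have "finite C1"
    using foldl_next_cover_bounds[of "take m ls" k "{}"] seq(2) set_take_subset[of m ls] by (auto simp: C1_def)
  ultimately have C12: "C1 \<subseteq> C2" "finite C2" "card C2 \<le> card C1 + k * M0"
    using foldl_next_cover_bounds[of "drop m ls" k C1] seq(1,2) set_drop_subset[of m ls] N(3)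
    by (auto simp: m_def)
  have U12: "card ({..<n} - C2) \<le> card ({..<n} - C1)" "card ({..<n} - C1) \<le> card ({..<n} - C2) + k * M0"
  proof -
    show "card ({..<n} - C2) \<le> card ({..<n} - C1)"
      using C12 by (intro card_mono) auto
    have "card ({..<n} - C1) \<le> card (({..<n} - C2) \<union> (C2 - C1))"
      using C12 by (intro card_mono) auto
    also have "\<dots> \<le> card ({..<n} - C2) + card (C2 - C1)"
      by (rule card_Un_le)
    also have "card (C2 - C1) \<le> k * M0"
      using C12 \<open>finite C1\<close> by (simp add: card_Diff_subset)
    finally show "card ({..<n} - C1) \<le> card ({..<n} - C2) + k * M0"
      by simp
  qed
  have cardA: "card (points n \<delta> - set (concat (take m ls))) = k * M0"
  proof -
    have ap: "concat (take m ls) @ concat (drop m ls) = concat ls"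
      unfolding concat_append[symmetric] by simp
    have "distinct (concat (take m ls))" "set (concat (take m ls)) \<subseteq> points n \<delta>"
      using seq(3,4) unfolding ap[symmetric] by auto
    moreover have "length (concat (take m ls)) = k * m"
      using length_concat_blocks[of "take m ls" k] seq(1,2) set_take_subset[of m ls] by (auto simp: m_def)
    ultimately have "card (set (concat (take m ls))) = k * m"
      using distinct_card[of "concat (take m ls)"] by simp
    moreover have "k * M = k * m + k * M0"
      using N(3) by (simp add: m_def distrib_left[symmetric])
    ultimately show ?thesis
      using \<open>set (concat (take m ls)) \<subseteq> points n \<delta>\<close> N(1,2)
      by (simp add: card_Diff_subset card_points)
  qed
  have err_eq: "err n N {..<n} 0 (points n \<delta> - set (concat (take m ls))) C1 = card ({..<n} - C1) - n * P_coeff 0 (\<alpha> s)"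
    unfolding err_def cardA s_def[symmetric] by (simp add: fstat_def stat_def traj_def)
  have "k * M0 \<le> N"
    using N(2,3) by simp
  then have "real (k * M0) \<le> real N"
    by (rule of_nat_mono)
  then have s: "0 \<le> s" "s \<le> 1"
    using N(4) unfolding s_def by (simp_all only: divide_nonneg_nonneg of_nat_0_le_iff) (simp add: divide_simps)
  have "\<bar>P_coeff 0 (\<alpha> s) - P_coeff 0 (\<alpha> 0)\<bar> \<le> Lip * (\<alpha> s - \<alpha> 0)"
    using \<alpha>[of s] \<alpha>[of 0] \<alpha>_diff[of 0 s] s by (intro P_coeff_Lipschitz) auto
  also have "\<dots> \<le> Lip * s"
    using \<alpha>_diff[of 0 s] s Lip_pos by (intro mult_left_mono) auto
  finally have "real n * \<bar>P_coeff 0 (\<alpha> s) - P_coeff 0 (\<alpha> 0)\<bar> \<le> real n * (Lip * s)"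
    by (rule mult_left_mono) simp
  moreover have "real n * P_coeff 0 (\<alpha> s) - P_coeff 0 (\<alpha> 0) * real n = real n * (P_coeff 0 (\<alpha> s) - P_coeff 0 (\<alpha> 0))"
    by (simp add: algebra_simps)
  ultimately have "\<bar>real n * P_coeff 0 (\<alpha> s) - P_coeff 0 (\<alpha> 0) * real n\<bar> \<le> real n * Lip * s"
    by (simp add: abs_mult mult.assoc)
  moreover have "\<epsilon> * real n < \<bar>real (card ({..<n} - C2)) - P_coeff 0 (\<alpha> 0) * real n\<bar>"
    using bad unfolding bad_matchings_def mem_Collect_eq U2 .
  moreover have "real (card ({..<n} - C2)) \<le> real (card ({..<n} - C1))"
    "real (card ({..<n} - C1)) \<le> real (card ({..<n} - C2)) + real (k * M0)"
    using U12 by (auto simp flip: of_nat_add of_nat_mult)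
  ultimately show ?thesis
    unfolding m_def[symmetric] C1_def[symmetric] s_def[symmetric] err_eq by linarith
qed

text \<open>The bound of \<open>concentration\<close> over all sequences is divided by the fraction
  of simple ones, which costs the power of n; the number \<open>W\<close> of sequences per edge
  order cancels. The same count shows that edge orders exist.\<close>

lemma failure_bound:
  assumes \<epsilon>: "0 < \<epsilon>"
  shows "\<exists>K>0. \<exists>c>0. \<exists>n0\<ge>1. \<forall>n\<ge>n0. \<forall>\<delta>. has_profile n \<delta> \<longrightarrow> edge_orders n k \<delta> \<noteq> {} \<and>
    real (card {es\<in>edge_orders n k \<delta>. fold greedy_step es {} \<in> bad_matchings n \<epsilon>})
      \<le> K * exp (- c * n) * (real \<Delta> * real n) ^ (2 * (k * \<Delta>)\<^sup>2) * real (card (edge_orders n k \<delta>))"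
proof -
  \<comment> \<open>\<epsilon> is split in thirds: concentration, stopping early, and rounding.
    Stopping early costs \<sigma> \<Delta> n vertices and \<sigma> n \<open>Lip\<close> on the
    trajectory.\<close>
  define \<sigma> where "\<sigma> = min 1 (\<epsilon> / (3 * (real \<Delta> + Lip)))"
  have \<sigma>: "0 < \<sigma>" "\<sigma> \<le> 1" "\<sigma> * (real \<Delta> + Lip) \<le> \<epsilon> / 3"
  proof -
    define x where "x = real \<Delta> + Lip"
    have pos: "0 < x" and \<sigma>_eq: "\<sigma> = min 1 (\<epsilon> / (3 * x))"
      using Lip_pos by (simp_all add: x_def \<sigma>_def add_nonneg_pos)
    then show "0 < \<sigma>" "\<sigma> \<le> 1"
      using \<epsilon> by auto
    have "\<sigma> * x \<le> \<epsilon> / (3 * x) * x"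
      using pos by (intro mult_right_mono) (auto simp: \<sigma>_eq)
    also have "\<dots> = \<epsilon> / 3"
      using pos by simp
    finally show "\<sigma> * (real \<Delta> + Lip) \<le> \<epsilon> / 3"
      by (simp only: x_def)
  qed
  have "0 < \<epsilon> / 3" "0 \<le> real \<Delta> * 2 ^ \<Delta>"
    using \<epsilon> by auto
  from concentration[OF \<sigma>(1,2) this, where ?'v = nat and ?'b = nat]
  obtain K c where K: "K > 0" "c > 0" and conc: "\<And>n N (V :: nat set) (A :: (nat \<times> nat) set) M M0.
    state n N V A \<Longrightarrow> card A = N \<Longrightarrow> N = k * M \<Longrightarrow> M0 \<le> M \<Longrightarrow> \<sigma> * real N \<le> real (k * M0) \<Longrightarrow> N \<le> \<Delta> * n \<Longrightarrow>
    (\<forall>i<Suc \<Delta>. \<bar>err n N V i A {}\<bar> \<le> real \<Delta> * 2 ^ \<Delta>) \<Longrightarrow>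
    real (card {ls\<in>seqs k M A. \<epsilon> / 3 * n <
      \<bar>err n N V 0 (A - set (concat (take (M - M0) ls))) (foldl next_cover {} (take (M - M0) ls))\<bar>})
    \<le> K * exp (- c * n) * card (seqs k M A)"
    by blast
  define C where "C = (k * \<Delta>)\<^sup>2"
  \<comment> \<open>\<open>3 * C + 1\<close> meets the hypothesis of \<open>card_simple_seqs\<close>
    because n \<le> N; the other bound keeps the rounding of \<open>M0\<close> within a third of
    \<epsilon> n.\<close>
  define n0 where "n0 = max (3 * C + 1) (nat \<lceil>3 * real k * (1 + Lip) / \<epsilon>\<rceil>)"
  have main: "edge_orders n k \<delta> \<noteq> {} \<and>
    real (card {es\<in>edge_orders n k \<delta>. fold greedy_step es {} \<in> bad_matchings n \<epsilon>})
      \<le> K * exp (- c * n) * (real \<Delta> * real n) ^ (2 * C) * real (card (edge_orders n k \<delta>))"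
    if n: "n \<ge> n0" and prof: "has_profile n \<delta>" for n \<delta>
  proof -
    define N where "N = (\<Sum>v<n. \<delta> v)"
    define A where "A = points n \<delta>"
    have n1: "n \<ge> 1" "n > 3 * C" "3 * real k * (1 + Lip) / \<epsilon> \<le> real n"
      using n by (auto simp: n0_def)
    note ps = profile_state[OF prof n1(1), folded N_def A_def]
    obtain M where M: "N = k * M"
      using ps(2) by (auto elim: dvdE)
    \<comment> \<open>Rounded up, since \<open>concentration\<close> wants at least \<sigma> N
      points to remain; this adds at most one tuple.\<close>
    define M0 where "M0 = nat \<lceil>\<sigma> * real M\<rceil>"
    have "\<sigma> * real M \<le> real M"
      using \<sigma> by (simp add: mult_left_le_one_le)
    then have M0: "M0 \<le> M" "\<sigma> * real M \<le> real M0" "real M0 \<le> \<sigma> * real M + 1"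
      using \<sigma> by (auto simp: M0_def nat_le_iff ceiling_le_iff)
    have kM0: "\<sigma> * real N \<le> real (k * M0)" "real (k * M0) \<le> \<sigma> * real N + real k"
      using mult_left_mono[OF M0(2), of "real k"] mult_left_mono[OF M0(3), of "real k"]
      by (simp_all add: M algebra_simps)
    have pos: "real n > 0" "real N > 0" "real n \<le> real N" "real N \<le> real \<Delta> * real n"
      using n1 ps(3,4) by (auto simp flip: of_nat_mult)
    have cardA: "card A = N" and finA: "finite A"
      by (simp_all add: A_def card_points N_def finite_points)
    interpret ps: point_set k \<Delta> A
      using k \<Delta> ps(1) by unfold_locales (auto simp: state_def)
    have C0: "ps.C0 = C"
      by (simp add: ps.C0_def C_def)
    define Bad where "Bad = {ls\<in>seqs k M A. \<epsilon> / 3 * n <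
      \<bar>err n N {..<n} 0 (A - set (concat (take (M - M0) ls))) (foldl next_cover {} (take (M - M0) ls))\<bar>}"
    have Bad: "real (card Bad) \<le> K * exp (- c * n) * card (seqs k M A)"
      unfolding Bad_def using ps(5) by (intro conc[OF ps(1) cardA M M0(1) kM0(1) ps(4)]) auto
    have "\<epsilon> / 3 * n \<le> \<epsilon> * real n - real (k * M0) - real n * Lip * (real (k * M0) / real N)"
    proof -
      have "real n * Lip * (real (k * M0) / real N) \<le> real n * Lip * (\<sigma> + real k / real n)"
      proof (rule mult_left_mono)
        have "real (k * M0) / real N \<le> (\<sigma> * real N + real k) / real N"
          using kM0(2) pos by (intro divide_right_mono) auto
        also have "\<dots> = \<sigma> + real k / real N"
          using pos by (simp add: field_simps)
        also have "real k / real N \<le> real k / real n"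
          using pos by (intro divide_left_mono) auto
        finally show "real (k * M0) / real N \<le> \<sigma> + real k / real n"
          by simp
      qed (use Lip_pos in auto)
      also have "\<dots> = \<sigma> * Lip * real n + Lip * real k"
        using pos by (simp add: field_simps)
      finally have 1: "real n * Lip * (real (k * M0) / real N) \<le> \<sigma> * Lip * real n + Lip * real k" .
      have "\<sigma> * real N \<le> \<sigma> * (real \<Delta> * real n)"
        using pos \<sigma> by (intro mult_left_mono) auto
      then have 2: "real (k * M0) \<le> \<sigma> * real \<Delta> * real n + real k"
        using kM0 by simp
      have 3: "\<sigma> * (real \<Delta> + Lip) * real n \<le> \<epsilon> / 3 * real n"
        using \<sigma>(3) by (intro mult_right_mono) auto
      have 4: "real k * (1 + Lip) \<le> \<epsilon> / 3 * real n"
        using n1(3) \<epsilon> by (simp add: field_simps)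
      have "\<sigma> * (real \<Delta> + Lip) * real n = \<sigma> * real \<Delta> * real n + \<sigma> * Lip * real n"
        "real k * (1 + Lip) = real k + Lip * real k"
        by (simp_all add: algebra_simps)
      then show ?thesis
        using 1 2 3 4 by linarith
    qed
    note slack = this
    have sub: "{ls\<in>seqs k M A. simple_seq ls \<and> fold greedy_step (map (\<lambda>l. fst ` set l) ls) {} \<in> bad_matchings n \<epsilon>} \<subseteq> Bad"
    proof
      fix ls
      assume "ls \<in> {ls\<in>seqs k M A. simple_seq ls \<and> fold greedy_step (map (\<lambda>l. fst ` set l) ls) {} \<in> bad_matchings n \<epsilon>}"
      then have ls: "ls \<in> seqs k M A" "simple_seq ls"
        "fold greedy_step (map (\<lambda>l. fst ` set l) ls) {} \<in> bad_matchings n \<epsilon>"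
        by simp_all
      have "N > 0"
        using pos(2) by simp
      note lt = le_less_trans[OF slack bad_seq_imp_err[OF ls(1)[unfolded A_def] ls(2) N_def M M0(1) this ls(3)]]
      show "ls \<in> Bad"
        unfolding Bad_def mem_Collect_eq by (rule conjI[OF ls(1) lt[folded A_def]])
    qed
    define W where "W = fact k ^ M * (\<Prod>v<n. fact (\<delta> v) :: nat)"
    have W: "W > 0"
      by (simp add: W_def prod_pos)
    have k1: "k \<ge> 1"
      using k by simp
    note eq = card_simple_seqs_eq[of \<delta> n k M, folded N_def A_def W_def, OF M k1]
    have bad_le: "card {es\<in>edge_orders n k \<delta>. fold greedy_step es {} \<in> bad_matchings n \<epsilon>} * W \<le> card Bad"
      unfolding eq[of "\<lambda>es. fold greedy_step es {} \<in> bad_matchings n \<epsilon>", symmetric]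
      using sub finite_seqs[OF finA] by (intro card_mono) (auto simp: Bad_def)
    have "card (seqs k M A) \<le> card {ls\<in>seqs k M A. simple_seq ls} * N ^ (2 * C)"
      using ps.card_simple_seqs[of M] n1(2) ps(3) M unfolding C0 cardA by simp
    moreover have "card {ls\<in>seqs k M A. simple_seq ls} = card (edge_orders n k \<delta>) * W"
      using eq[of "\<lambda>_. True"] by simp
    ultimately have seqs_le: "card (seqs k M A) \<le> card (edge_orders n k \<delta>) * W * N ^ (2 * C)"
      by simp
    have "0 < card (seqs k M A)"
      using card_seqs_pos[OF finA, of k M] cardA M by simp
    then have ne: "edge_orders n k \<delta> \<noteq> {}"
      using seqs_le by (auto intro: Nat.gr0I)
    have "real (card (seqs k M A)) \<le> real (card (edge_orders n k \<delta>) * W * N ^ (2 * C))"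
      using seqs_le by (rule of_nat_mono)
    also have "\<dots> = real (card (edge_orders n k \<delta>)) * real W * real N ^ (2 * C)"
      by simp
    also have "\<dots> \<le> real (card (edge_orders n k \<delta>)) * real W * (real \<Delta> * real n) ^ (2 * C)"
      using pos by (intro mult_left_mono power_mono) auto
    finally have "K * exp (- c * n) * real (card (seqs k M A)) \<le>
        K * exp (- c * n) * (real (card (edge_orders n k \<delta>)) * real W * (real \<Delta> * real n) ^ (2 * C))"
      using K by (intro mult_left_mono) auto
    then have "real (card Bad) \<le>
        K * exp (- c * n) * (real (card (edge_orders n k \<delta>)) * real W * (real \<Delta> * real n) ^ (2 * C))"
      using Bad by linarith
    moreover have "real (card {es\<in>edge_orders n k \<delta>. fold greedy_step es {} \<in> bad_matchings n \<epsilon>}) * real W \<le> real (card Bad)"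
      using bad_le by (simp flip: of_nat_mult)
    ultimately have "real (card {es\<in>edge_orders n k \<delta>. fold greedy_step es {} \<in> bad_matchings n \<epsilon>}) * real W \<le>
        (K * exp (- c * n) * (real \<Delta> * real n) ^ (2 * C) * real (card (edge_orders n k \<delta>))) * real W"
      by (simp only: ac_simps)
    then show ?thesis
      using ne W by (simp only: mult_le_cancel_right_pos of_nat_0_less_iff) simp
  qed
  have "n0 \<ge> 1"
    by (simp add: n0_def)
  then show ?thesis
    using K main unfolding C_def by blast
qed

lemma degree_class_subset:
  assumes "degree_profile k \<Delta> \<zeta> n d" "\<forall>i\<in>{1..\<Delta>}. card {v\<in>{..<n}. \<delta> v = i} = d i"
  shows "degree_class n k \<delta> \<subseteq> hypergraphs n k \<Delta> d"
proof
  fix E assume E: "E \<in> degree_class n k \<delta>"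
  have "{v\<in>{..<n}. vertex_degree E v = i} = {v\<in>{..<n}. \<delta> v = i}" for i
    using E by (auto simp: degree_class_def)
  then show "E \<in> hypergraphs n k \<Delta> d"
    using E assms by (simp add: hypergraphs_def degree_class_def)
qed

text \<open>The prescribed numbers for the degrees 1 to \<Delta> add up to \<open>n\<close>, so no
  vertex is left for any other degree.\<close>

lemma hypergraph_profile:
  assumes "degree_profile k \<Delta> \<zeta> n d" "E \<in> hypergraphs n k \<Delta> d"
  defines "\<delta> \<equiv> (\<lambda>v. if v < n then vertex_degree E v else 0)"
  shows "\<forall>i\<in>{1..\<Delta>}. card {v\<in>{..<n}. \<delta> v = i} = d i" "\<forall>v<n. \<delta> v \<in> {1..\<Delta>}" "E \<in> degree_class n k \<delta>"
proof -
  have eq: "{v\<in>{..<n}. \<delta> v = i} = {v\<in>{..<n}. vertex_degree E v = i}" for i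
    by (auto simp: \<delta>_def)
  then show 1: "\<forall>i\<in>{1..\<Delta>}. card {v\<in>{..<n}. \<delta> v = i} = d i"
    using assms(2) by (simp add: hypergraphs_def)
  show "E \<in> degree_class n k \<delta>"
    using assms(2) by (auto simp: hypergraphs_def degree_class_def \<delta>_def)
  have "card (\<Union>i\<in>{1..\<Delta>}. {v\<in>{..<n}. \<delta> v = i}) = (\<Sum>i\<in>{1..\<Delta>}. card {v\<in>{..<n}. \<delta> v = i})"
    by (intro card_UN_disjoint) auto
  also have "\<dots> = n"
    using 1 assms(1) by (simp add: degree_profile_def)
  finally have "(\<Union>i\<in>{1..\<Delta>}. {v\<in>{..<n}. \<delta> v = i}) = {..<n}"
    by (intro card_subset_eq) auto
  then show "\<forall>v<n. \<delta> v \<in> {1..\<Delta>}"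
    by blast
qed

lemma prob_bad_le:
  assumes \<epsilon>: "0 < \<epsilon>"
  shows "\<exists>K>0. \<exists>c>0. \<exists>n0\<ge>1. \<forall>n\<ge>n0. \<forall>d. degree_profile k \<Delta> \<zeta> n d \<longrightarrow>
    measure_pmf.prob (bind_pmf (random_hypergraph n k \<Delta> d) random_greedy) (bad_matchings n \<epsilon>)
      \<le> K * exp (- c * n) * (real \<Delta> * real n) ^ (2 * (k * \<Delta>)\<^sup>2)"
proof -
  obtain K c n0 where K: "K > 0" "c > 0" "n0 \<ge> 1" and fb: "\<And>n \<delta>. n \<ge> n0 \<Longrightarrow> has_profile n \<delta> \<Longrightarrow>
    edge_orders n k \<delta> \<noteq> {} \<and>
    real (card {es\<in>edge_orders n k \<delta>. fold greedy_step es {} \<in> bad_matchings n \<epsilon>})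
      \<le> K * exp (- c * n) * (real \<Delta> * real n) ^ (2 * (k * \<Delta>)\<^sup>2) * real (card (edge_orders n k \<delta>))"
    using failure_bound[OF \<epsilon>] by blast
  have "measure_pmf.prob (bind_pmf (random_hypergraph n k \<Delta> d) random_greedy) (bad_matchings n \<epsilon>)
      \<le> K * exp (- c * n) * (real \<Delta> * real n) ^ (2 * (k * \<Delta>)\<^sup>2)"
    if n: "n \<ge> n0" and d: "degree_profile k \<Delta> \<zeta> n d" for n d
  proof -
    define H where "H = hypergraphs n k \<Delta> d"
    define dg where "dg E = (\<lambda>v. if v < n then vertex_degree E v else 0)" for E
    have "(\<Sum>i=1..\<Delta>. d i) = n"
      using d by (simp add: degree_profile_def)
    then obtain \<delta>0 where \<delta>0: "\<forall>v<n. \<delta>0 v \<in> {1..\<Delta>}" "\<forall>i\<in>{1..\<Delta>}. card {v\<in>{..<n}. \<delta>0 v = i} = d i"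
      using ex_degree_function by blast
    then have "has_profile n \<delta>0"
      using d unfolding has_profile_def by blast
    then have "edge_orders n k \<delta>0 \<noteq> {}"
      using fb[OF n] by blast
    then have ne: "H \<noteq> {}"
      using degree_class_subset[OF d \<delta>0(2)] by (auto simp: edge_orders_def H_def)
    have prof: "has_profile n (dg E)" if "E \<in> H" for E
      using hypergraph_profile[OF d, of E] that d unfolding has_profile_def H_def dg_def by blast
    define N where "N = (\<Sum>i=1..\<Delta>. d i * i)"
    have cardE: "card E = N div k" if "E \<in> H" for E
    proof -
      have "k * card E = (\<Sum>v<n. dg E v)"
        using hypergraph_profile(3)[OF d, of E] that by (intro card_degree_class) (simp add: H_def dg_def)
      also have "\<dots> = N"
      proof -
        have E: "E \<in> hypergraphs n k \<Delta> d"
          using that by (simp only: H_def)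
        have "\<forall>v<n. dg E v \<in> {1..\<Delta>}" "\<forall>i\<in>{1..\<Delta>}. card {v\<in>{..<n}. dg E v = i} = d i"
          using hypergraph_profile(1,2)[OF d E] unfolding dg_def by blast+
        then show ?thesis
          using sum_by_degree[of n "dg E" \<Delta> d "\<lambda>i. i"] by (simp add: N_def)
      qed
      finally show ?thesis
        using k by auto
    qed
    have "measure_pmf.prob (bind_pmf (pmf_of_set H) random_greedy) (bad_matchings n \<epsilon>)
        \<le> K * exp (- c * n) * (real \<Delta> * real n) ^ (2 * (k * \<Delta>)\<^sup>2)"
    proof (rule prob_random_greedy_le[where n = n and k = k and M = "N div k"])
      show "finite H"
        by (rule finite_subset[of _ "Pow (Pow {..<n})"])
          (auto simp: H_def hypergraphs_def uniform_hypergraph_def)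
      show "uniform_hypergraph n k E" if "E \<in> H" for E
        using that by (simp add: H_def hypergraphs_def)
      show "degree_class n k (\<lambda>v. if v < n then vertex_degree E v else 0) \<subseteq> H" if "E \<in> H" for E
        using degree_class_subset[OF d hypergraph_profile(1)[OF d]] that by (simp add: H_def)
      show "real (card {es\<in>edge_orders n k (\<lambda>v. if v < n then vertex_degree E v else 0).
          fold greedy_step es {} \<in> bad_matchings n \<epsilon>})
        \<le> K * exp (- c * n) * (real \<Delta> * real n) ^ (2 * (k * \<Delta>)\<^sup>2) *
          real (card (edge_orders n k (\<lambda>v. if v < n then vertex_degree E v else 0)))" if "E \<in> H" for E
        using fb[OF n prof[OF that]] unfolding dg_def by blast
    qed (use ne cardE k K in auto)
    then show ?thesis
      by (simp add: random_hypergraph_def H_def)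
  qed
  then show ?thesis
    using K by blast
qed

end

section \<open>Passage to the limit\<close>

lemma exp_decay_times_power:
  fixes c K D :: real
  assumes "c > 0"
  shows "(\<lambda>n. K * exp (- c * real n) * (D * real n) ^ p) \<longlonglongrightarrow> 0"
proof -
  have "filterlim (\<lambda>n. c * real n) at_top sequentially"
    using assms by (intro filterlim_tendsto_pos_mult_at_top[OF tendsto_const _ filterlim_real_sequentially])
  then have "(\<lambda>n. (c * real n) ^ p / exp (c * real n)) \<longlonglongrightarrow> 0"
    by (rule filterlim_compose[OF tendsto_power_div_exp_0])
  then have "(\<lambda>n. K * (D / c) ^ p * ((c * real n) ^ p / exp (c * real n))) \<longlonglongrightarrow> K * (D / c) ^ p * 0"
    by (intro tendsto_mult tendsto_const)
  moreover have "K * (D / c) ^ p * ((c * real n) ^ p / exp (c * real n)) = K * exp (- c * real n) * (D * real n) ^ p" for n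
    using assms by (simp add: power_mult_distrib power_divide exp_minus field_simps)
  ultimately show ?thesis
    by simp
qed

text \<open>Diagonal choice of a null sequence: \<open>\<epsilon> n = 1 / (m + 1)\<close> for the largest \<open>m < n\<close> whose
  threshold has been passed.\<close>

lemma ex_null_sequence:
  fixes f :: "real \<Rightarrow> nat \<Rightarrow> real"
  assumes le1: "\<And>\<epsilon> n. f \<epsilon> n \<le> 1"
    and ev: "\<And>\<epsilon> \<eta>. \<epsilon> > 0 \<Longrightarrow> \<eta> > 0 \<Longrightarrow> \<exists>n0. \<forall>n\<ge>n0. S n \<longrightarrow> f \<epsilon> n \<ge> 1 - \<eta>"
  shows "\<exists>\<epsilon> :: nat \<Rightarrow> real. \<epsilon> \<longlonglongrightarrow> 0 \<and> ((\<lambda>n. f (\<epsilon> n) n) \<longlongrightarrow> 1) (inf sequentially (principal {n. S n}))"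
proof -
  have "\<forall>m. \<exists>n0. \<forall>n\<ge>n0. S n \<longrightarrow> f (1 / real (Suc m)) n \<ge> 1 - 1 / real (Suc m)"
    using ev by simp
  then obtain N where N: "\<And>m n. n \<ge> N m \<Longrightarrow> S n \<Longrightarrow> f (1 / real (Suc m)) n \<ge> 1 - 1 / real (Suc m)"
    by metis
  \<comment> \<open>The clause \<open>m < n\<close> keeps the set finite even if all thresholds are
    passed. For small \<open>n\<close> it may be empty and its \<open>Max\<close> unspecified, which
    does not affect the limits.\<close>
  define A where "A n = {m. m < n \<and> N m \<le> n}" for n
  define g where "g n = Max (A n)" for n
  define \<epsilon> where "\<epsilon> n = 1 / real (Suc (g n))" for n
  have finA: "finite (A n)" for n
    by (simp add: A_def)
  have large: "m \<le> g n \<and> N (g n) \<le> n" if "n \<ge> max (Suc m) (N m)" for m n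
  proof -
    have m: "m \<in> A n"
      using that by (simp add: A_def)
    then have "g n \<in> A n"
      unfolding g_def using finA by (intro Max_in) auto
    then show ?thesis
      using m finA by (simp add: g_def A_def)
  qed
  have small: "\<exists>m. 1 / real (Suc m) < e" if "e > 0" for e :: real
    using reals_Archimedean[OF that] by (simp add: inverse_eq_divide)
  have \<epsilon>_le: "\<epsilon> n \<le> 1 / real (Suc m)" if "n \<ge> max (Suc m) (N m)" for m n
    using large[OF that] unfolding \<epsilon>_def by (intro divide_left_mono) auto
  have "\<epsilon> \<longlonglongrightarrow> 0"
  proof (rule LIMSEQ_I)
    fix e :: real assume "e > 0"
    then obtain m where "1 / real (Suc m) < e"
      using small by blast
    then have "norm (\<epsilon> n - 0) < e" if "n \<ge> max (Suc m) (N m)" for n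
      using \<epsilon>_le[OF that] by (simp add: \<epsilon>_def)
    then show "\<exists>no. \<forall>n\<ge>no. norm (\<epsilon> n - 0) < e"
      by blast
  qed
  moreover have "((\<lambda>n. f (\<epsilon> n) n) \<longlongrightarrow> 1) (inf sequentially (principal {n. S n}))"
  proof (rule tendstoI)
    fix e :: real assume "e > 0"
    then obtain m where m: "1 / real (Suc m) < e"
      using small by blast
    have "dist (f (\<epsilon> n) n) 1 < e" if "n \<ge> max (Suc m) (N m)" "S n" for n
    proof -
      have "f (\<epsilon> n) n \<ge> 1 - \<epsilon> n"
        using N[of "g n" n] large[OF that(1)] that(2) by (simp add: \<epsilon>_def)
      then show ?thesis
        using le1[of "\<epsilon> n" n] \<epsilon>_le[OF that(1)] m by (simp add: dist_real_def)
    qed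
    then show "\<forall>\<^sub>F n in inf sequentially (principal {n. S n}). dist (f (\<epsilon> n) n) 1 < e"
      unfolding eventually_inf_principal eventually_sequentially by blast
  qed
  ultimately show ?thesis
    by blast
qed

text \<open>The limit runs along those \<open>n\<close> for which \<open>d n\<close> is a degree
  profile; for other \<open>n\<close> the divisibility by \<open>k\<close> may fail. The sequence
  \<epsilon> is the o(1) term.\<close>

theorem theorem1:
  fixes k \<Delta> :: nat and \<zeta> :: "nat \<Rightarrow> real" and d :: "nat \<Rightarrow> nat \<Rightarrow> nat"
  assumes "k \<ge> 2" and "\<Delta> \<ge> 2"
    and "\<And>i. i \<in> {1..\<Delta>} \<Longrightarrow> \<zeta> i \<ge> 0"
    and "\<zeta> \<Delta> > 0"
    and "(\<Sum>i=1..\<Delta>. \<zeta> i) = 1"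
  shows "(\<exists>!\<alpha>. is_end_root k \<Delta> \<zeta> \<alpha>) \<and>
    (\<forall>n. \<forall>H\<in>hypergraphs n k \<Delta> (d n). \<forall>M\<in>set_pmf (random_greedy H). is_matching H M) \<and>
    (\<exists>\<epsilon> :: nat \<Rightarrow> real. \<epsilon> \<longlonglongrightarrow> 0 \<and>
      ((\<lambda>n. measure_pmf.prob (bind_pmf (random_hypergraph n k \<Delta> (d n)) random_greedy)
          {M. \<bar>real (card (uncovered n M)) - P_fun \<Delta> \<zeta> (alpha_end k \<Delta> \<zeta>) * real n\<bar>
                \<le> \<epsilon> n * real n})
        \<longlongrightarrow> 1) (inf sequentially (principal {n. degree_profile k \<Delta> \<zeta> n (d n)})))"
proof -
  interpret degree_distribution k \<Delta> \<zeta>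
    using assms by unfold_locales auto
  define p where "p n = bind_pmf (random_hypergraph n k \<Delta> (d n)) random_greedy" for n
  define f where "f \<epsilon> n = measure_pmf.prob (p n) {M. \<bar>real (card (uncovered n M)) -
    P_fun \<Delta> \<zeta> (alpha_end k \<Delta> \<zeta>) * real n\<bar> \<le> \<epsilon> * real n}" for \<epsilon> n
  have f_eq: "f \<epsilon> n = 1 - measure_pmf.prob (p n) (bad_matchings n \<epsilon>)" for \<epsilon> n
  proof -
    have "{M. \<bar>real (card (uncovered n M)) - P_fun \<Delta> \<zeta> (alpha_end k \<Delta> \<zeta>) * real n\<bar> \<le> \<epsilon> * real n} =
        space (measure_pmf (p n)) - bad_matchings n \<epsilon>"
      by (auto simp: bad_matchings_def P_fun_eq_P_coeff \<alpha>_0)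
    then show ?thesis
      unfolding f_def by (simp only:) (simp add: measure_pmf.prob_compl del: space_measure_pmf)
  qed
  have "\<exists>\<epsilon> :: nat \<Rightarrow> real. \<epsilon> \<longlonglongrightarrow> 0 \<and> ((\<lambda>n. f (\<epsilon> n) n) \<longlongrightarrow> 1)
      (inf sequentially (principal {n. degree_profile k \<Delta> \<zeta> n (d n)}))"
  proof (rule ex_null_sequence)
    show "f \<epsilon> n \<le> 1" for \<epsilon> n
      by (simp add: f_def)
    show "\<exists>n0. \<forall>n\<ge>n0. degree_profile k \<Delta> \<zeta> n (d n) \<longrightarrow> f \<epsilon> n \<ge> 1 - \<eta>"
      if \<epsilon>: "\<epsilon> > 0" and \<eta>: "\<eta> > 0" for \<epsilon> \<eta>
    proof -
      obtain K c n0 where K: "K > 0" "c > 0" and bound: "\<And>n d. n \<ge> n0 \<Longrightarrow> degree_profile k \<Delta> \<zeta> n d \<Longrightarrow>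
        measure_pmf.prob (bind_pmf (random_hypergraph n k \<Delta> d) random_greedy) (bad_matchings n \<epsilon>)
          \<le> K * exp (- c * n) * (real \<Delta> * real n) ^ (2 * (k * \<Delta>)\<^sup>2)"
        using prob_bad_le[OF \<epsilon>] by blast
      obtain n1 where n1: "\<And>n. n \<ge> n1 \<Longrightarrow> norm (K * exp (- c * n) * (real \<Delta> * real n) ^ (2 * (k * \<Delta>)\<^sup>2) - 0) < \<eta>"
        using LIMSEQ_D[OF exp_decay_times_power[OF K(2)] \<eta>] by blast
      have "f \<epsilon> n \<ge> 1 - \<eta>" if "n \<ge> max n0 n1" "degree_profile k \<Delta> \<zeta> n (d n)" for n
        using bound[of n "d n"] n1[of n] that unfolding f_eq p_def by simp
      then show ?thesis
        by blast
    qed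
  qed
  moreover have "\<forall>n. \<forall>H\<in>hypergraphs n k \<Delta> (d n). \<forall>M\<in>set_pmf (random_greedy H). is_matching H M"
    using random_greedy_is_matching assms(1) by fastforce
  ultimately show ?thesis
    using ex1_end_root unfolding f_def p_def by blast
qed

end
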